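(* Let $n\ge 2$, $w\in W_{\mathrm{af}}$ and $m\ge 1$. Then in $H^*(\widetilde{Fl})$ we have $$\xi^{\omega(\rho_m)}\,\xi^w=\sum_S \xi^{\omega(\mathrm{inside}(S))},$$ where the sum runs over all strong strips $S$ of size $m$ such that $\mathrm{outside}(S)=\omega(w)$.
   Context: Fix an integer $n\ge 2$. $W_{\mathrm{af}}$ is the affine symmetric group (the affine Weyl group of type $\widetilde A_{n-1}$), with simple generators $s_0,s_1,\dots,s_{n-1}$ (indices modulo $n$), length function $\ell$ and Bruhat (strong) order; $v\lessdot u$ means $v<u$ and $\ell(v)=\ell(u)-1$. It is realized as the group of bijections $w:\mathbb Z\to\mathbb Z$ with $w(x+n)=w(x)+n$ for all $x$ and $\sum_{x=1}^n w(x)=n(n+1)/2$, with product given by composition; $s_i$ exchanges $i+kn$ and $i+1+kn$ for all $k\in\mathbb Z$. For $i<j$ with $i\not\equiv j \pmod n$, $t_{ij}\in W_{\mathrm{af}}$ is the reflection exchanging $i+kn$ and $j+kn$ for all $k\in\mathbb Z$. For $m\ge1$, $\rho_m=s_{m-1}s_{m-2}\cdots s_1s_0$, indices modulo $n$. $\omega:W_{\mathrm{af}}\to W_{\mathrm{af}}$ is the group automorphism with $s_i\mapsto s_{n-i}$ (indices modulo $n$). Strong strips: a marked strong cover $u\overset{a}{\longrightarrow}v$ consists of $u,v\in W_{\mathrm{af}}$ and an integer $a$ such that $u=vt_{ij}$, $v\lessdot u$ and $a=u(j)=v(i)$ for some integers $i\le 0<j$. A strong strip $S$ of size $m$ from $u$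 to $v$ is a path of marked strong covers $u\overset{a_1}{\longrightarrow}u_1\overset{a_2}{\longrightarrow}\cdots\overset{a_m}{\longrightarrow}u_m=v$ with $a_1>a_2>\cdots>a_m$ (markings are part of the data, so strips with different markings are distinct); $\mathrm{inside}(S)=u$ and $\mathrm{outside}(S)=v$. Cohomology of the affine flag variety: $\widetilde{Fl}=G_{\mathrm{af}}/B_{\mathrm{af}}$ is the Kac–Moody flag ind-variety of the affine Kac–Moody group $G_{\mathrm{af}}$ associated with $SL(n)$, $B_{\mathrm{af}}$ its Borel subgroup, paved by the cells $B_{\mathrm{af}}\dot wB_{\mathrm{af}}/B_{\mathrm{af}}\cong\mathbb C^{\ell(w)}$, $w\in W_{\mathrm{af}}$; $\{\xi^w\mid w\in W_{\mathrm{af}}\}$ is the Schubert basis of $H^*(\widetilde{Fl})=H^*(\widetilde{Fl},\mathbb Z)$. By Kostant–Kumar, this ring is the free abelian group on the $\xi^w$ with product $\xi^u\xi^v=\sum_w\phi(p^w_{u,v})\xi^w$, where the integers $\phi(p^w_{u,v})$ are as follows. Let $P=\mathbb Z^n/\mathbb Z(1,\dots,1)$ be the weight lattice of $SL(n)$, with $e_i$ the images of the standard basis vectors, $\alpha_i=e_i-e_{i+1}$ for $1\le i\le n-1$, $\theta=e_1-e_n$, and $\alpha_0:=-\theta$. $W_{\mathrm{af}}$ acts on $P$ by the level zero action: $s_i$ ($1\le i\le n-1$) is the reflection in $\alpha_i$ and $s_0$ acts as the reflection in $\theta$. Let $S=\mathrm{Sym}(P)$, $F=\mathrm{Frac}(S)$,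 and let $F_{W_{\mathrm{af}}}=\bigoplus_{w\in W_{\mathrm{af}}}Fw$ with product $(pv)(qw)=(p\,(v\cdot q))(vw)$ for $p,q\in F$. Put $A_i=\alpha_i^{-1}(1-s_i)$ for $i\in\mathbb Z/n\mathbb Z$, and $A_w=A_{i_1}\cdots A_{i_r}$ for any reduced word $w=s_{i_1}\cdots s_{i_r}$ (well defined; the $A_w$ form a left $F$-basis). Let $\Delta:F_{W_{\mathrm{af}}}\to F_{W_{\mathrm{af}}}\otimes_F F_{W_{\mathrm{af}}}$ (tensor product of left $F$-vector spaces) be the left $F$-linear map with $\Delta(w)=w\otimes w$. Then $p^w_{u,v}\in S$ is defined by $\Delta(A_w)=\sum_{u,v}p^w_{u,v}A_u\otimes A_v$ and is homogeneous of degree $\ell(u)+\ell(v)-\ell(w)$; $\phi:S\to\mathbb Z$ takes the constant term. *)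

theory Defs
  imports
    "HOL-Library.Poly_Mapping"
    "HOL-Library.FuncSet"
    "HOL-Computational_Algebra.Fraction_Field"
    "HOL-Number_Theory.Cong"
begin

section \<open>The affine symmetric group\<close>

definition W_af :: "nat \<Rightarrow> (int \<Rightarrow> int) set" where
  "W_af n = {w. bij w \<and> (\<forall>x. w (x + int n) = w x + int n) \<and>
               (\<Sum>x = 1..int n. w x) = int n * (int n + 1) div 2}"

text \<open>The reflection exchanging \<open>i + k n\<close> and \<open>j + k n\<close> for all \<open>k\<close>; only meaningful if \<open>i\<close> and
  \<open>j\<close> are incongruent modulo \<open>n\<close>.\<close>

definition refl_af :: "nat \<Rightarrow> int \<Rightarrow> int \<Rightarrow> int \<Rightarrow> int" where
  "refl_af n i j x =
     (if [x = i] (mod int n) then x + (j - i)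
      else if [x = j] (mod int n) then x - (j - i)
      else x)"

text \<open>The index of a simple generator is an arbitrary integer, read modulo \<open>n\<close>.\<close>

definition s_af :: "nat \<Rightarrow> int \<Rightarrow> int \<Rightarrow> int" where
  "s_af n i = refl_af n i (i + 1)"

definition word_prod :: "nat \<Rightarrow> int list \<Rightarrow> int \<Rightarrow> int" where
  "word_prod n is = foldr (\<lambda>i g. s_af n i \<circ> g) is id"

definition len_af :: "nat \<Rightarrow> (int \<Rightarrow> int) \<Rightarrow> nat" where
  "len_af n w = (LEAST l. \<exists>is. length is = l \<and> word_prod n is = w)"

definition reduced_word :: "nat \<Rightarrow> (int \<Rightarrow> int) \<Rightarrow> int list \<Rightarrow> bool" where
  "reduced_word n w is \<longleftrightarrow> word_prod n is = w \<and> length is = len_af n w"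

definition bruhat_step :: "nat \<Rightarrow> (int \<Rightarrow> int) \<Rightarrow> (int \<Rightarrow> int) \<Rightarrow> bool" where
  "bruhat_step n v u \<longleftrightarrow>
     v \<in> W_af n \<and> u \<in> W_af n \<and> len_af n v < len_af n u \<and>
     (\<exists>i j. i < j \<and> \<not> [i = j] (mod int n) \<and> u = v \<circ> refl_af n i j)"

definition bruhat_less :: "nat \<Rightarrow> (int \<Rightarrow> int) \<Rightarrow> (int \<Rightarrow> int) \<Rightarrow> bool" where
  "bruhat_less n = (bruhat_step n)\<^sup>+\<^sup>+"

definition bruhat_cover :: "nat \<Rightarrow> (int \<Rightarrow> int) \<Rightarrow> (int \<Rightarrow> int) \<Rightarrow> bool" where
  "bruhat_cover n v u \<longleftrightarrow> bruhat_less n v u \<and> len_af n u = len_af n v + 1"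

definition rho_af :: "nat \<Rightarrow> nat \<Rightarrow> int \<Rightarrow> int" where
  "rho_af n m = word_prod n (rev (map int [0..<m]))"

definition is_omega :: "nat \<Rightarrow> ((int \<Rightarrow> int) \<Rightarrow> (int \<Rightarrow> int)) \<Rightarrow> bool" where
  "is_omega n f \<longleftrightarrow>
     bij_betw f (W_af n) (W_af n) \<and>
     (\<forall>u\<in>W_af n. \<forall>v\<in>W_af n. f (u \<circ> v) = f u \<circ> f v) \<and>
     (\<forall>i. f (s_af n i) = s_af n (int n - i))"

text \<open>Existence and uniqueness are proved below (\<open>ex1_omega\<close>, \<open>omega_af_eq\<close>).\<close>

definition omega_af :: "nat \<Rightarrow> (int \<Rightarrow> int) \<Rightarrow> (int \<Rightarrow> int)" where
  "omega_af n = (THE f. f \<in> extensional (W_af n) \<and> is_omega n f)"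


lemma sum_residues:
  fixes d :: "int \<Rightarrow> int"
  assumes n: "n > 0" and d: "\<And>x. d (x mod int n) = d x"
    and inj: "inj_on (\<lambda>x. x mod int n) A" and A: "finite A" "card A = n"
  shows "sum d A = sum d {0..<int n}"
proof -
  have "(\<lambda>x. x mod int n) ` A = {0..<int n}"
    by (rule card_subset_eq) (use n A inj in \<open>auto simp: card_image\<close>)
  then have "sum d {0..<int n} = (\<Sum>x\<in>A. d (x mod int n))"
    using inj by (metis (mono_tags, lifting) sum.reindex_cong)
  then show ?thesis by (simp add: d)
qed

lemma inj_on_mod_interval: "inj_on (\<lambda>x. x mod int n) {a..<a + int n}"
proof (rule inj_onI)
  fix x y assume xy: "x \<in> {a..<a + int n}" "y \<in> {a..<a + int n}" and eq: "x mod int n = y mod int n"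
  then have "int n dvd x - y" by (simp add: mod_eq_dvd_iff)
  moreover have "\<bar>x - y\<bar> < int n" using xy by auto
  ultimately show "x = y" using zdvd_not_zless[of "\<bar>x - y\<bar>" "int n"] by auto
qed

lemma sum_interval_residues:
  fixes d :: "int \<Rightarrow> int"
  assumes "n > 0" and "\<And>x. d (x mod int n) = d x"
  shows "sum d {a..<a + int n} = sum d {0..<int n}"
  using assms by (intro sum_residues inj_on_mod_interval) auto

lemma periodic_mult:
  fixes w :: "int \<Rightarrow> int"
  assumes "\<And>x. w (x + int n) = w x + int n"
  shows "w (x + k * int n) = w x + k * int n"
proof -
  have nn: "w (x + int m * int n) = w x + int m * int n" for m x
  proof (induction m)
    case (Suc m)
    have "w (x + int (Suc m) * int n) = w ((x + int m * int n) + int n)" by (simp add: algebra_simps)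
    also have "\<dots> = w x + int (Suc m) * int n" by (simp only: assms Suc) (simp add: algebra_simps)
    finally show ?case .
  qed simp
  show ?thesis
  proof (cases "k \<ge> 0")
    case True then show ?thesis using nn[of x "nat k"] by simp
  next
    case False
    then show ?thesis using nn[of "x + k * int n" "nat (-k)"] by simp
  qed
qed

lemma periodic_mod:
  fixes w :: "int \<Rightarrow> int"
  assumes "\<And>x. w (x + int n) = w x + int n"
  shows "w (x mod int n) - x mod int n = w x - x"
  using periodic_mult[of w n, OF assms, of "x mod int n" "x div int n"]
  by (simp add: algebra_simps)

lemma W_af_iff:
  assumes "n > 0"
  shows "w \<in> W_af n \<longleftrightarrow> bij w \<and> (\<forall>x. w (x + int n) = w x + int n) \<and>
    (\<Sum>x\<in>{0..<int n}. w x - x) = 0"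
proof (cases "bij w \<and> (\<forall>x. w (x + int n) = w x + int n)")
  case True
  have "(\<Sum>x = 1..int n. x) = int n * (int n + 1) div 2" for n
  proof (induction n)
    case (Suc n)
    have "{1..int (Suc n)} = insert (1 + int n) {1..int n}" by auto
    then show ?case using Suc by (simp add: algebra_simps)
  qed simp
  moreover have "(\<Sum>x\<in>{1..<1 + int n}. w x - x) = (\<Sum>x\<in>{0..<int n}. w x - x)"
    using True assms by (intro sum_interval_residues) (auto intro: periodic_mod)
  moreover have "{1..<1 + int n} = {1..int n}" by auto
  ultimately show ?thesis using True by (auto simp: W_af_def sum_subtractf)
qed (auto simp: W_af_def)

lemma W_afD:
  assumes "w \<in> W_af n"
  shows "bij w" "w (x + int n) = w x + int n" "w (x + k * int n) = w x + k * int n"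
    "w (x mod int n) - x mod int n = w x - x"
  using assms by (auto simp: W_af_def intro: periodic_mult periodic_mod)

lemma W_af_cong:
  assumes "w \<in> W_af n"
  shows "[w x = w y] (mod int n) \<longleftrightarrow> [x = y] (mod int n)"
proof
  assume "[x = y] (mod int n)"
  then obtain k where "x = y + k * int n" by (metis cong_iff_lin cong_sym mult.commute)
  then show "[w x = w y] (mod int n)" by (simp add: W_afD[OF assms] cong_def)
next
  assume "[w x = w y] (mod int n)"
  then obtain k where "w x = w y + k * int n" by (metis cong_iff_lin cong_sym mult.commute)
  also have "\<dots> = w (y + k * int n)" by (simp add: W_afD[OF assms])
  finally have "x = y + k * int n" using W_afD(1)[OF assms] by (simp add: bij_def inj_eq)
  then show "[x = y] (mod int n)" by (simp add: cong_def)
qed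

lemma id_in_W_af: "n > 0 \<Longrightarrow> id \<in> W_af n"
  by (simp add: W_af_iff)

lemma comp_in_W_af:
  assumes n: "n > 0" and u: "u \<in> W_af n" and v: "v \<in> W_af n"
  shows "u \<circ> v \<in> W_af n"
proof -
  let ?d = "\<lambda>x. u x - x"
  have inj: "inj_on (\<lambda>x. x mod int n) (v ` {0..<int n})"
  proof (rule inj_onI, clarify)
    fix x y assume xy: "x \<in> {0..<int n}" "y \<in> {0..<int n}" "v x mod int n = v y mod int n"
    then have "[x = y] (mod int n)" using W_af_cong[OF v] by (simp add: cong_def)
    then show "v x = v y" using xy by (simp add: cong_def)
  qed
  have injv: "inj v" using W_afD(1)[OF v] by (simp add: bij_def)
  have "(\<Sum>x\<in>{0..<int n}. ?d (v x)) = sum ?d (v ` {0..<int n})"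
    using injv by (subst sum.reindex) (auto simp: inj_on_def inj_def)
  also have "\<dots> = sum ?d {0..<int n}"
    using injv by (intro sum_residues[OF n _ inj]) (auto simp: W_afD[OF u] card_image inj_on_def inj_def)
  also have "\<dots> = 0" using u n by (simp add: W_af_iff)
  finally have "(\<Sum>x\<in>{0..<int n}. (u (v x) - v x) + (v x - x)) = 0"
    using v n unfolding sum.distrib by (simp add: W_af_iff)
  then show ?thesis
    using n u v by (simp add: W_af_iff bij_comp)
qed

lemma s_af_invol:
  assumes "n \<ge> 2"
  shows "s_af n i (s_af n i x) = x"
proof -
  have ne: "\<not> [i + 1 = i] (mod int n)"
    using assms zdvd_not_zless[of 1 "int n"] by (simp add: cong_iff_dvd_diff)
  have a: "[x = i] (mod int n) \<Longrightarrow> [x + 1 = i + 1] (mod int n)"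
    by (simp add: cong_add)
  have b: "[x = i + 1] (mod int n) \<Longrightarrow> [x - 1 = i] (mod int n)"
    using cong_diff[of x "i + 1" "int n" 1 1] by simp
  show ?thesis
    using a b ne by (auto simp: s_af_def refl_af_def) (metis cong_sym cong_trans)+
qed

lemma s_af_shift: "s_af n i (x + int n) = s_af n i x + int n"
  by (auto simp: s_af_def refl_af_def cong_def)

lemma s_af_simps:
  assumes "n \<ge> 2"
  shows "s_af n i i = i + 1" "s_af n i (i + 1) = i"
    "x \<in> {i + 2..<i + int n} \<Longrightarrow> s_af n i x = x"
proof -
  show 1: "s_af n i i = i + 1" by (simp add: s_af_def refl_af_def)
  show "s_af n i (i + 1) = i" using s_af_invol[OF assms, of i i] 1 by simp
  assume x: "x \<in> {i + 2..<i + int n}"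
  have "\<not> [x = i] (mod int n)" "\<not> [x = i + 1] (mod int n)"
    using x assms inj_on_mod_interval[of n i] unfolding cong_def inj_on_def by (force)+
  then show "s_af n i x = x" by (simp add: s_af_def refl_af_def)
qed

lemma interval_split2: "n \<ge> 2 \<Longrightarrow> {i..<i + int n} = insert i (insert (i + 1) {i + 2..<i + int n})"
  by auto

lemma s_af_in_W_af:
  assumes "n \<ge> 2"
  shows "s_af n i \<in> W_af n"
proof -
  have "bij (s_af n i)" by (rule o_bij[of "s_af n i"]) (auto simp: fun_eq_iff s_af_invol[OF assms])
  moreover have "(\<Sum>x\<in>{i..<i + int n}. s_af n i x - x) = (\<Sum>x\<in>{0..<int n}. s_af n i x - x)"
    using assms by (intro sum_interval_residues) (auto intro: periodic_mod s_af_shift)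
  moreover have "(\<Sum>x\<in>{i..<i + int n}. s_af n i x - x) = 0"
    unfolding interval_split2[OF assms] by (simp add: s_af_simps[OF assms])
  ultimately show ?thesis using assms by (simp add: W_af_iff s_af_shift)
qed

lemma s_af_period: "s_af n (i + int n) = s_af n i"
proof -
  have "[x = i + int n] (mod int n) \<longleftrightarrow> [x = i] (mod int n)"
    "[x = i + int n + 1] (mod int n) \<longleftrightarrow> [x = i + 1] (mod int n)" for x
    using mod_add_self2[of "i + 1" "int n"] unfolding cong_def by (simp_all add: add.commute add.left_commute)
  then show ?thesis by (simp add: s_af_def refl_af_def fun_eq_iff)
qed

lemma word_prod_in_W_af: "n \<ge> 2 \<Longrightarrow> word_prod n is \<in> W_af n"
  by (induction "is") (auto simp: word_prod_def id_in_W_af intro!: comp_in_W_af s_af_in_W_af)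

lemma word_prod_append: "word_prod n (is @ js) = word_prod n is \<circ> word_prod n js"
  by (induction "is") (simp_all add: word_prod_def comp_assoc)

lemma W_af_increasing:
  assumes n: "n > 0" and w: "w \<in> W_af n" and inc: "\<And>i. w i < w (i + 1)"
  shows "w = id"
proof -
  define d where "d x = w x - x" for x
  have step: "d x \<le> d (x + 1)" for x using inc[of x] by (simp add: d_def)
  have mono: "d x \<le> d (x + int k)" for x k
  proof (induction k)
    case (Suc k) then show ?case using step[of "x + int k"] by (simp add: algebra_simps)
  qed simp
  have per: "d (x mod int n) = d x" for x by (simp add: d_def W_afD[OF w])
  have const: "d x = d 0" if "x \<in> {0..<int n}" for x
  proof -
    have "d 0 \<le> d x" using mono[of 0 "nat x"] that by simp
    moreover have "d x \<le> d (int n)" using mono[of x "nat (int n - x)"] that by simp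
    moreover have "d (int n) = d 0" using per[of "int n"] by simp
    ultimately show ?thesis by simp
  qed
  have "(\<Sum>x\<in>{0..<int n}. d x) = (\<Sum>x\<in>{0..<int n}. d 0)" by (intro sum.cong refl const)
  moreover have "(\<Sum>x\<in>{0..<int n}. d x) = 0" using w n by (simp add: W_af_iff d_def)
  ultimately have "d 0 = 0" using n by simp
  then have "d x = 0" for x
    using const[of "x mod int n"] per[of x] n by (metis atLeastLessThan_iff of_nat_0_less_iff pos_mod_bound pos_mod_sign)
  then show ?thesis by (auto simp: d_def fun_eq_iff)
qed

lemma W_af_generated:
  assumes n: "n \<ge> 2" and "w \<in> W_af n"
  shows "\<exists>is. word_prod n is = w"
  using assms(2)
proof (induction "nat (\<Sum>x\<in>{0..<int n}. (w x - x)\<^sup>2)" arbitrary: w rule: less_induct)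
  case less
  have n0: "n > 0" using n by simp
  show ?case
  proof (cases "\<forall>i. w i < w (i + 1)")
    case True
    then have "w = id" using W_af_increasing[OF n0 less.prems] by blast
    then show ?thesis by (intro exI[of _ "[]"]) (simp add: word_prod_def)
  next
    case False
    then obtain i where i: "\<not> w i < w (i + 1)" by blast
    have "w i \<noteq> w (i + 1)" using W_afD(1)[OF less.prems] by (simp add: bij_def inj_eq)
    with i have i: "w (i + 1) < w i" by simp
    let ?v = "w \<circ> s_af n i"
    have v: "?v \<in> W_af n" using n0 less.prems s_af_in_W_af[OF n] by (intro comp_in_W_af)
    have eq: "(\<Sum>x\<in>{0..<int n}. (u x - x)\<^sup>2) =
        (u i - i)\<^sup>2 + ((u (i + 1) - (i + 1))\<^sup>2 + (\<Sum>x\<in>{i + 2..<i + int n}. (u x - x)\<^sup>2))"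
      if u: "u \<in> W_af n" for u
    proof -
      have "(\<Sum>x\<in>{i..<i + int n}. (u x - x)\<^sup>2) = (\<Sum>x\<in>{0..<int n}. (u x - x)\<^sup>2)"
        by (rule sum_interval_residues[OF n0]) (simp add: W_afD[OF u])
      then show ?thesis unfolding interval_split2[OF n] by simp
    qed
    have "(\<Sum>x\<in>{i + 2..<i + int n}. (?v x - x)\<^sup>2) = (\<Sum>x\<in>{i + 2..<i + int n}. (w x - x)\<^sup>2)"
      by (intro sum.cong) (auto simp: s_af_simps[OF n])
    moreover have "(w (i + 1) - i)\<^sup>2 + (w i - (i + 1))\<^sup>2 < (w i - i)\<^sup>2 + (w (i + 1) - (i + 1))\<^sup>2"
      using i by (simp add: power2_eq_square algebra_simps)
    ultimately have "(\<Sum>x\<in>{0..<int n}. (?v x - x)\<^sup>2) < (\<Sum>x\<in>{0..<int n}. (w x - x)\<^sup>2)"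
      unfolding eq[OF v] eq[OF less.prems] by (simp add: s_af_simps[OF n])
    moreover have "0 \<le> (\<Sum>x\<in>{0..<int n}. (?v x - x)\<^sup>2)" by (simp add: sum_nonneg)
    ultimately obtain js where js: "word_prod n js = ?v" using less.hyps[OF _ v] by auto
    have "word_prod n (js @ [i]) = w"
      unfolding word_prod_append js by (simp add: word_prod_def fun_eq_iff s_af_invol[OF n])
    then show ?thesis by blast
  qed
qed

lemma flip_in_W_af:
  assumes n: "n > 0" and w: "w \<in> W_af n"
  shows "(\<lambda>x. 1 - w (1 - x)) \<in> W_af n"
proof -
  have per: "1 - w (1 - (x + int n)) = 1 - w (1 - x) + int n" for x
    using W_afD(3)[OF w, of "1 - x" "-1"] by (simp add: algebra_simps)
  have "bij (\<lambda>x::int. 1 - x)" by (rule o_bij[of "\<lambda>x. 1 - x"]) auto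
  then have "bij ((\<lambda>x. 1 - x) \<circ> w \<circ> (\<lambda>x. 1 - x))" using W_afD(1)[OF w] by (intro bij_comp)
  then have bij: "bij (\<lambda>x. 1 - w (1 - x))" by (simp add: comp_def)
  have "(\<Sum>x\<in>{0..<int n}. w (1 - x) - (1 - x)) = (\<Sum>x\<in>(\<lambda>x. 1 - x) ` {0..<int n}. w x - x)"
    by (subst sum.reindex) (auto simp: inj_on_def)
  also have "(\<lambda>x. 1 - x) ` {0..<int n} = {2 - int n..<2 - int n + int n}"
    by (auto simp: image_iff)
  also have "(\<Sum>x\<in>\<dots>. w x - x) = (\<Sum>x\<in>{0..<int n}. w x - x)"
    by (rule sum_interval_residues[OF n]) (simp add: W_afD[OF w])
  also have "\<dots> = 0" using n w by (simp add: W_af_iff)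
  finally have "(\<Sum>x\<in>{0..<int n}. - (w (1 - x) - (1 - x))) = 0" unfolding sum_negf by simp
  then have "(\<Sum>x\<in>{0..<int n}. (1 - w (1 - x)) - x) = 0" by (simp add: algebra_simps)
  then show ?thesis using n bij per by (simp add: W_af_iff)
qed

lemma is_omega_unique:
  assumes n: "n \<ge> 2" and f: "is_omega n f" and g: "is_omega n g" and w: "w \<in> W_af n"
  shows "f w = g w"
proof -
  have id: "h id = id" if h: "is_omega n h" for h
  proof -
    have 1: "id \<in> W_af n" using n by (simp add: id_in_W_af)
    then have "h id \<in> W_af n" using h by (auto simp: is_omega_def bij_betw_def)
    then have "inj (h id)" by (auto simp: W_af_def bij_def)
    moreover have "h (id \<circ> id) = h id \<circ> h id" using h 1 unfolding is_omega_def by blast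
    ultimately show ?thesis by (auto simp: fun_eq_iff inj_eq)
  qed
  have "f (word_prod n is) = g (word_prod n is)" for "is"
  proof (induction "is")
    case Nil then show ?case using id[OF f] id[OF g] by (simp add: word_prod_def id_def)
  next
    case (Cons i "is")
    have "h (word_prod n (i # is)) = s_af n (int n - i) \<circ> h (word_prod n is)" if "is_omega n h" for h
      using that s_af_in_W_af[OF n] word_prod_in_W_af[OF n] by (simp add: is_omega_def word_prod_def)
    then show ?case using f g Cons by metis
  qed
  then show ?thesis using W_af_generated[OF n w] by blast
qed

lemma is_omega_flip:
  assumes n: "n \<ge> 2"
  shows "is_omega n (\<lambda>w x. 1 - w (1 - x))"
proof -
  have "bij_betw (\<lambda>w x. 1 - w (1 - x)) (W_af n) (W_af n)"
    by (rule bij_betw_byWitness[where f' = "\<lambda>w x. 1 - w (1 - x)"]) (use n flip_in_W_af in auto)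
  moreover have "(\<lambda>x. 1 - s_af n i (1 - x)) = s_af n (int n - i)" for i
  proof -
    have "s_af n (int n - i) = s_af n (- i)" using s_af_period[of n "- i"] by (simp add: add.commute)
    moreover have "[1 - x = i] (mod int n) \<longleftrightarrow> [x = - i + 1] (mod int n)"
      "[1 - x = i + 1] (mod int n) \<longleftrightarrow> [x = - i] (mod int n)" for x
      unfolding cong_iff_dvd_diff by (subst dvd_minus_iff[symmetric], simp add: algebra_simps)+
    moreover have "\<not> ([x = - i] (mod int n) \<and> [x = - i + 1] (mod int n))" for x
    proof
      assume "[x = - i] (mod int n) \<and> [x = - i + 1] (mod int n)"
      then have "[- i + 1 = - i] (mod int n)" using cong_sym cong_trans by blast
      then show False using n zdvd_not_zless[of 1 "int n"] by (simp add: cong_iff_dvd_diff)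
    qed
    ultimately show ?thesis by (auto simp: s_af_def refl_af_def fun_eq_iff)
  qed
  ultimately show ?thesis by (simp add: is_omega_def fun_eq_iff)
qed

lemma ex1_omega:
  assumes n: "n \<ge> 2"
  shows "\<exists>!f. f \<in> extensional (W_af n) \<and> is_omega n f"
proof (rule ex1I)
  let ?f = "restrict (\<lambda>w x. 1 - w (1 - x)) (W_af n)"
  have "is_omega n ?f"
    using is_omega_flip[OF n] s_af_in_W_af[OF n] n
    by (auto simp: is_omega_def comp_in_W_af cong: bij_betw_cong)
  then show ex: "?f \<in> extensional (W_af n) \<and> is_omega n ?f" by simp
  fix g assume g: "g \<in> extensional (W_af n) \<and> is_omega n g"
  show "g = ?f"
    by (rule extensionalityI[of _ "W_af n"]) (use g ex is_omega_unique[OF n] in auto)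
qed

lemma omega_af_eq:
  assumes "n \<ge> 2" "w \<in> W_af n"
  shows "omega_af n w = (\<lambda>x. 1 - w (1 - x))"
proof -
  have "is_omega n (omega_af n)"
    using theI'[OF ex1_omega[OF assms(1)]] unfolding omega_af_def by blast
  from is_omega_unique[OF assms(1) this is_omega_flip[OF assms(1)] assms(2)] show ?thesis .
qed


section \<open>Strong strips\<close>

definition marked_cover :: "nat \<Rightarrow> (int \<Rightarrow> int) \<Rightarrow> int \<Rightarrow> (int \<Rightarrow> int) \<Rightarrow> bool" where
  "marked_cover n u a v \<longleftrightarrow>
     u \<in> W_af n \<and> v \<in> W_af n \<and>
     (\<exists>i j. i \<le> 0 \<and> 0 < j \<and> \<not> [i = j] (mod int n) \<and>
        u = v \<circ> refl_af n i j \<and> bruhat_cover n v u \<and> a = u j \<and> a = v i)"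

text \<open>A path \<open>u \<rightarrow> u\<^sub>1 \<rightarrow> \<dots> \<rightarrow> u\<^sub>m\<close> with markings \<open>a\<^sub>1, \<dots>, a\<^sub>m\<close> is the pair of
  \<open>u\<close> and the list \<open>[(a\<^sub>1, u\<^sub>1), \<dots>, (a\<^sub>m, u\<^sub>m)]\<close>.\<close>

type_synonym strip = "(int \<Rightarrow> int) \<times> (int \<times> (int \<Rightarrow> int)) list"

fun marked_path :: "nat \<Rightarrow> (int \<Rightarrow> int) \<Rightarrow> (int \<times> (int \<Rightarrow> int)) list \<Rightarrow> bool" where
  "marked_path n u [] \<longleftrightarrow> u \<in> W_af n"
| "marked_path n u ((a, v) # p) \<longleftrightarrow> marked_cover n u a v \<and> marked_path n v p"

definition strong_strip :: "nat \<Rightarrow> strip \<Rightarrow> bool" where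
  "strong_strip n S \<longleftrightarrow>
     marked_path n (fst S) (snd S) \<and> sorted_wrt (>) (map fst (snd S))"

definition strip_size :: "strip \<Rightarrow> nat" where
  "strip_size S = length (snd S)"

definition inside :: "strip \<Rightarrow> int \<Rightarrow> int" where
  "inside S = fst S"

definition outside :: "strip \<Rightarrow> int \<Rightarrow> int" where
  "outside S = last (fst S # map snd (snd S))"


section \<open>The symmetric algebra of the weight lattice\<close>

text \<open>
  The lattice \<open>P = \<int>\<^sup>n / \<int>(1,\<dots>,1)\<close> is free on \<open>e\<^sub>1, \<dots>, e\<^sub>n\<^sub>-\<^sub>1\<close>, and
  \<open>e\<^sub>n = - (e\<^sub>1 + \<dots> + e\<^sub>n\<^sub>-\<^sub>1)\<close>. So \<open>Sym(P)\<close> is the ring of integer polynomials in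
  \<open>X\<^sub>1, \<dots>, X\<^sub>n\<^sub>-\<^sub>1\<close>, with \<open>X\<^sub>j = e\<^sub>j\<close>. It is realised as the set \<open>Sym n\<close> of those elements of the
  polynomial ring in countably many variables that involve only these variables; \<open>Frac n\<close> is its
  field of fractions, inside the fraction field of the big ring.
\<close>

type_synonym mpol = "(nat \<Rightarrow>\<^sub>0 nat) \<Rightarrow>\<^sub>0 int"

definition Var :: "nat \<Rightarrow> mpol" where
  "Var j = Poly_Mapping.single (Poly_Mapping.single j 1) 1"

definition Sym :: "nat \<Rightarrow> mpol set" where
  "Sym n = {p. \<forall>t\<in>Poly_Mapping.keys p. Poly_Mapping.keys t \<subseteq> {1..<n}}"

definition Frac :: "nat \<Rightarrow> mpol fract set" where
  "Frac n = {Fract a b | a b. a \<in> Sym n \<and> b \<in> Sym n \<and> b \<noteq> 0}"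

text \<open>The index of \<open>e\<close> is read modulo \<open>n\<close>, so that \<open>e\<^sub>0 = e\<^sub>n\<close> and the simple roots, including
  \<open>\<alpha>\<^sub>0 = -\<theta> = e\<^sub>n - e\<^sub>1\<close>, are uniformly \<open>\<alpha>\<^sub>i = e\<^sub>i - e\<^sub>i\<^sub>+\<^sub>1\<close>.\<close>

definition e_wt :: "nat \<Rightarrow> int \<Rightarrow> mpol" where
  "e_wt n i = (let r = nat (i mod int n) in
     if r = 0 then - (\<Sum>j = 1..<n. Var j) else Var r)"

definition alpha_wt :: "nat \<Rightarrow> int \<Rightarrow> mpol" where
  "alpha_wt n i = e_wt n i - e_wt n (i + 1)"

definition subst_pol :: "(nat \<Rightarrow> mpol) \<Rightarrow> mpol \<Rightarrow> mpol" where
  "subst_pol \<sigma> p = (\<Sum>t\<in>Poly_Mapping.keys p.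
     of_int (Poly_Mapping.lookup p t) *
     (\<Prod>j\<in>Poly_Mapping.keys t. \<sigma> j ^ Poly_Mapping.lookup t j))"

text \<open>The level zero action, \<open>w \<cdot> e\<^sub>j = e\<^bsub>w(j)\<^esub>\<close>: translations act trivially, \<open>s\<^sub>i\<close> exchanges
  \<open>e\<^sub>i\<close> and \<open>e\<^sub>i\<^sub>+\<^sub>1\<close>, and \<open>s\<^sub>0\<close> exchanges \<open>e\<^sub>n\<close> and \<open>e\<^sub>1\<close>; see \<open>act_pol_e_wt\<close>, \<open>act_pol_comp\<close>,
  \<open>act_pol_s_af\<close> and \<open>act_frac_Fract\<close> below.\<close>

definition act_pol :: "nat \<Rightarrow> (int \<Rightarrow> int) \<Rightarrow> mpol \<Rightarrow> mpol" where
  "act_pol n w = subst_pol (\<lambda>j. e_wt n (w (int j)))"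

definition act_frac :: "nat \<Rightarrow> (int \<Rightarrow> int) \<Rightarrow> mpol fract \<Rightarrow> mpol fract" where
  "act_frac n w q = (THE r. \<exists>a\<in>Sym n. \<exists>b\<in>Sym n. b \<noteq> 0 \<and> q = Fract a b \<and>
     r = Fract (act_pol n w a) (act_pol n w b))"


lemma poly_mapping_sum_singles:
  "(\<Sum>t\<in>Poly_Mapping.keys p. Poly_Mapping.single t (Poly_Mapping.lookup p t)) = p"
proof (rule poly_mapping_eqI)
  fix t
  have "Poly_Mapping.lookup (\<Sum>t\<in>Poly_Mapping.keys p. Poly_Mapping.single t (Poly_Mapping.lookup p t)) t =
      (\<Sum>s\<in>Poly_Mapping.keys p. if s = t then Poly_Mapping.lookup p s else 0)"
    by (simp add: lookup_sum lookup_single when_def)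
  also have "\<dots> = Poly_Mapping.lookup p t" by (simp add: in_keys_iff)
  finally show "Poly_Mapping.lookup (\<Sum>t\<in>Poly_Mapping.keys p. Poly_Mapping.single t (Poly_Mapping.lookup p t)) t =
      Poly_Mapping.lookup p t" .
qed

lemma subst_pol_superset:
  assumes "finite T" "Poly_Mapping.keys p \<subseteq> T"
  shows "subst_pol \<sigma> p = (\<Sum>t\<in>T. of_int (Poly_Mapping.lookup p t) *
     (\<Prod>j\<in>Poly_Mapping.keys t. \<sigma> j ^ Poly_Mapping.lookup t j))"
  unfolding subst_pol_def
  by (rule sum.mono_neutral_left) (use assms in \<open>auto simp: in_keys_iff\<close>)

lemma subst_pol_add: "subst_pol \<sigma> (p + q) = subst_pol \<sigma> p + subst_pol \<sigma> q"
proof -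
  let ?T = "Poly_Mapping.keys p \<union> Poly_Mapping.keys q"
  have "Poly_Mapping.keys (p + q) \<subseteq> ?T" by (rule Poly_Mapping.keys_add)
  then show ?thesis
    by (subst (1 2 3) subst_pol_superset[of ?T])
      (auto simp: lookup_add distrib_right sum.distrib)
qed

lemma subst_pol_0: "subst_pol \<sigma> 0 = 0"
  by (simp add: subst_pol_def)

lemma subst_pol_uminus: "subst_pol \<sigma> (- p) = - subst_pol \<sigma> p"
  using subst_pol_add[of \<sigma> p "- p"] by (simp add: subst_pol_0 eq_neg_iff_add_eq_0 add.commute)

lemma subst_pol_diff: "subst_pol \<sigma> (p - q) = subst_pol \<sigma> p - subst_pol \<sigma> q"
  using subst_pol_add[of \<sigma> p "- q"] by (simp add: subst_pol_uminus)

lemma subst_pol_sum: "subst_pol \<sigma> (sum f A) = (\<Sum>a\<in>A. subst_pol \<sigma> (f a))"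
  by (induction A rule: infinite_finite_induct) (simp_all add: subst_pol_0 subst_pol_add)

lemma subst_pol_single:
  "subst_pol \<sigma> (Poly_Mapping.single t c) =
     of_int c * (\<Prod>j\<in>Poly_Mapping.keys t. \<sigma> j ^ Poly_Mapping.lookup t j)"
  by (subst subst_pol_superset[of "{t}"]) auto

lemma subst_pol_Var: "subst_pol \<sigma> (Var j) = \<sigma> j"
  by (simp add: Var_def subst_pol_single)

lemma subst_pol_mult: "subst_pol \<sigma> (p * q) = subst_pol \<sigma> p * subst_pol \<sigma> q"
proof -
  define M where "M t = (\<Prod>j\<in>Poly_Mapping.keys t. \<sigma> j ^ Poly_Mapping.lookup t j)"
    for t :: "nat \<Rightarrow>\<^sub>0 nat"
  have M_superset: "M t = (\<Prod>j\<in>J. \<sigma> j ^ Poly_Mapping.lookup t j)"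
    if "finite J" "Poly_Mapping.keys t \<subseteq> J" for t J
    unfolding M_def by (rule prod.mono_neutral_left) (use that in \<open>auto simp: in_keys_iff\<close>)
  have M_add: "M (s + t) = M s * M t" for s t
  proof -
    let ?J = "Poly_Mapping.keys s \<union> Poly_Mapping.keys t"
    have "Poly_Mapping.keys (s + t) \<subseteq> ?J" by (rule Poly_Mapping.keys_add)
    then show ?thesis
      by (subst (1 2 3) M_superset[of ?J]) (auto simp: lookup_add power_add prod.distrib)
  qed
  have single: "subst_pol \<sigma> (Poly_Mapping.single t c) = of_int c * M t" for t c
    by (simp add: subst_pol_single M_def)
  have expand: "r = (\<Sum>t\<in>Poly_Mapping.keys r. Poly_Mapping.single t (Poly_Mapping.lookup r t))"
    for r :: mpol
    by (simp add: poly_mapping_sum_singles)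
  have "p * q = (\<Sum>s\<in>Poly_Mapping.keys p. \<Sum>t\<in>Poly_Mapping.keys q.
      Poly_Mapping.single (s + t) (Poly_Mapping.lookup p s * Poly_Mapping.lookup q t))"
    by (subst expand[of p], subst expand[of q]) (simp add: sum_product mult_single)
  then have "subst_pol \<sigma> (p * q) = (\<Sum>s\<in>Poly_Mapping.keys p. \<Sum>t\<in>Poly_Mapping.keys q.
      (of_int (Poly_Mapping.lookup p s) * M s) * (of_int (Poly_Mapping.lookup q t) * M t))"
    by (simp add: subst_pol_sum single M_add mult_ac)
  then show ?thesis by (simp add: sum_product subst_pol_def M_def)
qed

lemma subst_pol_of_int: "subst_pol \<sigma> (of_int c) = of_int c"
  by (simp add: subst_pol_single flip: single_of_int)

lemma subst_pol_1: "subst_pol \<sigma> 1 = 1"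
  using subst_pol_of_int[of \<sigma> 1] by simp

lemma subst_pol_power: "subst_pol \<sigma> (p ^ k) = subst_pol \<sigma> p ^ k"
  by (induction k) (simp_all add: subst_pol_1 subst_pol_mult)

lemma subst_pol_prod: "subst_pol \<sigma> (prod f A) = (\<Prod>a\<in>A. subst_pol \<sigma> (f a))"
  by (induction A rule: infinite_finite_induct) (simp_all add: subst_pol_1 subst_pol_mult)

lemma subst_pol_subst_pol:
  "subst_pol \<tau> (subst_pol \<sigma> p) = subst_pol (\<lambda>j. subst_pol \<tau> (\<sigma> j)) p"
  unfolding subst_pol_def[of \<sigma>] subst_pol_def[of "\<lambda>j. subst_pol \<tau> (\<sigma> j)"]
  by (simp add: subst_pol_sum subst_pol_mult subst_pol_of_int subst_pol_prod subst_pol_power)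

lemma e_wt_cong: "[i = j] (mod int n) \<Longrightarrow> e_wt n i = e_wt n j"
  by (simp add: e_wt_def cong_def)

lemma e_wt_mod: "e_wt n (i mod int n) = e_wt n i"
  by (rule e_wt_cong) (simp add: cong_def)

lemma sum_int_split:
  fixes f :: "int \<Rightarrow> 'a::comm_monoid_add"
  assumes "n > 0"
  shows "sum f {0..<int n} = f 0 + (\<Sum>j = 1..<n. f (int j))"
proof -
  have "{0..<int n} = int ` {0..<n}" by (simp add: image_int_atLeastLessThan)
  then have "sum f {0..<int n} = (\<Sum>j = 0..<n. f (int j))" by (simp add: sum.reindex)
  then show ?thesis using assms by (simp add: sum.atLeast_Suc_lessThan)
qed

lemma sum_e_wt:
  assumes "n > 0"
  shows "(\<Sum>j\<in>{0..<int n}. e_wt n j) = 0"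
proof -
  have "(\<Sum>j = 1..<n. e_wt n (int j)) = (\<Sum>j = 1..<n. Var j)"
    by (intro sum.cong) (simp_all add: e_wt_def)
  then show ?thesis unfolding sum_int_split[OF assms] by (simp add: e_wt_def)
qed

lemma act_pol_e_wt:
  assumes n: "n > 0" and w: "w \<in> W_af n"
  shows "act_pol n w (e_wt n i) = e_wt n (w i)"
proof -
  define r where "r = i mod int n"
  have r: "0 \<le> r" "r < int n" using n by (auto simp: r_def)
  have wr: "e_wt n (w i) = e_wt n (w r)"
    by (rule e_wt_cong) (subst W_af_cong[OF w], simp add: r_def cong_def)
  have pos: "act_pol n w (e_wt n (int j)) = e_wt n (w (int j))" if "j \<in> {1..<n}" for j
    using that by (simp add: act_pol_def e_wt_def[of n "int j"] subst_pol_Var)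
  have "act_pol n w (e_wt n r) = e_wt n (w r)"
  proof (cases "r = 0")
    case False
    then have "nat r \<in> {1..<n}" using r by (auto simp: nat_less_iff Suc_le_eq)
    from pos[OF this] show ?thesis using r by simp
  next
    case True
    have inj: "inj_on (\<lambda>x. w x mod int n) {0..<int n}"
      using W_af_cong[OF w] by (auto simp: inj_on_def cong_def)
    have "(\<lambda>x. w x mod int n) ` {0..<int n} = {0..<int n}"
      by (rule card_subset_eq) (use inj n in \<open>auto simp: card_image\<close>)
    then have "(\<Sum>x\<in>{0..<int n}. e_wt n (w x mod int n)) = (\<Sum>x\<in>{0..<int n}. e_wt n x)"
      using inj by (metis (mono_tags, lifting) sum.reindex_cong)
    then have sum0: "(\<Sum>x\<in>{0..<int n}. e_wt n (w x)) = 0" by (simp add: e_wt_mod sum_e_wt[OF n])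
    have "act_pol n w (e_wt n 0) = - (\<Sum>j\<in>{1..<n}. e_wt n (w (int j)))"
      by (simp add: act_pol_def e_wt_def[of n 0] subst_pol_uminus subst_pol_sum subst_pol_Var)
    also have "\<dots> = e_wt n (w 0)" using sum0 unfolding sum_int_split[OF n] by (simp add: add_eq_0_iff)
    finally show ?thesis using True by simp
  qed
  then show ?thesis by (simp add: wr r_def e_wt_mod)
qed

lemma act_pol_comp:
  assumes "n > 0" "v \<in> W_af n"
  shows "act_pol n (v \<circ> w) p = act_pol n v (act_pol n w p)"
  using act_pol_e_wt[OF assms] by (simp add: act_pol_def subst_pol_subst_pol)

lemma act_pol_s_af:
  assumes "n \<ge> 2"
  shows "act_pol n (s_af n i) (e_wt n i) = e_wt n i - alpha_wt n i"
    "act_pol n (s_af n i) (e_wt n (i + 1)) = e_wt n (i + 1) + alpha_wt n i"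
    "\<not> [j = i] (mod int n) \<Longrightarrow> \<not> [j = i + 1] (mod int n) \<Longrightarrow>
       act_pol n (s_af n i) (e_wt n j) = e_wt n j"
  using assms s_af_simps[OF assms, of i]
  by (simp_all add: act_pol_e_wt s_af_in_W_af alpha_wt_def) (simp add: s_af_def refl_af_def)

lemma act_pol_id:
  assumes "p \<in> Sym n"
  shows "act_pol n id p = p"
proof -
  have "p = subst_pol Var p"
  proof -
    have "(\<Prod>j\<in>Poly_Mapping.keys t. Var j ^ Poly_Mapping.lookup t j) = Poly_Mapping.single t 1" for t
    proof -
      have pw: "Var j ^ k = Poly_Mapping.single (Poly_Mapping.single j k) 1" for j k
        by (induction k) (simp_all add: Var_def mult_single flip: single_add)
      have "(\<Prod>j\<in>J. Poly_Mapping.single (g j) 1) = Poly_Mapping.single (sum g J) (1::int)"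
        if "finite J" for g :: "nat \<Rightarrow> (nat \<Rightarrow>\<^sub>0 nat)" and J
        using that by (induction J) (simp_all add: mult_single)
      then show ?thesis by (simp add: pw poly_mapping_sum_singles)
    qed
    then have "subst_pol Var p = (\<Sum>t\<in>Poly_Mapping.keys p. Poly_Mapping.single t (Poly_Mapping.lookup p t))"
      unfolding subst_pol_def by (intro sum.cong) (simp_all add: mult_single flip: single_of_int)
    then show ?thesis by (simp add: poly_mapping_sum_singles)
  qed
  moreover have "subst_pol (\<lambda>j. e_wt n (id (int j))) p = subst_pol Var p"
    unfolding subst_pol_def
  proof (intro sum.cong prod.cong arg_cong2[where f = "(*)"] refl)
    fix t j assume "t \<in> Poly_Mapping.keys p" "j \<in> Poly_Mapping.keys t"
    then have "j \<in> {1..<n}" using assms unfolding Sym_def by blast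
    then show "e_wt n (id (int j)) ^ Poly_Mapping.lookup t j = Var j ^ Poly_Mapping.lookup t j"
      by (simp add: e_wt_def)
  qed
  ultimately show ?thesis by (simp add: act_pol_def)
qed

lemma act_pol_inverse:
  assumes n: "n \<ge> 2" and w: "w \<in> W_af n"
  shows "\<exists>v\<in>W_af n. \<forall>p\<in>Sym n. act_pol n v (act_pol n w p) = p"
proof -
  obtain "is" where "is": "word_prod n is = w" using W_af_generated[OF n w] by blast
  have "word_prod n (rev is) \<circ> word_prod n is = id"
  proof (induction "is")
    case (Cons i "is")
    have "word_prod n (rev (i # is)) \<circ> word_prod n (i # is) = word_prod n (rev is) \<circ> word_prod n is"
      by (simp add: word_prod_append) (simp add: word_prod_def fun_eq_iff s_af_invol[OF n])
    then show ?case using Cons by simp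
  qed (simp add: word_prod_def)
  then have "act_pol n (word_prod n (rev is)) (act_pol n w p) = act_pol n id p" for p
    using act_pol_comp[of n "word_prod n (rev is)" w p] n word_prod_in_W_af[OF n] "is" by simp
  then show ?thesis using word_prod_in_W_af[OF n] act_pol_id by metis
qed

lemma act_frac_Fract:
  assumes n: "n \<ge> 2" and w: "w \<in> W_af n" and ab: "a \<in> Sym n" "b \<in> Sym n" "b \<noteq> 0"
  shows "act_frac n w (Fract a b) = Fract (act_pol n w a) (act_pol n w b)"
  unfolding act_frac_def
proof (rule the_equality)
  show "\<exists>a'\<in>Sym n. \<exists>b'\<in>Sym n. b' \<noteq> 0 \<and> Fract a b = Fract a' b' \<and>
      Fract (act_pol n w a) (act_pol n w b) = Fract (act_pol n w a') (act_pol n w b')"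
    using ab by blast
  fix r assume "\<exists>a'\<in>Sym n. \<exists>b'\<in>Sym n. b' \<noteq> 0 \<and> Fract a b = Fract a' b' \<and>
      r = Fract (act_pol n w a') (act_pol n w b')"
  then obtain a' b' where ab': "a' \<in> Sym n" "b' \<in> Sym n" "b' \<noteq> 0" "Fract a b = Fract a' b'"
    and r: "r = Fract (act_pol n w a') (act_pol n w b')" by blast
  obtain v where v: "\<And>p. p \<in> Sym n \<Longrightarrow> act_pol n v (act_pol n w p) = p"
    using act_pol_inverse[OF n w] by blast
  have "act_pol n u 0 = 0" for u by (simp add: act_pol_def subst_pol_0)
  then have "act_pol n w b \<noteq> 0" "act_pol n w b' \<noteq> 0" using v ab ab' by metis+
  moreover have "a * b' = a' * b" using ab ab' by (simp add: eq_fract)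
  then have "act_pol n w a * act_pol n w b' = act_pol n w a' * act_pol n w b"
    by (metis act_pol_def subst_pol_mult)
  ultimately show "r = Fract (act_pol n w a) (act_pol n w b)" using r by (simp add: eq_fract)
qed


section \<open>The twisted group algebra and the structure constants\<close>

text \<open>An element of \<open>\<Oplus>\<^sub>w F w\<close> is a finitely supported function. The multiplication of type
  \<open>poly_mapping\<close> is not the one wanted (it would convolve along pointwise addition of functions)
  and is never used on this type.\<close>

type_synonym twisted = "(int \<Rightarrow> int) \<Rightarrow>\<^sub>0 mpol fract"

definition scale :: "'c::mult_zero \<Rightarrow> ('a \<Rightarrow>\<^sub>0 'c) \<Rightarrow> ('a \<Rightarrow>\<^sub>0 'c)" where
  "scale c f = Poly_Mapping.map (\<lambda>x. c * x) f"

definition tw_mult :: "nat \<Rightarrow> twisted \<Rightarrow> twisted \<Rightarrow> twisted" where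
  "tw_mult n f g = (\<Sum>v\<in>Poly_Mapping.keys f. \<Sum>w\<in>Poly_Mapping.keys g.
     Poly_Mapping.single (v \<circ> w)
       (Poly_Mapping.lookup f v * act_frac n v (Poly_Mapping.lookup g w)))"

definition A_gen :: "nat \<Rightarrow> int \<Rightarrow> twisted" where
  "A_gen n i = scale (inverse (Fract (alpha_wt n i) 1))
     (Poly_Mapping.single id 1 - Poly_Mapping.single (s_af n i) 1)"

definition A_word :: "nat \<Rightarrow> int list \<Rightarrow> twisted" where
  "A_word n is = foldr (\<lambda>i f. tw_mult n (A_gen n i) f) is (Poly_Mapping.single id 1)"

definition A_af :: "nat \<Rightarrow> (int \<Rightarrow> int) \<Rightarrow> twisted" where
  "A_af n w = A_word n (SOME is. reduced_word n w is)"

text \<open>The tensor square over \<open>F\<close> of the left \<open>F\<close>-vector space with basis \<open>W\<^sub>a\<^sub>f\<close> has the basis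
  \<open>v \<otimes> w\<close>, which is encoded as the pair \<open>(v, w)\<close>.\<close>

type_synonym twisted2 = "((int \<Rightarrow> int) \<times> (int \<Rightarrow> int)) \<Rightarrow>\<^sub>0 mpol fract"

definition tensor :: "twisted \<Rightarrow> twisted \<Rightarrow> twisted2" where
  "tensor f g = (\<Sum>v\<in>Poly_Mapping.keys f. \<Sum>w\<in>Poly_Mapping.keys g.
     Poly_Mapping.single (v, w) (Poly_Mapping.lookup f v * Poly_Mapping.lookup g w))"

definition Delta :: "twisted \<Rightarrow> twisted2" where
  "Delta f = (\<Sum>w\<in>Poly_Mapping.keys f. Poly_Mapping.single (w, w) (Poly_Mapping.lookup f w))"

definition is_coproduct_expansion :: "nat \<Rightarrow> (int \<Rightarrow> int) \<Rightarrow> twisted2 \<Rightarrow> bool" where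
  "is_coproduct_expansion n w p \<longleftrightarrow>
     Poly_Mapping.keys p \<subseteq> W_af n \<times> W_af n \<and>
     (\<forall>uv. Poly_Mapping.lookup p uv \<in> Frac n) \<and>
     Delta (A_af n w) = (\<Sum>(u, v)\<in>Poly_Mapping.keys p.
       scale (Poly_Mapping.lookup p (u, v)) (tensor (A_af n u) (A_af n v)))"

definition p_const :: "nat \<Rightarrow> (int \<Rightarrow> int) \<Rightarrow> (int \<Rightarrow> int) \<Rightarrow> (int \<Rightarrow> int) \<Rightarrow> mpol fract" where
  "p_const n u v w = Poly_Mapping.lookup (THE p. is_coproduct_expansion n w p) (u, v)"

text \<open>The constant term, for elements of the fraction field that lie in the polynomial ring.\<close>

definition phi :: "mpol fract \<Rightarrow> int" where
  "phi q = Poly_Mapping.lookup (THE a. q = Fract a 1) 0"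

lemma phi_Fract: "phi (Fract a 1) = Poly_Mapping.lookup a 0"
proof -
  have "(THE a'. Fract a 1 = Fract a' 1) = a" by (rule the_equality) (simp_all add: eq_fract)
  then show ?thesis by (simp add: phi_def)
qed


section \<open>The cohomology ring of the affine flag variety\<close>

text \<open>By Kostant and Kumar, the integral cohomology is the free abelian group on the Schubert
  classes \<open>\<xi>\<^sup>w\<close>, with the product given by the constants \<open>\<phi>(p\<^sup>w\<^sub>u\<^sub>,\<^sub>v)\<close>. Only finitely many \<open>w\<close>
  contribute to the sum below, because \<open>p\<^sup>w\<^sub>u\<^sub>,\<^sub>v\<close> is homogeneous of degree
  \<open>\<ell>(u) + \<ell>(v) - \<ell>(w)\<close>.\<close>

type_synonym cohom = "(int \<Rightarrow> int) \<Rightarrow>\<^sub>0 int"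

definition xi :: "(int \<Rightarrow> int) \<Rightarrow> cohom" where
  "xi w = frag_of w"

definition schubert_prod :: "nat \<Rightarrow> (int \<Rightarrow> int) \<Rightarrow> (int \<Rightarrow> int) \<Rightarrow> cohom" where
  "schubert_prod n u v =
     (\<Sum>w\<in>{w \<in> W_af n. phi (p_const n u v w) \<noteq> 0}. frag_cmul (phi (p_const n u v w)) (xi w))"

definition cup :: "nat \<Rightarrow> cohom \<Rightarrow> cohom \<Rightarrow> cohom" where
  "cup n x y = frag_extend (\<lambda>u. frag_extend (\<lambda>v. schubert_prod n u v) y) x"

end

(*
  Write f_u for the localised equivariant Schubert classes, A_u f for the value at the identity of
  the divided difference of f along a reduced word of u, and rr m k = s_(k-m+1) ... s_(k-1) s_k, so
  that omega(rho_m) = rr m 0. The structure constant p^u_(x,w) is A_u (f_x f_w), and its constant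
  term for x = rr m k is computed by induction on m and on the length of u, for all cuts k at once.

  If u has a right descent p that is not congruent to k, then f_(rr m k) is invariant under s_p and
  the Leibniz rule passes from (u, w) to (u s_p, w s_p). Strips behave in the same way: along a
  strip with cut k a descent at p is never lost going down, because s_p does not cross the cut.

  If u has descents only at k, then u has a descent off k + 1, and the cut is changed from k to
  k + 1 by f_(rr m (k+1)) = f_(rr m k) + (e_(k+1) - const) f_(rr (m-1) k), where e_(k+1) stands for
  the function v |-> e_(v(k+1)). Chevalley's formula expands the product with e_(k+1); all its
  terms have the same sign, since u is Grassmannian. The matching identity for strips moves a step
  at the cut past the other steps by conjugation: t_(k,j') t_(i,j) = t_(i',j'') t_(k,j').
*)
theory Submission
  imports Defs
begin

section \<open>Reflections, length and covers in the affine symmetric group\<close>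

text \<open>A function \<open>g\<close> on the group extends linearly to the twisted group algebra,
  and \<open>L u g\<close> is its value at A_u; the algebra itself enters only when the coproduct
  expansion is read off. The constant in the identity between the classes for \<open>k + 1\<close>
  and \<open>k\<close> is the weight of \<open>rr (m-1) k (k + 1)\<close>, that is of k + 2 - m. It
  is forced: at \<open>v = rr (m-1) k\<close> the two longer classes vanish and the shorter one does
  not. This constant and the leading term of Chevalley's formula are linear forms, so they disappear
  from constant terms. For strips the change of cut is proved with a bound: all markings lie below a
  number \<open>c\<close> that is at most the value at the cut. Without such a bound the induction
  on the number of steps has no hypothesis to use, because the steps after a given one are bounded
  by its marking. For an element with descents only at the cut the bound is automatic. Finally,
  \<omega> is conjugation by x |-> 1 - x. It reverses positions and sends the cut k to -k, so the
  covers at k + 1 in Chevalley's formula become the steps at the cut -k.\<close>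

locale affine_sym =
  fixes n :: nat
  assumes n2: "n \<ge> 2"
begin

abbreviation "W \<equiv> W_af n"
abbreviation "t \<equiv> refl_af n"
abbreviation "s \<equiv> s_af n"
abbreviation "len \<equiv> len_af n"
abbreviation cg :: "int \<Rightarrow> int \<Rightarrow> bool" (infix "\<approx>" 50) where "x \<approx> y \<equiv> [x = y] (mod int n)"

definition desc :: "(int \<Rightarrow> int) \<Rightarrow> int \<Rightarrow> bool" where
  "desc w p \<longleftrightarrow> w (p + 1) < w p"

section \<open>Congruences, and reflections acting on positions\<close>

lemma n0: "n > 0" using n2 by simp

lemma cg_iff: "x \<approx> y \<longleftrightarrow> (\<exists>k. x = y + k * int n)"
  by (metis cong_iff_lin cong_sym mult.commute)

lemma cg_add_mult [simp]: "x + k * int n \<approx> y \<longleftrightarrow> x \<approx> y" "x \<approx> y + k * int n \<longleftrightarrow> x \<approx> y"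
  "x - k * int n \<approx> y \<longleftrightarrow> x \<approx> y" "x \<approx> y - k * int n \<longleftrightarrow> x \<approx> y"
  by (simp_all add: cong_def mod_diff_right_eq[symmetric, of x "k * int n"]
      mod_diff_right_eq[symmetric, of y "k * int n"])

lemma cg_near: "x \<approx> y \<Longrightarrow> \<bar>x - y\<bar> < int n \<Longrightarrow> x = y"
  using zdvd_not_zless[of "\<bar>x - y\<bar>" "int n"] by (auto simp: cong_iff_dvd_diff)

lemma not_cg_Suc [simp]: "\<not> x + 1 \<approx> x" "\<not> x \<approx> x + 1"
  using cg_near[of "x + 1" x] cg_near[of x "x + 1"] n2 by auto

lemma cg_add_iff [simp]: "x + a \<approx> y + a \<longleftrightarrow> x \<approx> y"
  by (simp add: cong_iff_dvd_diff)

lemma s_eq: "s i = t i (i + 1)" by (simp add: s_af_def)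

lemma t_left [simp]: "x \<approx> i \<Longrightarrow> t i j x = x + (j - i)"
  and t_right: "\<not> i \<approx> j \<Longrightarrow> x \<approx> j \<Longrightarrow> t i j x = x - (j - i)"
  and t_other: "\<not> x \<approx> i \<Longrightarrow> \<not> x \<approx> j \<Longrightarrow> t i j x = x"
  by (auto simp: refl_af_def dest: cong_sym cong_trans)

lemma t_ends: "t i j i = j" "\<not> i \<approx> j \<Longrightarrow> t i j j = i"
  by (auto simp: t_right)

lemma t_per: "t i j (x + k * int n) = t i j x + k * int n"
  by (simp add: refl_af_def)

text \<open>The split is by the residue of \<open>x\<close>, but it keeps the translation
  \<open>k\<close>: later arguments compare integers, not only residues.\<close>

lemma t_cases:
  assumes "\<not> i \<approx> j"
  obtains k where "x = i + k * int n" "t i j x = j + k * int n"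
  | k where "x = j + k * int n" "t i j x = i + k * int n"
  | "\<not> x \<approx> i" "\<not> x \<approx> j" "t i j x = x"
proof -
  consider "x \<approx> i" | "x \<approx> j" "\<not> x \<approx> i" | "\<not> x \<approx> i" "\<not> x \<approx> j" by blast
  then show ?thesis
  proof cases
    case 1 then show ?thesis using that(1) by (force simp: cg_iff refl_af_def)
  next
    case 2 then show ?thesis using that(2) assms by (force simp: cg_iff refl_af_def)
  next
    case 3 then show ?thesis using that(3) by (simp add: refl_af_def)
  qed
qed

lemma t_invol: "\<not> i \<approx> j \<Longrightarrow> t i j (t i j x) = x"
  by (rule t_cases[of i j x]) (auto simp: t_per t_ends)

lemma t_comp_t: "\<not> i \<approx> j \<Longrightarrow> t i j \<circ> t i j = id"
  by (simp add: fun_eq_iff t_invol)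

lemma t_sym: "\<not> i \<approx> j \<Longrightarrow> t i j = t j i"
  by (auto simp: fun_eq_iff refl_af_def dest: cong_sym cong_trans)

lemma t_shift: "t (i + k * int n) (j + k * int n) = t i j"
  by (simp add: fun_eq_iff refl_af_def)

lemma t_in_W: assumes ij: "\<not> i \<approx> j" shows "t i j \<in> W"
proof -
  have "bij (t i j)" by (rule o_bij[of "t i j"]) (auto simp: t_comp_t ij)
  moreover have "(\<Sum>x\<in>{0..<int n}. t i j x - x) = 0"
  proof -
    have "(\<Sum>x\<in>{0..<int n}. t i j x - x) =
      (\<Sum>x\<in>{0..<int n}. (if x = i mod int n then j - i else 0) + (if x = j mod int n then i - j else 0))"
    proof (intro sum.cong refl)
      fix x assume "x \<in> {0..<int n}"
      then have "x \<approx> i \<longleftrightarrow> x = i mod int n" "x \<approx> j \<longleftrightarrow> x = j mod int n" by (auto simp: cong_def)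
      then show "t i j x - x =
        (if x = i mod int n then j - i else 0) + (if x = j mod int n then i - j else 0)"
        using ij by (auto simp: refl_af_def cong_def)
    qed
    also have "\<dots> = 0" using n0 by (simp add: sum.distrib)
    finally show ?thesis .
  qed
  ultimately show ?thesis using t_per[of i j _ 1] n0 by (simp add: W_af_iff)
qed

lemma W_inj: "v \<in> W \<Longrightarrow> v x = v y \<longleftrightarrow> x = y"
  using W_afD(1)[of v n] by (simp add: bij_def inj_eq)

lemma W_per: "v \<in> W \<Longrightarrow> v (x + k * int n) = v x + k * int n"
  by (rule W_afD(3))

lemma W_per_minus: "v \<in> W \<Longrightarrow> v (x - k * int n) = v x - k * int n"
  using W_per[of v x "- k"] by simp

lemma W_cg: "v \<in> W \<Longrightarrow> v x \<approx> v y \<longleftrightarrow> x \<approx> y" by (rule W_af_cong)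

lemma W_comp: "u \<in> W \<Longrightarrow> v \<in> W \<Longrightarrow> u \<circ> v \<in> W" using comp_in_W_af[OF n0] .

lemma s_in_W: "s i \<in> W" using s_af_in_W_af[OF n2] .

lemma id_in_W: "id \<in> W" using id_in_W_af[OF n0] .

lemma comp_s_in_W [simp]: "v \<circ> s i \<in> W \<longleftrightarrow> v \<in> W"
proof
  assume "v \<circ> s i \<in> W"
  then have "(v \<circ> s i) \<circ> s i \<in> W" by (rule W_comp[OF _ s_in_W])
  moreover have "(v \<circ> s i) \<circ> s i = v" by (simp add: fun_eq_iff s_af_invol[OF n2])
  ultimately show "v \<in> W" by (simp only:)
qed (intro W_comp s_in_W)

lemma comp_t_in_W: "\<not> i \<approx> j \<Longrightarrow> v \<in> W \<Longrightarrow> v \<circ> t i j \<in> W"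
  by (intro W_comp t_in_W)

lemma s_ends [simp]: "s i i = i + 1" "s i (i + 1) = i"
  by (simp_all add: s_af_simps[OF n2])

lemma s_invol [simp]: "s i (s i x) = x" by (rule s_af_invol[OF n2])

lemma comp_s_s [simp]: "v \<circ> s i \<circ> s i = v" by (simp add: fun_eq_iff)

lemma s_cong: "i \<approx> j \<Longrightarrow> s i = s j"
  using t_shift[of j _ "j + 1"] by (auto simp: cg_iff s_eq algebra_simps)

lemma t_conj:
  assumes v: "v \<in> W" and ij: "\<not> i \<approx> j"
  shows "v \<circ> t i j = t (v i) (v j) \<circ> v"
proof
  fix x
  have ij': "\<not> v i \<approx> v j" using W_cg[OF v] ij by simp
  show "(v \<circ> t i j) x = (t (v i) (v j) \<circ> v) x"
    using ij by (rule t_cases[of i j x])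
      (auto simp: W_per[OF v] t_per t_ends(1) t_ends(2)[OF ij] t_ends(2)[OF ij'] t_other W_cg[OF v])
qed

lemma t_conj_t:
  assumes "\<not> a \<approx> b" "\<not> i \<approx> j"
  shows "t a b \<circ> t i j = t (t a b i) (t a b j) \<circ> t a b"
  using t_conj[OF t_in_W[OF assms(1)] assms(2)] .

text \<open>A simple reflection moves every integer by at most one, so it can reverse only two
  neighbours that it interchanges.\<close>

lemma s_order:
  assumes "x < y" "s a y \<le> s a x"
  shows "x \<approx> a \<and> y = x + 1"
proof -
  have ne: "s a x \<noteq> s a y" using assms s_invol by (metis less_irrefl)
  have cases: "s a z = z + 1 \<and> z \<approx> a \<or> s a z = z - 1 \<or> s a z = z" for z
    unfolding s_eq by (auto simp: refl_af_def)
  show ?thesis using assms ne cases[of x] cases[of y] by auto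
qed

section \<open>Words, length and the exchange condition\<close>

lemma word_prod_Cons: "word_prod n (a # is) = s a \<circ> word_prod n is"
  and word_prod_Nil: "word_prod n [] = id"
  and word_prod_snoc: "word_prod n (is @ [a]) = word_prod n is \<circ> s a"
  by (simp_all add: word_prod_append) (simp_all add: word_prod_def)

lemma word_in_W [simp]: "word_prod n is \<in> W" by (rule word_prod_in_W_af[OF n2])

lemma ex_reduced: assumes "w \<in> W" shows "\<exists>is. reduced_word n w is"
proof -
  have "\<exists>l is. length is = l \<and> word_prod n is = w" using W_af_generated[OF n2 assms] by blast
  then have "\<exists>is. length is = len w \<and> word_prod n is = w"
    unfolding len_af_def by (rule LeastI_ex)
  then show ?thesis by (auto simp: reduced_word_def)
qed

lemma len_word_le: "len (word_prod n is) \<le> length is"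
  unfolding len_af_def by (rule Least_le) blast

lemma len_id [simp]: "len id = 0"
  using len_word_le[of "[]"] by (simp add: word_prod_Nil)

lemma len_0_iff: "w \<in> W \<Longrightarrow> len w = 0 \<longleftrightarrow> w = id"
  using ex_reduced[of w] by (auto simp: reduced_word_def word_prod_Nil)

lemma len_comp_s_le: assumes "w \<in> W" shows "len (w \<circ> s a) \<le> len w + 1"
proof -
  obtain "is" where "reduced_word n w is" using ex_reduced[OF assms] by blast
  then show ?thesis using len_word_le[of "is @ [a]"] by (simp add: reduced_word_def word_prod_snoc)
qed

text \<open>The deleted letter is the one that creates the inversion. When letters are prepended one
  by one, the values at \<open>i\<close> and \<open>j\<close> are reversed by a letter only if they
  are neighbours interchanged by it; that letter is then the conjugate of \<open>t i j\<close> by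
  the rest of the word.\<close>

lemma strong_exchange:
  assumes "i < j" "\<not> i \<approx> j" "word_prod n is j < word_prod n is i"
  shows "\<exists>js. length js < length is \<and> word_prod n js = word_prod n is \<circ> t i j"
  using assms(3)
proof (induction "is")
  case Nil then show ?case using assms(1) by (simp add: word_prod_Nil)
next
  case (Cons a "is")
  let ?u = "word_prod n is"
  show ?case
  proof (cases "?u j < ?u i")
    case True
    then obtain js where "length js < length is" "word_prod n js = ?u \<circ> t i j" using Cons.IH by blast
    then show ?thesis by (intro exI[of _ "a # js"]) (simp add: word_prod_Cons comp_assoc)
  next
    case False
    then have "?u i < ?u j" using assms(1) W_inj[of ?u i j] by fastforce
    then have *: "?u i \<approx> a" "?u j = ?u i + 1"
      using s_order[of "?u i" "?u j" a] Cons.prems by (simp_all add: word_prod_Cons)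
    then have "s a = t (?u i) (?u j)" using s_cong[of "?u i" a] by (simp add: s_eq)
    then have "s a \<circ> ?u = ?u \<circ> t i j" using t_conj[of ?u i j] assms(2) by simp
    then have "?u = word_prod n (a # is) \<circ> t i j"
      using t_comp_t[OF assms(2)] by (simp add: word_prod_Cons comp_assoc)
    then show ?thesis by (intro exI[of _ "is"]) simp
  qed
qed

lemma len_t_less:
  assumes u: "u \<in> W" and "i < j" "\<not> i \<approx> j" "u j < u i"
  shows "len (u \<circ> t i j) < len u"
proof -
  obtain "is" where "is": "word_prod n is = u" "length is = len u"
    using ex_reduced[OF u] by (auto simp: reduced_word_def)
  then obtain js where "length js < length is" "word_prod n js = u \<circ> t i j"
    using strong_exchange[OF assms(2,3), of "is"] assms(4) by auto
  then show ?thesis using len_word_le[of js] "is" by simp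
qed

lemma len_t_greater:
  assumes u: "u \<in> W" and ij: "i < j" "\<not> i \<approx> j" "u i < u j"
  shows "len u < len (u \<circ> t i j)"
  using len_t_less[of "u \<circ> t i j" i j] ij u
  by (simp add: comp_t_in_W t_ends comp_assoc t_comp_t)

lemma len_comp_s_desc: assumes w: "w \<in> W" and d: "desc w p" shows "len w = len (w \<circ> s p) + 1"
proof -
  have "len (w \<circ> s p) < len w" using len_t_less[OF w, of p "p + 1"] d by (simp add: desc_def s_eq)
  moreover have "len w \<le> len (w \<circ> s p) + 1" using len_comp_s_le[of "w \<circ> s p" p] w by simp
  ultimately show ?thesis by simp
qed

lemma desc_comp_s [simp]: assumes "w \<in> W" shows "desc (w \<circ> s p) p \<longleftrightarrow> \<not> desc w p"
  using W_inj[OF assms, of p "p + 1"] by (auto simp: desc_def)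

lemma len_comp_s_asc: "w \<in> W \<Longrightarrow> \<not> desc w p \<Longrightarrow> len (w \<circ> s p) = len w + 1"
  using len_comp_s_desc[of "w \<circ> s p" p] by simp

lemma desc_cong: assumes "w \<in> W" "p \<approx> q" shows "desc w p \<longleftrightarrow> desc w q"
proof -
  obtain k where "p = q + k * int n" using assms(2) by (auto simp: cg_iff)
  then show ?thesis using W_per[OF assms(1), of q k] W_per[OF assms(1), of "q + 1" k]
    by (simp add: desc_def algebra_simps)
qed

lemma ex_desc: assumes "w \<in> W" "w \<noteq> id" shows "\<exists>p. desc w p"
proof (rule ccontr)
  assume "\<not> ?thesis"
  then have "w i < w (i + 1)" for i using W_inj[OF assms(1), of i "i + 1"] unfolding desc_def
    by (metis add_left_cancel linorder_neqE_linordered_idom add_cancel_right_right one_neq_zero)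
  then show False using W_af_increasing[OF n0 assms(1)] assms(2) by blast
qed

lemma W_induct [consumes 1, case_names id s]:
  assumes "w \<in> W" and "P id" and "\<And>w p. w \<in> W \<Longrightarrow> \<not> desc w p \<Longrightarrow> P w \<Longrightarrow> P (w \<circ> s p)"
  shows "P w"
  using assms(1)
proof (induction "len w" arbitrary: w rule: less_induct)
  case less
  show ?case
  proof (cases "w = id")
    case False
    then obtain p where p: "desc w p" using ex_desc less.prems by blast
    then have "P (w \<circ> s p)" using less len_comp_s_desc[of w p] by simp
    then have "P ((w \<circ> s p) \<circ> s p)" using p less.prems
      by (subst assms(3)[of "w \<circ> s p" p]) simp_all
    then show ?thesis by (simp only: comp_s_s)
  qed (simp add: assms(2))
qed

lemma finite_len_le: "finite {w \<in> W. len w \<le> N}"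
proof -
  have "{w \<in> W. len w \<le> N} \<subseteq> word_prod n ` {is. set is \<subseteq> {0..<int n} \<and> length is \<le> N}"
  proof
    fix w assume "w \<in> {w \<in> W. len w \<le> N}"
    then obtain "is" where "is": "word_prod n is = w" "length is \<le> N"
      using ex_reduced by (force simp: reduced_word_def)
    have "word_prod n (map (\<lambda>i. i mod int n) is) = word_prod n is"
    proof (induction "is")
      case (Cons a "is")
      have "s (a mod int n) = s a" by (rule s_cong) (simp add: cong_def)
      then show ?case using Cons by (simp add: word_prod_Cons)
    qed simp
    then show "w \<in> word_prod n ` {is. set is \<subseteq> {0..<int n} \<and> length is \<le> N}"
      using "is" n0 by (intro image_eqI[of _ _ "map (\<lambda>i. i mod int n) is"]) auto
  qed
  moreover have "finite {is. set is \<subseteq> {0..<int n} \<and> length is \<le> N}"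
    by (rule finite_lists_length_le) simp
  ultimately show ?thesis using finite_subset by blast
qed

text \<open>The displacement is periodic, so it takes finitely many values. This bound is what makes
  the sets of covers and of steps finite.\<close>

lemma W_displacement_bound:
  assumes "w \<in> W" obtains B where "\<And>x. \<bar>w x - x\<bar> \<le> B"
proof
  fix x
  have "x mod int n \<in> {0..<int n}" using n0 by simp
  then have "\<bar>w (x mod int n) - x mod int n\<bar> \<le> (\<Sum>y\<in>{0..<int n}. \<bar>w y - y\<bar>)"
    by (intro member_le_sum[where f = "\<lambda>y. \<bar>w y - y\<bar>"]) auto
  then show "\<bar>w x - x\<bar> \<le> (\<Sum>y\<in>{0..<int n}. \<bar>w y - y\<bar>)" using W_afD(4)[OF assms] by simp
qed

text \<open>In both branches \<open>w \<circ> t i j\<close> is reached from \<open>w\<close> by three length-increasing reflections; the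
  maximality of \<open>r\<close> guarantees that one of the two branches applies.\<close>

lemma not_cover_translate:
  assumes w: "w \<in> W" and ij: "\<not> i \<approx> j" and r: "r \<ge> 1" "i < j - r * int n" "w i < w j - r * int n"
  shows "len (w \<circ> t i j) \<noteq> len w + 1"
proof -
  define R where "R = {r. r \<ge> 1 \<and> i < j - r * int n \<and> w i < w j - r * int n}"
  have "R \<subseteq> {1..j - i}"
  proof
    fix r assume "r \<in> R"
    then have "r \<ge> 1" "r * int n < j - i" by (auto simp: R_def)
    moreover have "r * 1 \<le> r * int n" using n0 \<open>r \<ge> 1\<close> by (intro mult_left_mono) auto
    ultimately have "1 \<le> r" "r \<le> j - i" by linarith+
    then show "r \<in> {1..j - i}" by simp
  qed
  then have fin: "finite R" using finite_subset by blast
  have "R \<noteq> {}" using r by (auto simp: R_def)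
  define m where "m = Max R"
  have "m \<in> R" and max: "\<And>x. x \<in> R \<Longrightarrow> x \<le> m" using fin \<open>R \<noteq> {}\<close> by (auto simp: m_def)
  define d where "d = m * int n"
  have m: "m \<ge> 1" "i < j - d" "w i < w j - d" using \<open>m \<in> R\<close> by (auto simp: R_def d_def)
  have d0: "d > 0" using m n0 by (simp add: d_def)
  have cg: "x + d \<approx> y \<longleftrightarrow> x \<approx> y" "x \<approx> y + d \<longleftrightarrow> x \<approx> y" "x - d \<approx> y \<longleftrightarrow> x \<approx> y" "x \<approx> y - d \<longleftrightarrow> x \<approx> y" for x y
    by (simp_all add: d_def)
  have wd: "v (x - d) = v x - d" "v (x + d) = v x + d" if "v \<in> W" for v x
    using W_per_minus[OF that] W_per[OF that] by (simp_all add: d_def)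
  have ji: "\<not> j \<approx> i" using ij cong_sym by blast
  have td: "t a b (x + d) = t a b x + d" "t a b (x - d) = t a b x - d" for a b x
    using t_per[of a b x m] t_per[of a b x "-m"] by (simp_all add: d_def)
  define q where "q = j - d"
  have iq: "\<not> i \<approx> q" by (simp add: q_def cg ij)
  \<comment> \<open>Doubling matches the two branches: with \<open>q = j - d\<close>, the inequality
    \<open>j - 2 * d < i\<close> says that \<open>q\<close> is to the left of \<open>i + d\<close>,
    and \<open>w j - 2 * d < w i\<close> says the same of their values under
    \<open>w\<close>.\<close>
  have "2 * m \<notin> R" using max[of "2 * m"] m by auto
  then have "\<not> (i < j - 2 * d \<and> w i < w j - 2 * d)" using m by (simp add: R_def d_def mult.assoc)
  moreover have "i \<noteq> j - 2 * d" using ij cg_add_mult(4)[of i j "2 * m"] by (auto simp: d_def mult.assoc)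
  moreover have "w i \<noteq> w j - 2 * d"
    using W_cg[OF w, of i j] ij cg_add_mult(4)[of "w i" "w j" "2 * m"] by (auto simp: d_def mult.assoc)
  ultimately consider "j - 2 * d < i" | "w j - 2 * d < w i" by linarith
  then have "len w + 3 \<le> len (w \<circ> t i j)"
  proof cases
    case 1
    let ?a = "w \<circ> t i q" and ?b = "w \<circ> t i q \<circ> t q (i + d)"
    have qi: "\<not> q \<approx> i + d" using iq cong_sym by (auto simp: cg)
    have tq: "t i q i = q" "t i q q = i" "t i q (i + d) = q + d" "t i q (q + d) = i + d"
      using t_ends[of i q] iq td by auto
    have tb: "t q (i + d) q = i + d" "t q (i + d) (i + d) = q" "t q (i + d) i = q - d"
      using t_ends[of q "i + d"] qi td(2)[of q "i + d" "i + d"] by auto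
    have "len w < len ?a" using w iq m by (intro len_t_greater) (auto simp: q_def wd)
    moreover have "len ?a < len ?b"
      using w iq m qi 1 by (intro len_t_greater comp_t_in_W) (auto simp: tq, auto simp: q_def wd)
    moreover have "len ?b < len (?b \<circ> t i q)"
      using w iq m qi d0 td(2)[of i q q] by (intro len_t_greater comp_t_in_W) (auto simp: tq tb wd td, auto simp: q_def wd)
    \<comment> \<open>Conjugation by \<open>t i q\<close> sends \<open>q\<close> to \<open>i\<close>
      and \<open>i + d\<close> to \<open>q + d\<close>, which is \<open>j\<close>.\<close>
    moreover have "t i q \<circ> t q (i + d) \<circ> t i q = t i j"
    proof -
      have "t i q \<circ> t q (i + d) = t i j \<circ> t i q"
        using t_conj_t[OF iq qi] tq by (simp add: q_def)
      then show ?thesis by (simp add: comp_assoc t_comp_t[OF iq])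
    qed
    ultimately show ?thesis by (simp add: comp_assoc)
  next
    case 2
    let ?a = "w \<circ> t i q" and ?b = "w \<circ> t i q \<circ> t i j"
    have ij': "\<not> i \<approx> j + d" by (simp add: cg ij)
    have tq: "t i q i = q" "t i q q = i" "t i q j = i + d"
      using t_ends[of i q] iq td(1)[of i q q] by (auto simp: q_def)
    have tb: "t i j i = j" "t i j j = i" "t i j (j + d) = i + d"
      using t_ends[of i j] ij td(1)[of i j j] by auto
    have "len w < len ?a" using w iq m by (intro len_t_greater) (auto simp: q_def wd)
    moreover have "len ?a < len ?b"
      using w iq m ij 2 d0 by (intro len_t_greater comp_t_in_W) (auto simp: tq wd, auto simp: q_def wd)
    moreover have "len ?b < len (?b \<circ> t i (j + d))"
      using w iq m ij ij' 2 d0 td(1)[of i q i]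
      by (intro len_t_greater comp_t_in_W) (auto simp: tq tb wd, auto simp: q_def wd)
    moreover have "t i q \<circ> t i j \<circ> t i (j + d) = t i j"
    proof -
      have "t i q \<circ> t i j = t q (i + d) \<circ> t i q" using t_conj_t[OF iq ij] tq by simp
      moreover have "t i j \<circ> t i (j + d) = t j (i + d) \<circ> t i j"
        using t_conj_t[OF ij ij'] tb by simp
      moreover have "t j (i + d) = t i q"
        using t_shift[of q m i] t_sym[OF iq] by (simp add: q_def d_def)
      ultimately show ?thesis by (metis comp_assoc comp_id id_comp t_comp_t[OF iq])
    qed
    ultimately show ?thesis by (simp add: comp_assoc)
  qed
  then show ?thesis by simp
qed

end

section \<open>Divided differences\<close>

text \<open>The calculus asks of the weights just that different residues have different values, so
  the field stays abstract here; \<open>kk\<close> instantiates it at the fraction field.\<close>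

locale affine_weights = affine_sym n for n :: nat +
  fixes E :: "int \<Rightarrow> 'a::field"
  assumes E_eq_iff: "E x = E y \<longleftrightarrow> [x = y] (mod int n)"
begin

text \<open>Right multiplication by A_p seen on functions: v A_p is (v - v s_p) divided by
  v(\<alpha>_p), and \<open>dd p g v\<close> is the value there of the linear extension of
  \<open>g\<close>. Accordingly \<open>ddw is g v\<close> is its value at v times the product of the
  A_i along the word, in the order of the word.\<close>

definition dd :: "int \<Rightarrow> ((int \<Rightarrow> int) \<Rightarrow> 'a) \<Rightarrow> (int \<Rightarrow> int) \<Rightarrow> 'a" where
  "dd p g v = (g v - g (v \<circ> s p)) / (E (v p) - E (v (p + 1)))"

definition ddw :: "int list \<Rightarrow> ((int \<Rightarrow> int) \<Rightarrow> 'a) \<Rightarrow> (int \<Rightarrow> int) \<Rightarrow> 'a" where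
  "ddw is g = foldr dd is g"

text \<open>Functions are defined on all of \<open>int \<Rightarrow> int\<close>, while the roots in
  the denominators are known to be nonzero on \<open>W\<close> only.\<close>

definition eqW :: "((int \<Rightarrow> int) \<Rightarrow> 'a) \<Rightarrow> ((int \<Rightarrow> int) \<Rightarrow> 'a) \<Rightarrow> bool" (infix "\<doteq>" 50) where
  "g \<doteq> h \<longleftrightarrow> (\<forall>v\<in>W. g v = h v)"

lemma ddw_simps: "ddw [] g = g" "ddw (p # is) g = dd p (ddw is g)" "ddw (is @ js) g = ddw is (ddw js g)"
  by (simp_all add: ddw_def)

lemma eqW_refl [simp]: "g \<doteq> g" and eqW_sym: "g \<doteq> h \<Longrightarrow> h \<doteq> g"
  and eqW_trans [trans]: "g \<doteq> h \<Longrightarrow> h \<doteq> k \<Longrightarrow> g \<doteq> k"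
  by (simp_all add: eqW_def)

lemma eqWD: "g \<doteq> h \<Longrightarrow> v \<in> W \<Longrightarrow> g v = h v" by (simp add: eqW_def)

lemma dd_cong: "g \<doteq> h \<Longrightarrow> dd p g \<doteq> dd p h" by (simp add: eqW_def dd_def)

lemma ddw_cong: "g \<doteq> h \<Longrightarrow> ddw is g \<doteq> ddw is h"
  by (induction "is") (simp_all add: ddw_simps dd_cong)

lemma root_nonzero: "v \<in> W \<Longrightarrow> E (v p) - E (v (p + 1)) \<noteq> 0"
  by (simp add: E_eq_iff W_cg)

lemma dd_cong_index: assumes "p \<approx> q" shows "dd p g \<doteq> dd q g"
proof -
  obtain k where k: "p = q + k * int n" using assms by (auto simp: cg_iff)
  have "E (v p) = E (v q)" "E (v (p + 1)) = E (v (q + 1))" if "v \<in> W" for v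
    using assms cg_add_iff[of p 1 q] by (simp_all add: E_eq_iff W_cg[OF that])
  then show ?thesis using s_cong[OF assms] by (simp add: eqW_def dd_def)
qed

lemma dd_step: "v \<in> W \<Longrightarrow> g (v \<circ> s p) = g v - (E (v p) - E (v (p + 1))) * dd p g v"
  using root_nonzero by (simp add: dd_def)

lemma div_swap: "(a - b) / (c - d) = (b - a) / (d - c)" for a b c d :: 'a
  by (metis minus_diff_eq minus_divide_divide)

lemma dd_comp_s: "dd p g (v \<circ> s p) = dd p g v"
proof -
  have "dd p g (v \<circ> s p) = (g (v \<circ> s p) - g v) / (E (v (p + 1)) - E (v p))"
    unfolding dd_def by (simp only: comp_s_s) (simp only: o_apply s_ends)
  also have "\<dots> = dd p g v"
    unfolding dd_def by (rule div_swap)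
  finally show ?thesis .
qed

lemma dd_dd: "dd p (dd p g) \<doteq> (\<lambda>_. 0)"
  unfolding eqW_def by (simp add: dd_def[of p "dd p g"] dd_comp_s)

lemma s_other: assumes "\<not> x \<approx> p" "\<not> x \<approx> p + 1" shows "s p x = x"
  using assms by (simp add: s_eq t_other)

lemma s_commute: assumes "\<not> p \<approx> q" "\<not> p \<approx> q + 1" "\<not> q \<approx> p + 1"
  shows "s p \<circ> s q = s q \<circ> s p"
proof -
  have "\<not> q + 1 \<approx> p" "\<not> q \<approx> p" "\<not> q + 1 \<approx> p + 1" using assms by (simp_all add: cong_sym_eq)
  then have "s p q = q" "s p (q + 1) = q + 1" using assms by (simp_all add: s_other)
  then show ?thesis using t_conj[OF s_in_W, of q "q + 1" p] by (simp add: s_eq)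
qed

lemma dd_commute:
  assumes pq: "\<not> p \<approx> q" "\<not> p \<approx> q + 1" "\<not> q \<approx> p + 1"
  shows "dd p (dd q g) \<doteq> dd q (dd p g)"
  unfolding eqW_def
proof
  fix v assume v: "v \<in> W"
  have *: "\<not> q \<approx> p" "\<not> q + 1 \<approx> p" "\<not> p + 1 \<approx> q" "\<not> p + 1 \<approx> q + 1" "\<not> q + 1 \<approx> p + 1"
    using pq by (simp_all add: cong_sym_eq)
  have "s p q = q" "s p (q + 1) = q + 1" "s q p = p" "s q (p + 1) = p + 1"
    using pq * by (simp_all add: s_other)
  moreover have "v \<circ> s p \<circ> s q = v \<circ> s q \<circ> s p" using s_commute[OF pq] by (simp add: comp_assoc)
  ultimately show "dd p (dd q g) v = dd q (dd p g) v"
    by (simp add: dd_def diff_divide_distrib add_divide_distrib algebra_simps)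
qed

lemma s_braid: assumes n3: "n \<ge> 3" shows "s p \<circ> s (p + 1) \<circ> s p = s (p + 1) \<circ> s p \<circ> s (p + 1)"
proof -
  have "\<not> p + 2 \<approx> p" using cg_near[of "p + 2" p] n3 by auto
  moreover have ne': "\<not> p + 2 \<approx> p + 1" "\<not> p + 1 \<approx> p + 2" using not_cg_Suc[of "p + 1"] by (simp_all add: add.assoc)
  ultimately have sp: "s p p = p + 1" "s p (p + 1) = p" "s p (p + 2) = p + 2"
    "s (p + 1) p = p" "s (p + 1) (p + 1) = p + 2"
    using s_ends[of "p + 1"] by (simp_all add: s_other add.assoc cong_sym_eq)
  have b: "s (p + 1) = t (p + 1) (p + 2)" by (simp add: s_eq add.commute)
  have np: "\<not> p \<approx> p + 1" by simp
  have "s p \<circ> s (p + 1) = t p (p + 2) \<circ> s p"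
    unfolding b using t_conj[OF s_in_W, of "p + 1" "p + 2" p] ne' sp by simp
  moreover have "s (p + 1) \<circ> s p = t p (p + 2) \<circ> s (p + 1)"
    unfolding s_eq[of p] t_conj[OF s_in_W np] sp by (rule refl)
  ultimately show ?thesis by simp
qed

text \<open>This is the shape of three nested divided differences with roots u, w and u + w. The
  entry A / u occurs twice, and 1/w - 1/(u + w) = u / (w (u + w)) cancels its denominator, which
  leaves an expression with a common denominator symmetric in u and w.\<close>

lemma braid_fraction:
  fixes A B D u w :: 'a
  assumes "u \<noteq> 0" "w \<noteq> 0" "u + w \<noteq> 0"
  shows "((A / u - B / (u + w)) / w - (A / u - D / w) / (u + w)) / u = (A - B + D) / (u * w * (u + w))"
proof -
  have "A / u / w - A / u / (u + w) = A / (w * (u + w))"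
    using assms by (simp add: divide_simps) (simp add: algebra_simps)
  then have "(A / u - B / (u + w)) / w - (A / u - D / w) / (u + w) = (A - B + D) / (w * (u + w))"
    by (simp add: diff_divide_distrib add_divide_distrib mult.commute)
  then show ?thesis by (simp add: mult_ac)
qed

lemma dd_braid:
  assumes n3: "n \<ge> 3"
  shows "dd p (dd (p + 1) (dd p g)) \<doteq> dd (p + 1) (dd p (dd (p + 1) g))"
  unfolding eqW_def
proof
  fix v assume v: "v \<in> W"
  have ne: "\<not> p + 2 \<approx> p" "\<not> p \<approx> p + 2" using cg_near[of "p + 2" p] cg_near[of p "p + 2"] n3 by auto
  have ne': "\<not> p + 2 \<approx> p + 1" "\<not> p + 1 \<approx> p + 2" using not_cg_Suc[of "p + 1"] by (simp_all add: add.assoc)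
  have sp: "s p p = p + 1" "s p (p + 1) = p" "s p (p + 2) = p + 2"
    "s (p + 1) p = p" "s (p + 1) (p + 1) = p + 2" "s (p + 1) (p + 2) = p + 1"
    using s_ends[of "p + 1"] ne ne' by (simp_all add: s_other add.assoc)
  let ?a = "s p" and ?b = "s (p + 1)"
  have br: "v \<circ> ?a \<circ> ?b \<circ> ?a = v \<circ> ?b \<circ> ?a \<circ> ?b"
    using s_braid[OF n3, of p] by (simp add: comp_assoc)
  define u w where "u = E (v p) - E (v (p + 1))" and "w = E (v (p + 1)) - E (v (p + 2))"
  have uw: "u \<noteq> 0" "w \<noteq> 0" "u + w \<noteq> 0" using ne ne'
    by (auto simp: u_def w_def E_eq_iff W_cg[OF v])
  have E: "E (v p) - E (v (p + 1)) = u" "E (v (p + 1)) - E (v (p + 2)) = w"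
    "E (v p) - E (v (p + 2)) = u + w" "E (v (p + 1)) - E (v p) = - u"
    "E (v (p + 2)) - E (v (p + 1)) = - w" "E (v (p + 2)) - E (v p) = - (u + w)"
    by (simp_all add: u_def w_def)
  have neg: "(a - b) / (- c) = (b - a) / c" for a b c :: 'a
    using div_swap[of a b 0 c] by simp
  have p2: "p + 1 + 1 = p + 2" by simp
  \<comment> \<open>The alternating sum over the coset of \<open>v\<close> under the subgroup
    generated by the two reflections. By the braid relation it is symmetric in them.\<close>
  define h where "h = g v - g (v \<circ> ?a) - g (v \<circ> ?b) + g (v \<circ> ?a \<circ> ?b) + g (v \<circ> ?b \<circ> ?a) - g (v \<circ> ?a \<circ> ?b \<circ> ?a)"
  have "dd p (dd (p + 1) (dd p g)) v = h / (u * w * (u + w))"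
    unfolding dd_def o_apply sp p2 E neg comp_s_s
    by (subst braid_fraction[OF uw]) (simp add: h_def o_def algebra_simps)
  moreover have "dd (p + 1) (dd p (dd (p + 1) g)) v = h / (w * u * (w + u))"
    unfolding dd_def o_apply sp p2 E neg comp_s_s add.commute[of u w] br[symmetric]
    by (subst braid_fraction) (use uw in \<open>auto simp: h_def o_def algebra_simps\<close>)
  ultimately show "dd p (dd (p + 1) (dd p g)) v = dd (p + 1) (dd p (dd (p + 1) g)) v"
    by (simp add: mult_ac add_ac)
qed

end

section \<open>Independence of the reduced word\<close>

context affine_sym
begin

lemma reduced_snocD:
  assumes "reduced_word n w (is @ [p])"
  shows "w \<in> W" "desc w p" "reduced_word n (w \<circ> s p) is"
proof -
  have w: "w = word_prod n is \<circ> s p" and l: "len w = length is + 1"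
    using assms by (auto simp: reduced_word_def word_prod_snoc)
  show W: "w \<in> W" by (simp add: w)
  have ws: "w \<circ> s p = word_prod n is" by (simp add: w)
  have le: "len (w \<circ> s p) \<le> length is" unfolding ws by (rule len_word_le)
  show "desc w p" using len_comp_s_asc[OF W, of p] le l by fastforce
  then show "reduced_word n (w \<circ> s p) is"
    using len_comp_s_desc[OF W, of p] l ws by (simp add: reduced_word_def)
qed

lemma reduced_snocI:
  assumes "w \<in> W" "\<not> desc w p" "reduced_word n w is"
  shows "reduced_word n (w \<circ> s p) (is @ [p])"
  using assms len_comp_s_asc[of w p] by (simp add: reduced_word_def word_prod_snoc)

definition ball :: "nat \<Rightarrow> (int \<Rightarrow> int) set" where
  "ball N = {w \<in> W. len w \<le> N}"

lemma finite_ball [simp]: "finite (ball N)" unfolding ball_def by (rule finite_len_le)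

lemma ball_0: "ball 0 = {id}" using len_0_iff id_in_W by (auto simp: ball_def)

end

context affine_weights
begin

text \<open>An argument in the style of Matsumoto. The last letters p and q are both descents. If
  they differ modulo \<open>n\<close>, a common lower element \<open>x\<close> has a reduced word
  that extends to words of w s_p and w s_q; there the induction applies, and the two extensions
  differ by one commutation or braid relation of divided differences.\<close>

lemma ddw_reduced:
  assumes "reduced_word n w is" "reduced_word n w js"
  shows "ddw is g \<doteq> ddw js g"
  using assms
proof (induction "len w" arbitrary: w "is" js g rule: less_induct)
  case less
  show ?case
  proof (cases "is = []")
    case True
    then show ?thesis using less.prems by (simp add: reduced_word_def)
  next
    case False
    then obtain is' p where "is": "is = is' @ [p]" by (metis rev_exhaust)
    have "js \<noteq> []" using less.prems "is" by (auto simp: reduced_word_def)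
    then obtain js' q where js: "js = js' @ [q]" by (metis rev_exhaust)
    note P = reduced_snocD[OF less.prems(1)[unfolded "is"]]
    note Q = reduced_snocD[OF less.prems(2)[unfolded js]]
    have w: "w \<in> W" by (rule P)
    have lt: "len (w \<circ> s r) < len w" if "desc w r" for r using len_comp_s_desc[OF w that] by simp
    have key: "ddw is' (dd p g) \<doteq> ddw js' (dd q g)"
      if "desc w p" "desc w q" "reduced_word n (w \<circ> s p) is'" "reduced_word n (w \<circ> s q) js'"
        "q = p + 1" "n \<ge> 3" for p q is' js'
    proof -
      have d: "desc w p" "desc w (p + 1)" using that by simp_all
      let ?a = "s p" and ?b = "s (p + 1)"
      have ne: "\<not> p + 2 \<approx> p" "\<not> p \<approx> p + 2" using cg_near[of "p + 2" p] cg_near[of p "p + 2"] \<open>n \<ge> 3\<close> by auto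
      have ne': "\<not> p + 2 \<approx> p + 1" "\<not> p + 1 \<approx> p + 2"
        using not_cg_Suc[of "p + 1"] by (simp_all add: add.assoc)
      have p2: "p + 1 + 1 = p + 2" by simp
      have sp: "s p p = p + 1" "s p (p + 1) = p" "s p (p + 2) = p + 2"
        "s (p + 1) p = p" "s (p + 1) (p + 1) = p + 2" "s (p + 1) (p + 2) = p + 1"
        using s_ends[of "p + 1"] ne ne' by (simp_all add: s_other add.assoc)
      define x where "x = w \<circ> ?a \<circ> ?b \<circ> ?a"
      have d2: "desc (w \<circ> ?a) (p + 1)" "desc (w \<circ> ?a \<circ> ?b) p"
        "desc (w \<circ> ?b) p" "desc (w \<circ> ?b \<circ> ?a) (p + 1)"
        using d unfolding desc_def o_apply p2 sp by simp_all
      have br: "w \<circ> ?b \<circ> ?a \<circ> ?b = x"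
        using s_braid[OF \<open>n \<ge> 3\<close>, of p] by (simp add: x_def comp_assoc)
      have x: "x \<in> W" using w by (simp add: x_def)
      obtain ks where ks: "reduced_word n x ks" using ex_reduced[OF x] by blast
      have xa: "x \<circ> ?a = w \<circ> ?a \<circ> ?b" by (simp add: x_def)
      have xb: "x \<circ> ?b = w \<circ> ?b \<circ> ?a" unfolding br[symmetric] by (rule comp_s_s)
      have dx1: "\<not> desc x p" unfolding x_def using d2(2) w by (subst desc_comp_s) simp_all
      have dx2: "\<not> desc x (p + 1)" unfolding br[symmetric] using d2(4) w by (subst desc_comp_s) simp_all
      note dx = dx1 dx2
      have "reduced_word n (w \<circ> ?a \<circ> ?b) (ks @ [p])"
        using reduced_snocI[OF x dx(1) ks] by (simp add: xa)
      from reduced_snocI[OF _ _ this, of "p + 1"] have 1: "reduced_word n (w \<circ> ?a) ((ks @ [p]) @ [p + 1])"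
        using d2 w by simp
      have "reduced_word n (w \<circ> ?b \<circ> ?a) (ks @ [p + 1])"
        using reduced_snocI[OF x dx(2) ks] by (simp add: xb)
      from reduced_snocI[OF _ _ this, of p] have 2: "reduced_word n (w \<circ> ?b) ((ks @ [p + 1]) @ [p])"
        using d2 w by simp
      have "ddw is' (dd p g) \<doteq> ddw ((ks @ [p]) @ [p + 1]) (dd p g)"
        using less.hyps[OF lt[OF d(1)]] that 1 by blast
      also have "\<dots> \<doteq> ddw ((ks @ [p + 1]) @ [p]) (dd q g)"
        using ddw_cong[OF dd_braid[OF \<open>n \<ge> 3\<close>, of p g], of ks] by (simp add: ddw_simps that)
      also have "\<dots> \<doteq> ddw js' (dd q g)"
        using less.hyps[OF lt[OF d(2)]] that 2 by blast
      finally show ?thesis .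
    qed
    have key': "ddw is' (dd p g) \<doteq> ddw js' (dd q g)"
      if pq: "desc w p" "desc w q" "reduced_word n (w \<circ> s p) is'" "reduced_word n (w \<circ> s q) js'"
        "q \<approx> p + 1" for p q is' js'
    proof -
      have "desc w (p + 1)" using desc_cong[OF w pq(5)] pq by simp
      \<comment> \<open>For \<open>n = 2\<close> there is no braid relation, but p and p + 1 cannot
        both be descents either, because w(p + 2) = w(p) + 2.\<close>
      have n3: "n \<ge> 3"
      proof (rule ccontr)
        assume "\<not> n \<ge> 3" then have "n = 2" using n2 by simp
        then have "w (p + 2) = w p + 2" using W_per[OF w, of p 1] by simp
        moreover have "p + 1 + 1 = p + 2" by simp
        ultimately show False using \<open>desc w p\<close> \<open>desc w (p + 1)\<close> by (simp add: desc_def add.commute)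
      qed
      have "ddw is' (dd p g) \<doteq> ddw js' (dd (p + 1) g)"
        using key[of p "p + 1" is' js'] pq n3 \<open>desc w (p + 1)\<close> s_cong[OF pq(5)] by simp
      also have "\<dots> \<doteq> ddw js' (dd q g)"
        using pq(5) by (intro ddw_cong dd_cong_index) (simp add: cong_sym_eq)
      finally show ?thesis .
    qed
    have "ddw is' (dd p g) \<doteq> ddw js' (dd q g)"
    proof -
      consider "p \<approx> q" | "q \<approx> p + 1" | "p \<approx> q + 1"
        | "\<not> p \<approx> q" "\<not> q \<approx> p + 1" "\<not> p \<approx> q + 1" by blast
      then show ?thesis
      proof cases
        case 1
        then have "ddw is' (dd p g) \<doteq> ddw is' (dd q g)" by (intro ddw_cong dd_cong_index)
        also have "\<dots> \<doteq> ddw js' (dd q g)"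
          using less.hyps[OF lt[OF P(2)]] P Q s_cong[OF 1] by simp
        finally show ?thesis .
      next
        case 2 then show ?thesis using key'[OF P(2) Q(2) P(3) Q(3)] by blast
      next
        case 3 then show ?thesis by (rule eqW_sym[OF key'[OF Q(2) P(2) Q(3) P(3)]])
      next
        case 4
        then have sw: "s p \<circ> s q = s q \<circ> s p" by (intro s_commute)
        have so: "s p q = q" "s p (q + 1) = q + 1" "s q p = p" "s q (p + 1) = p + 1"
          using 4 by (auto intro!: s_other simp: cong_sym_eq)
        define x where "x = w \<circ> s p \<circ> s q"
        have x: "x \<in> W" "x = w \<circ> s q \<circ> s p" using w by (simp add: x_def) (simp add: x_def comp_assoc sw)
        have d: "desc (w \<circ> s p) q" "desc (w \<circ> s q) p" using P(2) Q(2) so by (simp_all add: desc_def)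
        have dx: "\<not> desc x q" "\<not> desc x p" using d w by (simp add: x_def) (simp add: x(2) d w)
        obtain ks where ks: "reduced_word n x ks" using ex_reduced[OF x(1)] by blast
        have 1: "reduced_word n (w \<circ> s p) (ks @ [q])"
          using reduced_snocI[OF x(1) dx(1) ks] by (simp add: x_def)
        have 2: "reduced_word n (w \<circ> s q) (ks @ [p])"
          using reduced_snocI[OF x(1) dx(2) ks] by (simp add: x(2))
        have "ddw is' (dd p g) \<doteq> ddw (ks @ [q]) (dd p g)"
          using less.hyps[OF lt[OF P(2)]] P 1 by blast
        also have "\<dots> \<doteq> ddw (ks @ [p]) (dd q g)"
          using 4 by (simp add: ddw_simps) (intro ddw_cong dd_commute, simp_all add: cong_sym_eq)
        also have "\<dots> \<doteq> ddw js' (dd q g)"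
          using less.hyps[OF lt[OF Q(2)]] Q 2 by blast
        finally show ?thesis .
      qed
    qed
    then show ?thesis by (simp add: "is" js ddw_simps)
  qed
qed

section \<open>Evaluation at A_w, and the basis dual to these functionals\<close>

definition L :: "(int \<Rightarrow> int) \<Rightarrow> ((int \<Rightarrow> int) \<Rightarrow> 'a) \<Rightarrow> 'a" where
  "L w g = ddw (SOME is. reduced_word n w is) g id"

lemma L_reduced: assumes "reduced_word n w is" shows "L w g = ddw is g id"
  unfolding L_def using ddw_reduced[OF someI[of "reduced_word n w", OF assms] assms, of g] id_in_W
  by (simp add: eqW_def)

lemma L_cong: "g \<doteq> h \<Longrightarrow> L w g = L w h"
  unfolding L_def using ddw_cong id_in_W by (simp add: eqW_def)

lemma L_id [simp]: "L id g = g id"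
  using L_reduced[of id "[]" g] by (simp add: reduced_word_def word_prod_Nil ddw_simps)

text \<open>This is the product rule A_w A_p = A_(w s_p) at an ascent. Its companion
  \<open>L_dd_desc\<close>, A_w A_p = 0 at a descent, follows from A_p A_p = 0.\<close>

lemma L_dd_asc: assumes "w \<in> W" "\<not> desc w p" shows "L w (dd p g) = L (w \<circ> s p) g"
proof -
  obtain "is" where "is": "reduced_word n w is" using ex_reduced[OF assms(1)] by blast
  show ?thesis
    using L_reduced[OF "is"] L_reduced[OF reduced_snocI[OF assms "is"]] by (simp add: ddw_simps)
qed

lemma dd_sum: "dd p (\<lambda>v. \<Sum>x\<in>S. c x * h x v) = (\<lambda>v. \<Sum>x\<in>S. c x * dd p (h x) v)"
  by (simp add: dd_def fun_eq_iff sum_subtractf[symmetric] sum_divide_distrib right_diff_distrib)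

lemma L_sum: "L w (\<lambda>v. \<Sum>x\<in>S. c x * h x v) = (\<Sum>x\<in>S. c x * L w (h x))"
proof -
  have "ddw is (\<lambda>v. \<Sum>x\<in>S. c x * h x v) = (\<lambda>v. \<Sum>x\<in>S. c x * ddw is (h x) v)" for "is"
    by (induction "is") (simp_all add: ddw_simps dd_sum)
  then show ?thesis by (simp add: L_def)
qed

lemma L_add: "L w (\<lambda>v. g v + h v) = L w g + L w h"
  using L_sum[of w "\<lambda>_. 1" "\<lambda>b. if b then g else h" UNIV] by (simp add: UNIV_bool add.commute)

lemma L_scale: "L w (\<lambda>v. c * g v) = c * L w g"
  using L_sum[of w "\<lambda>_. c" "\<lambda>_. g" "{()}"] by simp

lemma L_diff: "L w (\<lambda>v. g v - h v) = L w g - L w h"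
  using L_add[of w g "\<lambda>v. (-1) * h v"] L_scale[of w "-1" h] by simp

lemma L_zero: "L w (\<lambda>_. 0) = 0"
  using L_scale[of w 0 "\<lambda>_. 0"] by simp

lemma L_dd_desc: assumes "w \<in> W" "desc w p" shows "L w (dd p g) = 0"
proof -
  have "L w (dd p g) = L ((w \<circ> s p) \<circ> s p) (dd p g)" by simp
  also have "\<dots> = L (w \<circ> s p) (dd p (dd p g))" using assms by (subst L_dd_asc) simp_all
  also have "\<dots> = L (w \<circ> s p) (\<lambda>_. 0)" by (intro L_cong dd_dd)
  finally show ?thesis by (simp add: L_zero)
qed

text \<open>Triangularity: for a reduced word, A_w is a nonzero multiple of w plus shorter elements.
  The factor \<open>\<kappa>\<close> is chosen before \<open>g\<close>, so it serves for all test
  functions at once.\<close>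

lemma ddw_leading:
  "\<exists>\<kappa>. \<kappa> \<noteq> 0 \<and> (\<forall>g. (\<forall>x\<in>W. len x < length is \<longrightarrow> g x = 0) \<longrightarrow> ddw is g id = \<kappa> * g (word_prod n is))"
proof (induction "is" rule: rev_induct)
  case Nil then show ?case by (intro exI[of _ 1]) (simp add: ddw_simps word_prod_Nil)
next
  case (snoc p "is")
  let ?w = "word_prod n is"
  obtain \<kappa> where \<kappa>: "\<kappa> \<noteq> 0"
    and IH: "\<And>g. (\<forall>x\<in>W. len x < length is \<longrightarrow> g x = 0) \<Longrightarrow> ddw is g id = \<kappa> * g ?w"
    using snoc by blast
  let ?r = "E (?w p) - E (?w (p + 1))"
  have r: "?r \<noteq> 0" by (rule root_nonzero) simp
  show ?case
  proof (intro exI[of _ "- \<kappa> / ?r"] conjI allI impI)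
    show "- \<kappa> / ?r \<noteq> 0" using \<kappa> r by simp
    fix g :: "(int \<Rightarrow> int) \<Rightarrow> 'a"
    assume g: "\<forall>x\<in>W. len x < length (is @ [p]) \<longrightarrow> g x = 0"
    have "\<forall>x\<in>W. len x < length is \<longrightarrow> dd p g x = 0"
    proof (intro ballI impI)
      fix x assume "x \<in> W" "len x < length is"
      then show "dd p g x = 0" using g len_comp_s_le[of x p] by (simp add: dd_def)
    qed
    then have "ddw is (dd p g) id = \<kappa> * dd p g ?w" by (rule IH)
    moreover have "g ?w = 0" using g len_word_le[of "is"] by simp
    ultimately show "ddw (is @ [p]) g id = - \<kappa> / ?r * g (word_prod n (is @ [p]))"
      by (simp add: ddw_simps dd_def word_prod_snoc)
  qed
qed

lemma L_leading:
  assumes "w \<in> W"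
  obtains \<kappa> where "\<kappa> \<noteq> 0" "\<And>g. (\<And>x. x \<in> W \<Longrightarrow> len x < len w \<Longrightarrow> g x = 0) \<Longrightarrow> L w g = \<kappa> * g w"
proof -
  obtain "is" where "is": "reduced_word n w is" using ex_reduced[OF assms] by blast
  show ?thesis using ddw_leading[of "is"] that "is" L_reduced[OF "is"] by (auto simp: reduced_word_def)
qed

text \<open>Triangularity applied to the difference. It permits replacing a function by a Taylor sum
  that represents it on a ball only.\<close>

lemma L_local:
  assumes w: "w \<in> W" and gh: "\<And>x. x \<in> ball (len w) \<Longrightarrow> g x = h x"
  shows "L w g = L w h"
proof -
  obtain \<kappa> where \<kappa>: "\<And>g. (\<And>x. x \<in> W \<Longrightarrow> len x < len w \<Longrightarrow> g x = 0) \<Longrightarrow> L w g = \<kappa> * g w"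
    using L_leading[OF w] by metis
  have "L w (\<lambda>v. g v - h v) = \<kappa> * (g w - h w)" using gh by (intro \<kappa>) (simp add: ball_def)
  then show ?thesis using gh[of w] w by (simp add: L_diff ball_def)
qed

text \<open>Tested on the delta function at a longest element of the support: by triangularity every
  other functional vanishes on it.\<close>

lemma L_independent:
  assumes S: "finite S" "S \<subseteq> W" and 0: "\<And>g. (\<Sum>u\<in>S. c u * L u g) = 0" and u: "u \<in> S"
  shows "c u = 0"
proof (rule ccontr)
  assume "c u \<noteq> 0"
  define A where "A = {u \<in> S. c u \<noteq> 0}"
  have A: "finite A" "A \<noteq> {}" using S u \<open>c u \<noteq> 0\<close> by (auto simp: A_def)
  then have "Max (len ` A) \<in> len ` A" by (intro Max_in) auto
  then obtain x where x: "x \<in> A" "len x = Max (len ` A)" by auto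
  have max: "len y \<le> len x" if "y \<in> A" for y using A that by (simp add: x(2))
  have xW: "x \<in> W" using x S by (auto simp: A_def)
  define \<delta> where "\<delta> y = (if y = x then 1 else 0 :: 'a)" for y
  obtain \<kappa> where \<kappa>: "\<kappa> \<noteq> 0" "\<And>g. (\<And>y. y \<in> W \<Longrightarrow> len y < len x \<Longrightarrow> g y = 0) \<Longrightarrow> L x g = \<kappa> * g x"
    using L_leading[OF xW] by metis
  have "c y * L y \<delta> = 0" if "y \<in> S" "y \<noteq> x" for y
  proof (cases "y \<in> A")
    case True
    have "y \<in> W" using that S by blast
    from L_leading[OF this] obtain \<kappa> where "L y \<delta> = \<kappa> * \<delta> y"
      using max[OF True] by (metis \<delta>_def leD)
    then show ?thesis using that by (simp add: \<delta>_def)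
  qed (use that in \<open>simp add: A_def\<close>)
  then have "(\<Sum>u\<in>S - {x}. c u * L u \<delta>) = 0" by (intro sum.neutral) blast
  then have "(\<Sum>u\<in>S. c u * L u \<delta>) = c x * L x \<delta>"
    using S x by (subst sum.remove[of _ x]) (auto simp: A_def)
  moreover have "L x \<delta> = \<kappa> * \<delta> x" by (rule \<kappa>(2)) (auto simp: \<delta>_def)
  ultimately show False using 0[of \<delta>] \<kappa>(1) x by (simp add: A_def \<delta>_def)
qed

text \<open>The coefficients of v in the basis A_u, expressed by testing v = \<Sum> c_u A_u against
  all functions.\<close>

definition taylor :: "(int \<Rightarrow> int) \<Rightarrow> ((int \<Rightarrow> int) \<Rightarrow> 'a) \<Rightarrow> bool" where
  "taylor v c \<longleftrightarrow> (\<forall>u. u \<notin> ball (len v) \<longrightarrow> c u = 0) \<and>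
     (\<forall>g. g v = (\<Sum>u\<in>ball (len v). c u * L u g))"

lemma taylor_unique: assumes "taylor v c" "taylor v c'" shows "c = c'"
proof
  fix u
  show "c u = c' u"
  proof (cases "u \<in> ball (len v)")
    case True
    have "c u - c' u = 0"
    proof (rule L_independent[OF finite_ball _ _ True])
      fix g
      have "g v = (\<Sum>u\<in>ball (len v). c u * L u g)" "g v = (\<Sum>u\<in>ball (len v). c' u * L u g)"
        using assms unfolding taylor_def by blast+
      then have "(\<Sum>u\<in>ball (len v). (c u - c' u) * L u g) = g v - g v"
        unfolding left_diff_distrib sum_subtractf by simp
      then show "(\<Sum>u\<in>ball (len v). (c u - c' u) * L u g) = 0" by simp
    qed (auto simp: ball_def)
    then show ?thesis by simp
  qed (use assms in \<open>simp add: taylor_def\<close>)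
qed

lemma taylor_id: "taylor id (\<lambda>u. if u = id then 1 else 0)"
  by (simp add: taylor_def ball_0)

lemma bij_betw_comp_s:
  "bij_betw (\<lambda>x. x \<circ> s p) {x \<in> ball N. \<not> desc x p} {x \<in> ball (Suc N). desc x p}"
  by (rule bij_betw_byWitness[where f' = "\<lambda>x. x \<circ> s p"])
    (auto simp: ball_def len_comp_s_asc dest: len_comp_s_desc[where p = p])

text \<open>v s_p is v minus the root times v A_p. Expanding v and multiplying by A_p on the right
  kills the A_u with descent p and turns the others into A_(u s_p); reindexing by x = u s_p gives
  the second term.\<close>

lemma taylor_step:
  assumes v: "v \<in> W" "\<not> desc v p" and c: "taylor v c"
  shows "taylor (v \<circ> s p)
    (\<lambda>x. c x - (E (v p) - E (v (p + 1))) * (if x \<in> W \<and> desc x p then c (x \<circ> s p) else 0))"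
proof -
  let ?\<alpha> = "E (v p) - E (v (p + 1))" and ?N = "len v"
  let ?b = "\<lambda>x. if x \<in> W \<and> desc x p then c (x \<circ> s p) else 0"
  have N: "len (v \<circ> s p) = Suc ?N" using len_comp_s_asc[OF v] by simp
  have sub: "ball ?N \<subseteq> ball (Suc ?N)" by (auto simp: ball_def)
  have c0: "c u = 0" if "u \<notin> ball ?N" for u using c that by (simp add: taylor_def)
  have 1: "c x - ?\<alpha> * ?b x = 0" if "x \<notin> ball (Suc ?N)" for x
  proof -
    have "c x = 0" using that sub c0 by blast
    moreover have "?b x = 0"
      using that len_comp_s_desc[of x p] by (auto simp: ball_def intro!: c0)
    ultimately show ?thesis by simp
  qed
  have 2: "g (v \<circ> s p) = (\<Sum>x\<in>ball (Suc ?N). (c x - ?\<alpha> * ?b x) * L x g)" for g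
  proof -
    have T: "h v = (\<Sum>u\<in>ball (Suc ?N). c u * L u h)" for h
    proof -
      have "h v = (\<Sum>u\<in>ball ?N. c u * L u h)" using c by (simp add: taylor_def)
      also have "\<dots> = (\<Sum>u\<in>ball (Suc ?N). c u * L u h)"
        by (rule sum.mono_neutral_left) (use sub c0 in auto)
      finally show ?thesis .
    qed
    have "dd p g v = (\<Sum>u\<in>ball ?N. c u * L u (dd p g))" using c by (simp add: taylor_def)
    also have "\<dots> = (\<Sum>u\<in>{u \<in> ball ?N. \<not> desc u p}. c u * L (u \<circ> s p) g)"
      by (rule sum.mono_neutral_cong_right[OF finite_ball]) (auto simp: ball_def L_dd_asc L_dd_desc)
    also have "\<dots> = (\<Sum>u\<in>{u \<in> ball ?N. \<not> desc u p}. c ((u \<circ> s p) \<circ> s p) * L (u \<circ> s p) g)"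
      by simp
    also have "\<dots> = (\<Sum>x\<in>{x \<in> ball (Suc ?N). desc x p}. c (x \<circ> s p) * L x g)"
      by (rule sum.reindex_bij_betw[OF bij_betw_comp_s])
    also have "\<dots> = (\<Sum>x\<in>ball (Suc ?N). ?b x * L x g)"
      by (rule sum.mono_neutral_cong_left[OF finite_ball]) (auto simp: ball_def)
    finally have "dd p g v = (\<Sum>x\<in>ball (Suc ?N). ?b x * L x g)" .
    then show ?thesis unfolding dd_step[OF v(1)] using T[of g]
      by (simp add: left_diff_distrib sum_subtractf sum_distrib_left mult.assoc)
  qed
  show ?thesis unfolding taylor_def N using 1 2 by blast
qed

lemma ex1_taylor: assumes "v \<in> W" shows "\<exists>!c. taylor v c"
proof -
  have "\<exists>c. taylor v c" using assms
    by (induction rule: W_induct) (use taylor_id taylor_step in blast)+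
  then show ?thesis using taylor_unique by blast
qed

text \<open>\<open>sch u\<close> is the localisation of the equivariant Schubert class of \<open>u\<close>: the coefficients of
  \<open>v = \<Sum>\<^sub>u sch u v A\<^sub>u\<close> in the twisted group algebra.\<close>

definition sch :: "(int \<Rightarrow> int) \<Rightarrow> (int \<Rightarrow> int) \<Rightarrow> 'a" where
  "sch u v = (THE c. taylor v c) u"

lemma taylor_sch: "v \<in> W \<Longrightarrow> taylor v (\<lambda>u. sch u v)"
  unfolding sch_def using theI'[OF ex1_taylor] by simp

lemma taylor_eq_sch: "v \<in> W \<Longrightarrow> taylor v c \<Longrightarrow> sch u v = c u"
  using taylor_unique[OF taylor_sch] by metis

lemma sch_outside: "v \<in> W \<Longrightarrow> u \<notin> ball (len v) \<Longrightarrow> sch u v = 0"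
  using taylor_sch by (simp add: taylor_def)

lemma taylor_expansion:
  assumes v: "v \<in> W" and N: "len v \<le> N"
  shows "g v = (\<Sum>u\<in>ball N. sch u v * L u g)"
proof -
  have "g v = (\<Sum>u\<in>ball (len v). sch u v * L u g)" using taylor_sch[OF v] by (simp add: taylor_def)
  also have "\<dots> = (\<Sum>u\<in>ball N. sch u v * L u g)"
    by (rule sum.mono_neutral_left[OF finite_ball])
      (use N sch_outside[OF v] in \<open>auto simp: ball_def\<close>)
  finally show ?thesis .
qed

lemma sch_at_id: "sch u id = (if u = id then 1 else 0)"
  using taylor_eq_sch[OF id_in_W taylor_id] .

lemma sch_comp_s:
  assumes v: "v \<in> W" "\<not> desc v p" and u: "u \<in> W"
  shows "sch u (v \<circ> s p) = sch u v - (E (v p) - E (v (p + 1))) * (if desc u p then sch (u \<circ> s p) v else 0)"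
  using taylor_eq_sch[OF _ taylor_step[OF v taylor_sch[OF v(1)]]] v u by simp

text \<open>At an ascent of \<open>v\<close> this is the recursion \<open>sch_comp_s\<close>. At a
  descent it is carried over from v s_p, since both sides are invariant under right multiplication
  by s_p.\<close>

lemma dd_sch:
  assumes u: "u \<in> W"
  shows "dd p (sch u) \<doteq> (if desc u p then sch (u \<circ> s p) else (\<lambda>_. 0))"
proof -
  have asc: "dd p (sch u) v = (if desc u p then sch (u \<circ> s p) v else 0)"
    if v: "v \<in> W" "\<not> desc v p" for v
    using sch_comp_s[OF v u] root_nonzero[OF v(1), of p] by (simp add: dd_def)
  have "dd p (sch u) v = (if desc u p then sch (u \<circ> s p) v else 0)" if v: "v \<in> W" for v
  proof (cases "desc v p")
    case True
    let ?v = "v \<circ> s p"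
    have v': "?v \<in> W" "\<not> desc ?v p" using v True by simp_all
    have "dd p (sch u) v = dd p (sch u) ?v" by (simp add: dd_comp_s)
    also have "\<dots> = (if desc u p then sch (u \<circ> s p) ?v else 0)" by (rule asc[OF v'])
    also have "\<dots> = (if desc u p then sch (u \<circ> s p) v else 0)"
      using sch_comp_s[OF v', of "u \<circ> s p"] u by simp
    finally show ?thesis .
  qed (use asc v in blast)
  then show ?thesis by (simp add: eqW_def)
qed

lemma L_sch:
  assumes "w \<in> W" "u \<in> W"
  shows "L w (sch u) = (if u = w then 1 else 0)"
  using assms
proof (induction arbitrary: u rule: W_induct)
  case id show ?case by (simp only: L_id sch_at_id)
next
  case (s w p)
  have eq: "u \<circ> s p = w \<longleftrightarrow> u = w \<circ> s p" by (metis comp_s_s)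
  have "L (w \<circ> s p) (sch u) = L w (if desc u p then sch (u \<circ> s p) else (\<lambda>_. 0))"
    using s L_cong[OF dd_sch, of u w p] by (simp add: L_dd_asc)
  also have "\<dots> = (if u = w \<circ> s p then 1 else 0)"
  proof -
    have "u \<circ> s p \<in> W" using s.prems by simp
    then have "L w (sch (u \<circ> s p)) = (if u \<circ> s p = w then 1 else 0)" by (rule s.IH)
    then show ?thesis using s.hyps s.prems eq by (auto simp: L_zero)
  qed
  finally show ?case .
qed

text \<open>Identities between classes are proved with this: all divided differences of the
  difference vanish, and so does its value at \<open>id\<close>.\<close>

lemma dd_zero_const:
  assumes "\<And>p. dd p g \<doteq> (\<lambda>_. 0)" "v \<in> W"
  shows "g v = g id"
  using assms(2)
proof (induction rule: W_induct)
  case (s w p)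
  then have "g (w \<circ> s p) = g w" using dd_step[of w g p] eqWD[OF assms(1), of w p] by simp
  then show ?case using s.IH by (simp only:)
qed (rule refl)

lemma sch_id: "v \<in> W \<Longrightarrow> sch id v = 1"
  using dd_zero_const[of "sch id" v] dd_sch[OF id_in_W] by (simp add: desc_def sch_at_id)

end

section \<open>Chevalley's formula and the classes of \<open>\<rho>\<^sub>m\<close>\<close>

context affine_sym
begin

lemma len_t_less_iff:
  assumes u: "u \<in> W" and ij: "\<not> i \<approx> j"
  shows "len (u \<circ> t i j) < len u \<longleftrightarrow> i < j \<and> u j < u i \<or> j < i \<and> u i < u j"
proof -
  have ji: "\<not> j \<approx> i" using ij by (simp add: cong_sym_eq)
  have ne: "i \<noteq> j" "u i \<noteq> u j" using ij W_inj[OF u] by auto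
  consider "i < j" | "j < i" using ne by linarith
  then show ?thesis
  proof cases
    case 1 then show ?thesis
      using len_t_less[OF u 1 ij] len_t_greater[OF u 1 ij] ne by fastforce
  next
    case 2 then show ?thesis
      using len_t_less[OF u 2 ji] len_t_greater[OF u 2 ji] ne t_sym[OF ij] by fastforce
  qed
qed

text \<open>The positions may come in either order: Chevalley's formula fixes the first one and lets
  the second range over both sides, with the side deciding the sign.\<close>

definition cov :: "(int \<Rightarrow> int) \<Rightarrow> int \<Rightarrow> int \<Rightarrow> bool" where
  "cov u i j \<longleftrightarrow> \<not> i \<approx> j \<and> len (u \<circ> t i j) + 1 = len u"

lemma cov_cong: "cov u i j \<Longrightarrow> \<not> i \<approx> j" by (simp add: cov_def)

lemma cov_inv: "u \<in> W \<Longrightarrow> cov u i j \<Longrightarrow> i < j \<and> u j < u i \<or> j < i \<and> u i < u j"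
  using len_t_less_iff[of u i j] by (simp add: cov_def)

lemma cov_inv_less: "u \<in> W \<Longrightarrow> cov u i j \<Longrightarrow> i < j \<Longrightarrow> u j < u i"
  using cov_inv[of u i j] by simp

lemma cov_W: "u \<in> W \<Longrightarrow> cov u i j \<Longrightarrow> u \<circ> t i j \<in> W"
  by (simp add: cov_def comp_t_in_W)

lemma finite_cov: assumes "u \<in> W" shows "finite {j. cov u r j}"
proof -
  obtain B where B: "\<And>x. \<bar>u x - x\<bar> \<le> B" using W_displacement_bound[OF assms] by blast
  have "{j. cov u r j} \<subseteq> {r - 2 * B..r + 2 * B}"
  proof
    fix j assume "j \<in> {j. cov u r j}"
    then show "j \<in> {r - 2 * B..r + 2 * B}"
      using cov_inv[OF assms, of r j] B[of r] B[of j] by auto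
  qed
  then show ?thesis using finite_subset by blast
qed

text \<open>The pairs whose order \<open>s p\<close> reverses, with \<open>r\<close> as the first
  entry.\<close>

definition special :: "int \<Rightarrow> int \<Rightarrow> int \<Rightarrow> bool" where
  "special p r j \<longleftrightarrow> r \<approx> p \<and> j = r + 1 \<or> r \<approx> p + 1 \<and> j = r - 1"

lemma special_refl: assumes "special p r j" shows "t r j = s p"
  using assms unfolding special_def
proof
  assume "r \<approx> p \<and> j = r + 1"
  then show ?thesis using s_cong[of r p] by (simp add: s_eq)
next
  assume a: "r \<approx> p + 1 \<and> j = r - 1"
  then have "r - 1 \<approx> p" using cg_add_iff[of "r - 1" 1 p] by simp
  moreover have "\<not> r \<approx> r - 1" using not_cg_Suc[of "r - 1"] by simp
  ultimately show ?thesis using s_cong[of "r - 1" p] t_sym[of r "r - 1"] a by (simp add: s_eq)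
qed

lemma s_less_iff: assumes "\<not> special p r j" shows "s p j < s p r \<longleftrightarrow> j < r"
proof -
  have inj: "s p j = s p r \<longleftrightarrow> j = r" by (metis s_invol)
  have "r < j \<Longrightarrow> s p r < s p j"
    using s_order[of r j p] assms by (force simp: special_def)
  moreover have "j < r \<Longrightarrow> s p j < s p r"
    using s_order[of j r p] assms by (force simp: special_def)
  ultimately show ?thesis using inj by (metis less_asym' linorder_neqE_linordered_idom)
qed

lemma s_sgn: assumes "\<not> special p r j" shows "sgn (s p j - s p r) = sgn (j - r)"
proof -
  have "s p j = s p r \<longleftrightarrow> j = r" by (metis s_invol)
  then show ?thesis using s_less_iff[OF assms] by (auto simp: sgn_if)
qed

lemma s_cg: "s p x \<approx> s p y \<longleftrightarrow> x \<approx> y" by (rule W_cg[OF s_in_W])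

lemma comp_s_t: "\<not> r \<approx> j \<Longrightarrow> w \<circ> s p \<circ> t r j = w \<circ> t (s p r) (s p j) \<circ> s p"
  using t_conj[OF s_in_W, of r j p] by (simp add: comp_assoc)

text \<open>Moving \<open>s p\<close> to the right turns \<open>w \<circ> s p \<circ> t r j\<close>
  into \<open>?x \<circ> s p\<close>. Off the special pairs \<open>s p\<close> keeps the order of
  \<open>r\<close> and \<open>j\<close>, so the conjugated reflection lowers \<open>w\<close>
  whenever \<open>t r j\<close> lowers \<open>w \<circ> s p\<close>. The lengths then force
  \<open>?x\<close> to be covered by \<open>w\<close> and to ascend at \<open>p\<close>.\<close>

lemma cov_comp_s_iff:
  assumes w: "w \<in> W" "\<not> desc w p" and ns: "\<not> special p r j"
  shows "cov (w \<circ> s p) r j \<longleftrightarrow> cov w (s p r) (s p j) \<and> \<not> desc (w \<circ> t (s p r) (s p j)) p"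
proof (cases "r \<approx> j")
  case False
  let ?x = "w \<circ> t (s p r) (s p j)"
  have cg: "\<not> s p r \<approx> s p j" using False by (simp add: s_cg)
  have x: "?x \<in> W" using w cg by (simp add: comp_t_in_W)
  have lw: "len (w \<circ> s p) = len w + 1" using w by (rule len_comp_s_asc)
  have eq: "w \<circ> s p \<circ> t r j = ?x \<circ> s p" using comp_s_t[OF False] .
  show ?thesis
  proof
    assume c: "cov (w \<circ> s p) r j"
    then have l: "len (?x \<circ> s p) = len w" using lw by (simp add: cov_def eq)
    have "j \<noteq> r" using False by auto
    have "r < j \<and> (w \<circ> s p) j < (w \<circ> s p) r \<or> j < r \<and> (w \<circ> s p) r < (w \<circ> s p) j"
      using cov_inv[OF _ c] w by simp
    moreover have "j < r \<longleftrightarrow> s p j < s p r" "r < j \<longleftrightarrow> s p r < s p j"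
      using s_less_iff[OF ns] \<open>j \<noteq> r\<close> by (auto, (metis s_invol not_less_iff_gr_or_eq)+)
    ultimately have "len ?x < len w" using w by (simp add: len_t_less_iff[OF w(1) cg])
    then have "len ?x + 1 = len w" "\<not> desc ?x p"
      using l len_comp_s_le[OF x, of p] len_comp_s_desc[OF x, of p] by linarith+
    then show "cov w (s p r) (s p j) \<and> \<not> desc ?x p" using cg by (simp add: cov_def)
  next
    assume "cov w (s p r) (s p j) \<and> \<not> desc ?x p"
    then show "cov (w \<circ> s p) r j"
      using len_comp_s_asc[OF x, of p] lw False by (simp add: cov_def eq)
  qed
qed (simp add: cov_def s_cg)

end

context affine_weights
begin

text \<open>The pairing of the weight e_r with the simple coroot of index p.\<close>

definition eps :: "int \<Rightarrow> int \<Rightarrow> 'a" where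
  "eps p r = (if r \<approx> p then 1 else if r \<approx> p + 1 then - 1 else 0)"

text \<open>The commutation rule A_p e_r = e_(s_p(r)) A_p + <e_r, coroot of p>, because v |->
  e_(v(r)) g(v) is g evaluated after right multiplication by e_r.\<close>

lemma dd_weight: "dd p (\<lambda>v. E (v r) * g v) \<doteq> (\<lambda>v. E (v (s p r)) * dd p g v + eps p r * g v)"
  unfolding eqW_def
proof
  fix v assume v: "v \<in> W"
  let ?a = "E (v p) - E (v (p + 1))"
  have a: "?a \<noteq> 0" by (rule root_nonzero[OF v])
  have E: "E (v x) = E (v y)" if "x \<approx> y" for x y using that by (simp add: E_eq_iff W_cg[OF v])
  have "E (v r) - E (v (s p r)) = ?a * eps p r"
  proof -
    consider "r \<approx> p" | "r \<approx> p + 1" "\<not> r \<approx> p" | "\<not> r \<approx> p" "\<not> r \<approx> p + 1" by blast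
    then show ?thesis
    proof cases
      case 1
      then have "s p r = r + 1" "r + 1 \<approx> p + 1" by (simp_all add: s_eq)
      then show ?thesis using 1 E[OF 1] E[of "r + 1" "p + 1"] by (simp add: eps_def)
    next
      case 2
      then have "s p r = r - 1" "r - 1 \<approx> p" using cg_add_iff[of "r - 1" 1 p] by (simp_all add: s_eq t_right)
      then show ?thesis using 2 E[OF 2(1)] E[of "r - 1" "p"] by (simp add: eps_def)
    next
      case 3 then show ?thesis by (simp add: eps_def s_other)
    qed
  qed
  then have e: "E (v r) = E (v (s p r)) + ?a * eps p r" by (simp add: algebra_simps)
  have "E (v r) * g v - E (v (s p r)) * g (v \<circ> s p) = ?a * (E (v (s p r)) * dd p g v + eps p r * g v)"
    unfolding dd_step[OF v] e by (simp add: algebra_simps)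
  then show "dd p (\<lambda>v. E (v r) * g v) v = E (v (s p r)) * dd p g v + eps p r * g v"
    using a by (simp add: dd_def[of p "\<lambda>v. E (v r) * g v"])
qed

text \<open>Chevalley's formula in dual form: \<open>A\<^sub>u e\<^sub>r = e\<^bsub>u(r)\<^esub> A\<^sub>u + \<Sum>\<^sub>j \<plusminus> A\<^bsub>u t\<^esub>\<close>.\<close>

lemma L_weight:
  assumes "u \<in> W"
  shows "L u (\<lambda>v. E (v r) * g v) =
    E (u r) * L u g + (\<Sum>j | cov u r j. of_int (sgn (j - r)) * L (u \<circ> t r j) g)"
  using assms
proof (induction arbitrary: r g rule: W_induct)
  case id
  have "{j. cov id r j} = {}" by (auto simp: cov_def)
  then have "L id (\<lambda>v. E (v r) * g v) =
    E (id r) * L id g + (\<Sum>j | cov id r j. of_int (sgn (j - r)) * L (id \<circ> t r j) g)"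
    unfolding L_id by simp
  then show ?case .
next
  case (s w p)
  let ?u = "w \<circ> s p" and ?r = "s p r"
  let ?x = "\<lambda>j. w \<circ> t ?r j"
  have w: "w \<in> W" "\<not> desc w p" by fact+
  have u: "?u \<in> W" using w by simp
  have xs: "?x j \<circ> s p = ?u \<circ> t r (s p j)" if "\<not> ?r \<approx> j" for j
    using comp_s_t[of r "s p j" w p] that s_cg[of p r "s p j"] by simp
  have "L ?u (\<lambda>v. E (v r) * g v) = L w (\<lambda>v. E (v ?r) * dd p g v + eps p r * g v)"
    using L_cong[OF dd_weight] w by (simp flip: L_dd_asc)
  also have "\<dots> = L w (\<lambda>v. E (v ?r) * dd p g v) + eps p r * L w g"
    by (simp add: L_add L_scale)
  also have "L w (\<lambda>v. E (v ?r) * dd p g v) = E (w ?r) * L w (dd p g) +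
      (\<Sum>j | cov w ?r j. of_int (sgn (j - ?r)) * L (?x j) (dd p g))"
    by (rule s.IH)
  also have "E (w ?r) * L w (dd p g) = E (?u r) * L ?u g" using w by (simp add: L_dd_asc)
  also have "(\<Sum>j | cov w ?r j. of_int (sgn (j - ?r)) * L (?x j) (dd p g)) =
      (\<Sum>j | cov w ?r j \<and> \<not> desc (?x j) p. of_int (sgn (j - ?r)) * L (?u \<circ> t r (s p j)) g)"
  proof (rule sum.mono_neutral_cong_right)
    show "finite {j. cov w ?r j}" by (rule finite_cov[OF w(1)])
    fix j assume "j \<in> {j. cov w ?r j \<and> \<not> desc (?x j) p}"
    then show "of_int (sgn (j - ?r)) * L (?x j) (dd p g) =
        of_int (sgn (j - ?r)) * L (?u \<circ> t r (s p j)) g"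
      using L_dd_asc[of "?x j" p g] xs[of j] w cov_W[of w ?r j] cov_cong[of w ?r j] by simp
  qed (use w in \<open>auto simp: L_dd_desc cov_W\<close>)
  also have "\<dots> = (\<Sum>j | cov ?u r j \<and> \<not> special p r j. of_int (sgn (j - r)) * L (?u \<circ> t r j) g)"
  proof (rule sum.reindex_bij_witness[where i = "s p" and j = "s p"])
    fix j assume j: "j \<in> {j. cov w ?r j \<and> \<not> desc (?x j) p}"
    \<comment> \<open>A special pair would make \<open>?x j\<close> equal to
      \<open>w \<circ> s p\<close>, which is longer than \<open>w\<close> and not covered by
      it.\<close>
    have ns: "\<not> special p r (s p j)"
    proof
      assume sp: "special p r (s p j)"
      then have "t r (s p j) = s p" by (rule special_refl)
      then have "?x j = w \<circ> s p" using xs[of j] j by (metis (mono_tags) comp_s_s cov_cong mem_Collect_eq)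
      then show False using j len_comp_s_asc[OF w] by (simp add: cov_def)
    qed
    show "s p (s p j) = j" by simp
    show "s p j \<in> {j. cov ?u r j \<and> \<not> special p r j}"
      using cov_comp_s_iff[OF w ns] j ns by simp
    show "of_int (sgn (s p j - r)) * L (?u \<circ> t r (s p j)) g = of_int (sgn (j - ?r)) * L (?u \<circ> t r (s p j)) g"
      using s_sgn[OF ns] by simp
  next
    fix j assume j: "j \<in> {j. cov ?u r j \<and> \<not> special p r j}"
    then show "s p j \<in> {j. cov w ?r j \<and> \<not> desc (?x j) p}"
      using cov_comp_s_iff[OF w, of r j] by simp
    show "s p (s p j) = j" by simp
  qed
  finally have *: "L ?u (\<lambda>v. E (v r) * g v) = E (?u r) * L ?u g +
    ((\<Sum>j | cov ?u r j \<and> \<not> special p r j. of_int (sgn (j - r)) * L (?u \<circ> t r j) g) + eps p r * L w g)"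
    by (simp only: add.assoc)
  \<comment> \<open>The special reflection leads from \<open>w \<circ> s p\<close> back to
    \<open>w\<close>, and the sign of its term is \<open>eps p r\<close>. So the scalar in the
    commutation rule accounts exactly for the covers that were set aside.\<close>
  have "(\<Sum>j | cov ?u r j \<and> special p r j. of_int (sgn (j - r)) * L (?u \<circ> t r j) g) = eps p r * L w g"
  proof -
    have sp: "cov ?u r j" if "special p r j" for j
      using special_refl[OF that] len_comp_s_asc[OF w] that not_cg_Suc[of "r - 1"]
      by (auto simp: cov_def special_def)
    have "\<not> (r \<approx> p \<and> r \<approx> p + 1)" using not_cg_Suc(2)[of p] by (meson cong_sym cong_trans)
    then have "{j. special p r j} = (if r \<approx> p then {r + 1} else if r \<approx> p + 1 then {r - 1} else {})"
      by (auto simp: special_def)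
    moreover have "{j. cov ?u r j \<and> special p r j} = {j. special p r j}" using sp by blast
    ultimately have set: "{j. cov ?u r j \<and> special p r j} =
      (if r \<approx> p then {r + 1} else if r \<approx> p + 1 then {r - 1} else {})" by simp
    have t: "?u \<circ> t r j = w" if "special p r j" for j using special_refl[OF that] by simp
    show ?thesis unfolding set using t[of "r + 1"] t[of "r - 1"]
      by (auto simp: eps_def special_def)
  qed
  moreover have "(\<Sum>j | cov ?u r j. of_int (sgn (j - r)) * L (?u \<circ> t r j) g) =
    (\<Sum>j | cov ?u r j \<and> \<not> special p r j. of_int (sgn (j - r)) * L (?u \<circ> t r j) g) +
    (\<Sum>j | cov ?u r j \<and> special p r j. of_int (sgn (j - r)) * L (?u \<circ> t r j) g)"
    by (subst sum.union_disjoint[symmetric])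
      (auto intro!: sum.cong finite_subset[OF _ finite_cov[OF u, of r]])
  ultimately have "L ?u (\<lambda>v. E (v r) * g v) =
    E (?u r) * L ?u g + (\<Sum>j | cov ?u r j. of_int (sgn (j - r)) * L (?u \<circ> t r j) g)"
    unfolding * by simp
  then show ?case .
qed

end

section \<open>The elements \<open>rr m k\<close> and the recursion for their classes\<close>

context affine_sym
begin

primrec rr :: "nat \<Rightarrow> int \<Rightarrow> int \<Rightarrow> int" where
  "rr 0 k = id"
| "rr (Suc m) k = rr m (k - 1) \<circ> s k"

lemma rr_in_W [simp]: "rr m k \<in> W"
  by (induction m arbitrary: k) (simp_all add: id_in_W del: comp_apply)

text \<open>\<open>s k\<close> inverts only pairs whose right end has residue k + 1, and it moves
  that residue to k, which is the exceptional one for \<open>rr m (k - 1)\<close>. Hence descents of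
  \<open>rr m k\<close> can occur only at the residue k.\<close>

lemma rr_order: "x < y \<Longrightarrow> \<not> y \<approx> k + 1 \<Longrightarrow> rr m k x < rr m k y"
proof (induction m arbitrary: k x y)
  case (Suc m)
  have "s k x < s k y"
  proof (rule ccontr)
    assume "\<not> ?thesis"
    then have "x \<approx> k \<and> y = x + 1" using s_order[of x y k] Suc.prems by simp
    then show False using Suc.prems by simp
  qed
  moreover have "\<not> s k y \<approx> k"
    using s_cg[of k y "k + 1"] Suc.prems by simp
  ultimately show ?case using Suc.IH[of "s k x" "s k y" "k - 1"] by simp
qed simp

lemma rr_not_desc: "\<not> p \<approx> k \<Longrightarrow> \<not> desc (rr m k) p"
  using rr_order[of p "p + 1" k m] by (simp add: desc_def)

lemma rr_desc: "desc (rr (Suc m) k) k"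
proof -
  have "\<not> k \<approx> k - 1" using not_cg_Suc[of "k - 1"] by simp
  then have "\<not> desc (rr m (k - 1)) k" by (rule rr_not_desc)
  then show ?thesis by simp
qed

lemma rr_Suc_comp_s: "rr (Suc m) k \<circ> s k = rr m (k - 1)" by simp

declare rr.simps(2) [simp del]

lemma rr_Suc_not_id: "rr (Suc m) k \<noteq> id"
proof
  assume "rr (Suc m) k = id"
  then have "desc id k" using rr_desc[of m k] by (simp only:)
  then show False by (simp add: desc_def)
qed

end

context affine_weights
begin

lemma dd_lin: "dd p (\<lambda>v. g v - h v) v = dd p g v - dd p h v" "dd p (\<lambda>v. c * g v) v = c * dd p g v"
  "dd p (\<lambda>v. g v + h v) v = dd p g v + dd p h v"
  by (simp_all add: dd_def diff_divide_distrib add_divide_distrib right_diff_distrib)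

text \<open>Both sides have the same divided differences and the same value at \<open>id\<close>. At
  the residue k + 1 the scalar of the commutation rule cancels the difference of the left side; at
  the residue k the claim turns into the same identity for m - 1 and k - 1, hence the induction on
  \<open>m\<close>.\<close>

lemma sch_rr_step:
  "v \<in> W \<Longrightarrow> sch (rr (Suc m) (k + 1)) v =
     sch (rr (Suc m) k) v + (E (v (k + 1)) - E (rr m k (k + 1))) * sch (rr m k) v"
proof (induction m arbitrary: k v rule: less_induct)
  case (less m)
  note v = less.prems
  define A B C c where "A = sch (rr (Suc m) (k + 1))" and "B = sch (rr (Suc m) k)"
    and "C = sch (rr m k)" and "c = E (rr m k (k + 1))"
  define g where "g v = A v - B v - (E (v (k + 1)) * C v - c * C v)" for v
  have "dd p g \<doteq> (\<lambda>_. 0)" for p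
    unfolding eqW_def
  proof
    fix x assume x: "x \<in> W"
    have EC: "dd p (\<lambda>v. E (v (k + 1)) * C v) x = E (x (s p (k + 1))) * dd p C x + eps p (k + 1) * C x"
      using eqWD[OF dd_weight x] .
    have ddg: "dd p g x = dd p A x - dd p B x - (dd p (\<lambda>v. E (v (k + 1)) * C v) x - c * dd p C x)"
      unfolding g_def[abs_def] by (simp add: dd_lin)
    have sch0: "dd p (sch (rr m k)) x = 0" if "\<not> p \<approx> k" for m k
      using eqWD[OF dd_sch x, of "rr m k" p] rr_not_desc[OF that] by simp
    have sch1: "dd p (sch (rr (Suc m) k)) x = sch (rr m (k - 1)) x" if "p \<approx> k" for m k
    proof -
      have "desc (rr (Suc m) k) p" using desc_cong[OF rr_in_W that] rr_desc by blast
      moreover have "rr (Suc m) k \<circ> s p = rr m (k - 1)"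
        unfolding s_cong[OF that] by (rule rr_Suc_comp_s)
      ultimately show ?thesis
        using eqWD[OF dd_sch[OF rr_in_W[of "Suc m" k]] x, of p] by (simp only: if_True)
    qed
    have "\<not> (p \<approx> k \<and> p \<approx> k + 1)" using not_cg_Suc(2)[of k] by (meson cong_sym cong_trans)
    then consider "p \<approx> k + 1" "\<not> p \<approx> k" | "p \<approx> k" "\<not> p \<approx> k + 1" | "\<not> p \<approx> k" "\<not> p \<approx> k + 1"
      by blast
    then show "dd p g x = 0"
    proof cases
      case 1
      then have "eps p (k + 1) = 1" by (simp add: eps_def cong_sym_eq)
      then show ?thesis unfolding ddg EC using sch1[OF 1(1), of m] sch0[OF 1(2)]
        by (simp add: A_def B_def C_def)
    next
      case 2
      have e: "eps p (k + 1) = -1" using 2 by (simp add: eps_def cong_sym_eq)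
      have spk: "s p (k + 1) = k" using s_cong[OF 2(1)] by simp
      show ?thesis
      proof (cases m)
        case 0
        then show ?thesis unfolding ddg EC
          using sch1[OF 2(1), of 0] sch0[OF 2(2), of "Suc 0"] eqWD[OF dd_sch[OF id_in_W] x, of p]
          by (simp add: A_def B_def C_def e desc_def)
      next
        case (Suc m')
        \<comment> \<open>The constants for (m, k) and (m - 1, k - 1) agree, both being the weight
          of k + 1 - m; without this the induction hypothesis would not match.\<close>
        have "rr (Suc m') k (k + 1) = rr m' (k - 1) k" by (simp add: rr.simps(2))
        then have "C x = sch (rr m (k - 1)) x + (E (x k) - c) * sch (rr m' (k - 1)) x"
          using less.IH[of m' x "k - 1"] x by (simp add: C_def Suc c_def)
        then show ?thesis unfolding ddg EC e spk
          using sch1[OF 2(1), of m] sch0[OF 2(2), of "Suc m"] sch1[OF 2(1), of m']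
          by (simp add: A_def B_def C_def Suc) (simp add: algebra_simps)
      qed
    next
      case 3
      then have "eps p (k + 1) = 0" by (simp add: eps_def cong_sym_eq)
      then show ?thesis unfolding ddg EC using sch0[OF 3(1)] sch0[OF 3(2)]
        by (simp add: A_def B_def C_def)
    qed
  qed
  then have "g v = g id" using dd_zero_const v by blast
  \<comment> \<open>For \<open>m = 0\<close> the class of \<open>id\<close> is 1, but its
    coefficient vanishes at \<open>id\<close>; for larger \<open>m\<close> all three classes vanish
    there.\<close>
  also have "g id = 0"
    using rr_Suc_not_id[of m k] rr_Suc_not_id[of m "k + 1"] rr_Suc_not_id[of "m - 1" k]
    by (cases m) (simp_all add: g_def A_def B_def C_def c_def sch_at_id)
  finally show ?case
    by (simp add: g_def A_def B_def C_def c_def algebra_simps)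
qed

text \<open>The coefficient of A_x \<otimes> A_w in the coproduct of A_u: the coproduct is dual to
  pointwise multiplication of functions.\<close>

definition pstr :: "(int \<Rightarrow> int) \<Rightarrow> (int \<Rightarrow> int) \<Rightarrow> (int \<Rightarrow> int) \<Rightarrow> 'a" where
  "pstr x w u = L u (\<lambda>v. sch x v * sch w v)"

lemma pstr_desc:
  assumes "x \<in> W" "w \<in> W" "u \<in> W" "\<not> desc x p" "desc u p"
  shows "pstr x w u = (if desc w p then pstr x (w \<circ> s p) (u \<circ> s p) else 0)"
proof -
  have inv: "sch x (v \<circ> s p) = sch x v" if "v \<in> W" for v
    using dd_step[OF that, of "sch x" p] eqWD[OF dd_sch that, of x p] assms by simp
  have "dd p (\<lambda>v. sch x v * sch w v) v = sch x v * dd p (sch w) v" if "v \<in> W" for v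
    by (simp add: dd_def inv[OF that] right_diff_distrib)
  then have "dd p (\<lambda>v. sch x v * sch w v) \<doteq> (\<lambda>v. sch x v * (if desc w p then sch (w \<circ> s p) else (\<lambda>_. 0)) v)"
    using eqWD[OF dd_sch[OF assms(2)], of _ p] by (auto simp: eqW_def)
  then have "L (u \<circ> s p) (dd p (\<lambda>v. sch x v * sch w v)) =
      L (u \<circ> s p) (\<lambda>v. sch x v * (if desc w p then sch (w \<circ> s p) else (\<lambda>_. 0)) v)"
    by (rule L_cong)
  moreover have "L (u \<circ> s p) (dd p (\<lambda>v. sch x v * sch w v)) = pstr x w u"
    using L_dd_asc[of "u \<circ> s p" p] assms by (simp add: pstr_def)
  ultimately show ?thesis by (simp add: pstr_def L_zero)
qed

lemma pstr_id: "w \<in> W \<Longrightarrow> u \<in> W \<Longrightarrow> pstr id w u = (if w = u then 1 else 0)"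
proof -
  assume "w \<in> W" "u \<in> W"
  have "pstr id w u = L u (sch w)"
    unfolding pstr_def by (rule L_cong) (simp add: eqW_def sch_id)
  then show ?thesis using L_sch[OF \<open>u \<in> W\<close> \<open>w \<in> W\<close>] by simp
qed

lemma pstr_at_id: "x \<noteq> id \<Longrightarrow> pstr x w id = 0"
  by (simp add: pstr_def sch_at_id)

lemma pstr_rr_step:
  assumes u: "u \<in> W"
  shows "pstr (rr (Suc m) (k + 1)) w u = pstr (rr (Suc m) k) w u +
    (E (u (k + 1)) - E (rr m k (k + 1))) * pstr (rr m k) w u +
    (\<Sum>j | cov u (k + 1) j. of_int (sgn (j - (k + 1))) * pstr (rr m k) w (u \<circ> t (k + 1) j))"
proof -
  let ?c = "E (rr m k (k + 1))"
  let ?g = "\<lambda>v. sch (rr m k) v * sch w v"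
  have "pstr (rr (Suc m) (k + 1)) w u = L u (\<lambda>v. sch (rr (Suc m) k) v * sch w v +
      (E (v (k + 1)) * ?g v - ?c * ?g v))"
    unfolding pstr_def
    by (rule L_cong) (unfold eqW_def, intro ballI, subst sch_rr_step,
        simp_all only: algebra_simps)
  also have "\<dots> = pstr (rr (Suc m) k) w u + (L u (\<lambda>v. E (v (k + 1)) * ?g v) - ?c * L u ?g)"
    by (simp only: L_add L_diff L_scale pstr_def)
  finally show ?thesis unfolding L_weight[OF u] by (simp add: pstr_def algebra_simps)
qed

end

section \<open>The structure constants\<close>

lemma Sym_0 [simp]: "0 \<in> Sym n" by (simp add: Sym_def)

lemma Sym_of_int [simp]: "of_int c \<in> Sym n"
  by (cases "c = 0") (auto simp: Sym_def simp flip: single_of_int)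

lemma Sym_1 [simp]: "1 \<in> Sym n" using Sym_of_int[of 1] by simp

lemma Sym_add: "p \<in> Sym n \<Longrightarrow> q \<in> Sym n \<Longrightarrow> p + q \<in> Sym n"
  using Poly_Mapping.keys_add[of p q] unfolding Sym_def by blast

lemma Sym_uminus: "p \<in> Sym n \<Longrightarrow> - p \<in> Sym n" by (simp add: Sym_def)

lemma Sym_mult: assumes "p \<in> Sym n" "q \<in> Sym n" shows "p * q \<in> Sym n"
  unfolding Sym_def
proof (intro CollectI ballI)
  fix x assume "x \<in> Poly_Mapping.keys (p * q)"
  then obtain a b where "a \<in> Poly_Mapping.keys p" "b \<in> Poly_Mapping.keys q" "x = a + b"
    using Poly_Mapping.keys_mult[of p q] by blast
  then show "Poly_Mapping.keys x \<subseteq> {1..<n}"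
    using assms Poly_Mapping.keys_add[of a b] unfolding Sym_def by blast
qed

lemma Sym_sum: "(\<And>x. x \<in> A \<Longrightarrow> f x \<in> Sym n) \<Longrightarrow> sum f A \<in> Sym n"
  by (induction A rule: infinite_finite_induct) (auto intro: Sym_add)

lemma Sym_prod: "(\<And>x. x \<in> A \<Longrightarrow> f x \<in> Sym n) \<Longrightarrow> prod f A \<in> Sym n"
  by (induction A rule: infinite_finite_induct) (auto intro: Sym_mult)

lemma Sym_power: "p \<in> Sym n \<Longrightarrow> p ^ k \<in> Sym n"
  by (induction k) (auto intro: Sym_mult)

lemma Sym_Var: "j \<in> {1..<n} \<Longrightarrow> Var j \<in> Sym n"
  by (simp add: Sym_def Var_def)

lemma Sym_e_wt: assumes "n > 0" shows "e_wt n i \<in> Sym n"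
proof -
  have "nat (i mod int n) < n" using assms by (simp add: nat_less_iff)
  then show ?thesis
    by (auto simp: e_wt_def Let_def intro!: Sym_uminus Sym_sum Sym_Var)
qed

lemma Sym_subst_pol: "(\<And>j. \<sigma> j \<in> Sym n) \<Longrightarrow> subst_pol \<sigma> p \<in> Sym n"
  unfolding subst_pol_def by (intro Sym_sum Sym_mult Sym_prod Sym_power Sym_of_int)

lemma Frac_Fract: "a \<in> Sym n \<Longrightarrow> b \<in> Sym n \<Longrightarrow> b \<noteq> 0 \<Longrightarrow> Fract a b \<in> Frac n"
  by (auto simp: Frac_def)

lemma FracE:
  assumes "q \<in> Frac n"
  obtains a b where "q = Fract a b" "a \<in> Sym n" "b \<in> Sym n" "b \<noteq> 0"
  using assms by (auto simp: Frac_def)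

lemma Frac_of_Sym: "a \<in> Sym n \<Longrightarrow> Fract a 1 \<in> Frac n"
  by (rule Frac_Fract) simp_all

lemma Frac_0 [simp]: "0 \<in> Frac n" and Frac_1 [simp]: "1 \<in> Frac n"
  using Frac_of_Sym[of 0 n] Frac_of_Sym[of 1 n] by (simp_all add: Zero_fract_def One_fract_def)

lemma Frac_add: "p \<in> Frac n \<Longrightarrow> q \<in> Frac n \<Longrightarrow> p + q \<in> Frac n"
  by (elim FracE) (auto intro!: Frac_Fract Sym_add Sym_mult)

lemma Frac_mult: "p \<in> Frac n \<Longrightarrow> q \<in> Frac n \<Longrightarrow> p * q \<in> Frac n"
  by (elim FracE) (auto intro!: Frac_Fract Sym_mult)

lemma Frac_uminus: "p \<in> Frac n \<Longrightarrow> - p \<in> Frac n"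
  by (elim FracE) (auto intro!: Frac_Fract Sym_uminus)

lemma Frac_diff: "p \<in> Frac n \<Longrightarrow> q \<in> Frac n \<Longrightarrow> p - q \<in> Frac n"
  using Frac_add[of p n "- q"] Frac_uminus[of q n] by simp

lemma Frac_inverse: "p \<in> Frac n \<Longrightarrow> inverse p \<in> Frac n"
proof (elim FracE)
  fix a b assume "p = Fract a b" "a \<in> Sym n" "b \<in> Sym n" "b \<noteq> 0"
  then show ?thesis by (cases "a = 0") (auto intro: Frac_Fract simp: fract_collapse)
qed

lemma Frac_divide: "p \<in> Frac n \<Longrightarrow> q \<in> Frac n \<Longrightarrow> p / q \<in> Frac n"
  unfolding divide_inverse by (intro Frac_mult Frac_inverse)

text \<open>Linear coefficients separate the weights: e_n has -1 at every variable, any other weight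
  has 1 at its own variable and 0 elsewhere. Of two different residues at least one is nonzero, and
  its variable tells them apart.\<close>

lemma e_wt_inj:
  assumes n: "n > 0" and eq: "e_wt n x = e_wt n y"
  shows "[x = y] (mod int n)"
proof -
  have Var_coeff: "Poly_Mapping.lookup (Var j) (Poly_Mapping.single i 1) = (if i = j then 1 else 0)" for i j
    by (simp add: Var_def lookup_single when_def poly_mapping_eq_iff fun_eq_iff)
  have coeff: "Poly_Mapping.lookup (e_wt n z) (Poly_Mapping.single i 1) =
      (if z mod int n = 0 then -1 else if z mod int n = int i then 1 else 0)" if "i \<in> {1..<n}" for z i
  proof -
    have "(\<Sum>j = 1..<n. Poly_Mapping.lookup (Var j) (Poly_Mapping.single i 1)) = 1"
      using that unfolding Var_coeff by simp
    moreover have "nat (z mod int n) = 0 \<longleftrightarrow> z mod int n = 0" "nat (z mod int n) = i \<longleftrightarrow> z mod int n = int i"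
      using n by (auto simp: nat_eq_iff)
    moreover have "(i = nat (z mod int n)) = (nat (z mod int n) = i)" by (rule eq_commute)
    ultimately show ?thesis
      by (simp add: e_wt_def Let_def lookup_sum Var_coeff[unfolded One_nat_def])
  qed
  have "x mod int n = y mod int n"
  proof (rule ccontr)
    assume ne: "x mod int n \<noteq> y mod int n"
    have pos: "0 \<le> z mod int n" "z mod int n < int n" for z using n by simp_all
    have "x mod int n \<noteq> 0 \<or> y mod int n \<noteq> 0" using ne by auto
    then obtain z where z: "z \<in> {x, y}" "z mod int n \<noteq> 0" by blast
    have i: "nat (z mod int n) \<in> {1..<n}" using pos[of z] z by auto
    show False
      using coeff[OF i, of x] coeff[OF i, of y] z ne pos eq by (auto split: if_splits)
  qed
  then show ?thesis by (simp add: cong_def)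
qed

section \<open>Linear functionals on finitely supported functions\<close>

lemma lookup_scale: "Poly_Mapping.lookup (scale c f) k = c * Poly_Mapping.lookup f k"
  by (simp add: scale_def map.rep_eq when_def)

definition pm_eval :: "('k \<Rightarrow> 'a) \<Rightarrow> ('k \<Rightarrow>\<^sub>0 'a) \<Rightarrow> 'a::comm_ring_1" where
  "pm_eval h T = (\<Sum>k\<in>Poly_Mapping.keys T. Poly_Mapping.lookup T k * h k)"

lemma pm_eval_superset:
  assumes "finite S" "Poly_Mapping.keys T \<subseteq> S"
  shows "pm_eval h T = (\<Sum>k\<in>S. Poly_Mapping.lookup T k * h k)"
  unfolding pm_eval_def by (rule sum.mono_neutral_left) (use assms in \<open>auto simp: in_keys_iff\<close>)

lemma pm_eval_add: "pm_eval h (T + U) = pm_eval h T + pm_eval h U"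
proof -
  let ?S = "Poly_Mapping.keys T \<union> Poly_Mapping.keys U"
  have "Poly_Mapping.keys (T + U) \<subseteq> ?S" by (rule Poly_Mapping.keys_add)
  then show ?thesis
    by (subst (1 2 3) pm_eval_superset[of ?S]) (auto simp: lookup_add distrib_right sum.distrib)
qed

lemma pm_eval_0 [simp]: "pm_eval h 0 = 0" by (simp add: pm_eval_def)

lemma pm_eval_sum: "pm_eval h (sum f A) = (\<Sum>a\<in>A. pm_eval h (f a))"
  by (induction A rule: infinite_finite_induct) (simp_all add: pm_eval_add)

lemma pm_eval_single: "pm_eval h (Poly_Mapping.single k c) = c * h k"
  by (subst pm_eval_superset[of "{k}"]) auto

lemma pm_eval_scale: "pm_eval h (scale c T) = c * pm_eval h T"
proof -
  have "Poly_Mapping.keys (scale c T) \<subseteq> Poly_Mapping.keys T"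
    by (auto simp: in_keys_iff lookup_scale)
  then show ?thesis
    by (subst pm_eval_superset[of "Poly_Mapping.keys T"])
      (auto simp: lookup_scale pm_eval_def sum_distrib_left mult.assoc)
qed

lemma pm_eval_tensor: "pm_eval (\<lambda>(x, y). a x * b y) (tensor f g) = pm_eval a f * pm_eval b g"
  unfolding tensor_def pm_eval_sum pm_eval_single
  by (simp add: pm_eval_def sum_product mult_ac)

lemma pm_eval_Delta: "pm_eval h (Delta f) = pm_eval (\<lambda>x. h (x, x)) f"
  unfolding Delta_def pm_eval_sum pm_eval_single by (simp add: pm_eval_def)

lemma lookup_eq_pm_eval: "Poly_Mapping.lookup T k = pm_eval (\<lambda>x. if x = k then 1 else 0) T"
proof -
  have "pm_eval (\<lambda>x. if x = k then 1 else 0) T =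
      (\<Sum>x\<in>Poly_Mapping.keys T. if x = k then Poly_Mapping.lookup T x else 0)"
    unfolding pm_eval_def by (rule sum.cong) auto
  also have "\<dots> = Poly_Mapping.lookup T k" by (simp add: in_keys_iff)
  finally show ?thesis by simp
qed

section \<open>Comparison of divided differences with the twisted group algebra\<close>

context affine_sym
begin

definition wt :: "int \<Rightarrow> mpol fract" where "wt x = Fract (e_wt n x) 1"

lemma wt_eq_iff: "wt x = wt y \<longleftrightarrow> x \<approx> y"
proof -
  have "wt x = wt y \<longleftrightarrow> e_wt n x = e_wt n y" unfolding wt_def by (subst eq_fract(1)) simp_all
  then show ?thesis using e_wt_inj[OF n0, of x y] e_wt_cong[of x y n] by blast
qed

sublocale kk: affine_weights n wt
  by unfold_locales (rule wt_eq_iff)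

lemma act_pol_simps:
  "act_pol n w (p + q) = act_pol n w p + act_pol n w q"
  "act_pol n w (p * q) = act_pol n w p * act_pol n w q"
  "act_pol n w (- p) = - act_pol n w p"
  "act_pol n w (p - q) = act_pol n w p - act_pol n w q"
  "act_pol n w 0 = 0" "act_pol n w 1 = 1"
  by (simp_all add: act_pol_def subst_pol_add subst_pol_mult subst_pol_uminus subst_pol_diff
      subst_pol_0 subst_pol_1)

lemma act_pol_Sym: "act_pol n w p \<in> Sym n"
  unfolding act_pol_def by (intro Sym_subst_pol Sym_e_wt n0)

lemma act_pol_nonzero: assumes "w \<in> W" "b \<in> Sym n" "b \<noteq> 0" shows "act_pol n w b \<noteq> 0"
  using act_pol_inverse[OF n2 assms(1)] assms(2,3) act_pol_simps(5) by metis

lemma act_frac_Fract':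
  "w \<in> W \<Longrightarrow> a \<in> Sym n \<Longrightarrow> b \<in> Sym n \<Longrightarrow> b \<noteq> 0 \<Longrightarrow>
    act_frac n w (Fract a b) = Fract (act_pol n w a) (act_pol n w b)"
  by (rule act_frac_Fract[OF n2])

lemma act_frac_Frac: "w \<in> W \<Longrightarrow> q \<in> Frac n \<Longrightarrow> act_frac n w q \<in> Frac n"
  by (elim FracE) (simp add: act_frac_Fract' Frac_Fract act_pol_Sym act_pol_nonzero)

lemma act_frac_of_Sym: "w \<in> W \<Longrightarrow> a \<in> Sym n \<Longrightarrow> act_frac n w (Fract a 1) = Fract (act_pol n w a) 1"
  by (simp add: act_frac_Fract' act_pol_simps)

lemma act_frac_0: "w \<in> W \<Longrightarrow> act_frac n w 0 = 0" and act_frac_1: "w \<in> W \<Longrightarrow> act_frac n w 1 = 1"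
  using act_frac_of_Sym[of w 0] act_frac_of_Sym[of w 1]
  by (simp_all add: act_pol_simps Zero_fract_def One_fract_def)

lemma act_frac_add:
  assumes "w \<in> W" "p \<in> Frac n" "q \<in> Frac n"
  shows "act_frac n w (p + q) = act_frac n w p + act_frac n w q"
  using assms(2,3)
  by (elim FracE) (simp add: act_frac_Fract' assms(1) Sym_add Sym_mult act_pol_nonzero act_pol_simps)

lemma act_frac_mult:
  assumes "w \<in> W" "p \<in> Frac n" "q \<in> Frac n"
  shows "act_frac n w (p * q) = act_frac n w p * act_frac n w q"
  using assms(2,3)
  by (elim FracE) (simp add: act_frac_Fract' assms(1) Sym_mult act_pol_simps)

lemma act_frac_uminus: assumes "w \<in> W" "p \<in> Frac n" shows "act_frac n w (- p) = - act_frac n w p"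
  using assms(2) by (elim FracE) (simp add: act_frac_Fract' assms(1) Sym_uminus act_pol_simps)

lemma act_frac_inverse: assumes "w \<in> W" "p \<in> Frac n" shows "act_frac n w (inverse p) = inverse (act_frac n w p)"
  using assms(2)
proof (elim FracE)
  fix a b assume "p = Fract a b" "a \<in> Sym n" "b \<in> Sym n" "b \<noteq> 0"
  then show ?thesis using assms(1) act_frac_0[OF assms(1)]
    by (cases "a = 0") (simp_all add: act_frac_Fract' act_pol_simps fract_collapse)
qed

lemma act_frac_comp:
  assumes "v \<in> W" "w \<in> W" "q \<in> Frac n"
  shows "act_frac n (v \<circ> w) q = act_frac n v (act_frac n w q)"
  using assms(3)
  by (elim FracE) (simp add: act_frac_Fract' assms W_comp act_pol_comp[OF n0] act_pol_Sym act_pol_nonzero)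

lemma act_frac_id: assumes "q \<in> Frac n" shows "act_frac n id q = q"
  using assms by (elim FracE) (simp add: act_frac_Fract' id_in_W act_pol_id)

lemma act_frac_wt: "w \<in> W \<Longrightarrow> act_frac n w (wt i) = wt (w i)"
  by (simp add: wt_def act_frac_of_Sym Sym_e_wt n0 act_pol_e_wt)

lemma wt_Frac: "wt x \<in> Frac n"
  by (simp add: wt_def Frac_of_Sym Sym_e_wt n0)

text \<open>\<open>act_frac\<close> is given by a description that behaves as a ring homomorphism on
  \<open>Frac n\<close>, so membership of the coefficients is carried along.\<close>

definition frac_coeffs :: "twisted \<Rightarrow> bool" where
  "frac_coeffs T \<longleftrightarrow> (\<forall>x. Poly_Mapping.lookup T x \<in> Frac n)"

text \<open>The value at the product v T of the linear extension of \<open>g\<close>; moving v past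
  the coefficients of T lets it act on them.\<close>

definition pair_at :: "(int \<Rightarrow> int) \<Rightarrow> ((int \<Rightarrow> int) \<Rightarrow> mpol fract) \<Rightarrow> twisted \<Rightarrow> mpol fract" where
  "pair_at v g T = (\<Sum>x\<in>Poly_Mapping.keys T. act_frac n v (Poly_Mapping.lookup T x) * g (v \<circ> x))"

lemma pair_at_superset:
  assumes "v \<in> W" "finite S" "Poly_Mapping.keys T \<subseteq> S"
  shows "pair_at v g T = (\<Sum>x\<in>S. act_frac n v (Poly_Mapping.lookup T x) * g (v \<circ> x))"
  unfolding pair_at_def
  by (rule sum.mono_neutral_left) (use assms in \<open>auto simp: in_keys_iff act_frac_0\<close>)

lemma frac_coeffs_add: "frac_coeffs T \<Longrightarrow> frac_coeffs U \<Longrightarrow> frac_coeffs (T + U)"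
  by (simp add: frac_coeffs_def lookup_add Frac_add)

lemma frac_coeffs_single: "c \<in> Frac n \<Longrightarrow> frac_coeffs (Poly_Mapping.single k c)"
  by (simp add: frac_coeffs_def lookup_single when_def)

lemma frac_coeffs_sum: "(\<And>a. a \<in> A \<Longrightarrow> frac_coeffs (f a)) \<Longrightarrow> frac_coeffs (sum f A)"
proof (induction A rule: infinite_finite_induct)
  case (insert x F)
  then show ?case by (simp add: frac_coeffs_add)
qed (simp_all add: frac_coeffs_def)

lemma pair_at_add:
  assumes v: "v \<in> W" and "frac_coeffs T" "frac_coeffs U"
  shows "pair_at v g (T + U) = pair_at v g T + pair_at v g U"
proof -
  let ?S = "Poly_Mapping.keys T \<union> Poly_Mapping.keys U"
  have "Poly_Mapping.keys (T + U) \<subseteq> ?S" by (rule Poly_Mapping.keys_add)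
  then show ?thesis using assms
    by (subst (1 2 3) pair_at_superset[of v ?S])
      (auto simp: lookup_add act_frac_add frac_coeffs_def distrib_right sum.distrib)
qed

lemma pair_at_single: "v \<in> W \<Longrightarrow> pair_at v g (Poly_Mapping.single k c) = act_frac n v c * g (v \<circ> k)"
  by (subst pair_at_superset[of v "{k}"]) auto

lemma pair_at_sum:
  assumes "v \<in> W" "\<And>a. a \<in> A \<Longrightarrow> frac_coeffs (f a)"
  shows "pair_at v g (sum f A) = (\<Sum>a\<in>A. pair_at v g (f a))"
  using assms(2)
proof (induction A rule: infinite_finite_induct)
  case (insert x F)
  then show ?case using assms(1) by (simp add: pair_at_add frac_coeffs_sum)
qed (simp_all add: pair_at_def)

lemma s_neq_id: "s i \<noteq> id"
proof
  assume "s i = id"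
  then have "s i i = i" by (simp only: id_apply)
  then show False by simp
qed

lemma alpha_frac: "Fract (alpha_wt n i) 1 = wt i - wt (i + 1)"
  by (simp add: alpha_wt_def wt_def)

lemma tw_mult_A_gen:
  assumes "frac_coeffs a"
  shows "tw_mult n (A_gen n i) a =
    (\<Sum>w\<in>Poly_Mapping.keys a. Poly_Mapping.single w (inverse (wt i - wt (i + 1)) * Poly_Mapping.lookup a w)) +
    (\<Sum>w\<in>Poly_Mapping.keys a. Poly_Mapping.single (s i \<circ> w)
       (- inverse (wt i - wt (i + 1)) * act_frac n (s i) (Poly_Mapping.lookup a w)))"
proof -
  let ?c = "inverse (wt i - wt (i + 1))"
  have c: "?c \<noteq> 0" by (simp add: wt_eq_iff)
  have l: "Poly_Mapping.lookup (A_gen n i) x = (if x = id then ?c else if x = s i then - ?c else 0)" for x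
    using s_neq_id[of i] unfolding A_gen_def lookup_scale alpha_frac
    by (auto simp: lookup_minus lookup_single when_def)
  then have k: "Poly_Mapping.keys (A_gen n i) = {id, s i}"
    using c s_neq_id[of i] by (auto simp: in_keys_iff split: if_splits)
  have "act_frac n id (Poly_Mapping.lookup a w) = Poly_Mapping.lookup a w" for w
    using assms by (intro act_frac_id) (simp add: frac_coeffs_def)
  then show ?thesis unfolding tw_mult_def k using s_neq_id[of i] by (simp add: l)
qed

text \<open>v A_i T equals v T - v s_i T divided by v(\<alpha>_i), which is a divided difference in
  v. The claim for v therefore uses the one for v s_i, and it is stated for all v at once.\<close>

lemma A_word_pair:
  "frac_coeffs (A_word n is) \<and> (\<forall>v\<in>W. pair_at v g (A_word n is) = kk.ddw is g v)"
proof (induction "is")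
  case Nil
  show ?case
    by (auto simp: A_word_def frac_coeffs_single pair_at_single kk.ddw_simps act_frac_1)
next
  case (Cons i "is")
  let ?a = "A_word n is" and ?c = "inverse (wt i - wt (i + 1))"
  have cF: "?c \<in> Frac n" by (intro Frac_inverse Frac_diff wt_Frac)
  have a: "frac_coeffs ?a" using Cons by simp
  then have aF: "Poly_Mapping.lookup ?a w \<in> Frac n" for w by (simp add: frac_coeffs_def)
  have asF: "act_frac n (s i) (Poly_Mapping.lookup ?a w) \<in> Frac n" for w
    by (intro act_frac_Frac s_in_W aF)
  have A: "A_word n (i # is) = tw_mult n (A_gen n i) ?a" by (simp add: A_word_def)
  let ?f = "\<lambda>w. Poly_Mapping.single w (?c * Poly_Mapping.lookup ?a w)"
  let ?h = "\<lambda>w. Poly_Mapping.single (s i \<circ> w) (- ?c * act_frac n (s i) (Poly_Mapping.lookup ?a w))"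
  have fF: "frac_coeffs (?f w)" for w by (intro frac_coeffs_single Frac_mult cF aF)
  have hF: "frac_coeffs (?h w)" for w by (intro frac_coeffs_single Frac_mult Frac_uminus cF asF)
  have "pair_at v g (A_word n (i # is)) = kk.ddw (i # is) g v" if v: "v \<in> W" for v
  proof -
    have vc: "act_frac n v ?c = inverse (wt (v i) - wt (v (i + 1)))"
      using v wt_Frac[of i] wt_Frac[of "i + 1"] act_frac_add[OF v wt_Frac Frac_uminus[OF wt_Frac], of i "i + 1"]
      by (simp add: act_frac_inverse Frac_diff act_frac_uminus act_frac_wt)
    have "pair_at v g (A_word n (i # is)) =
        (\<Sum>w\<in>Poly_Mapping.keys ?a. pair_at v g (?f w)) + (\<Sum>w\<in>Poly_Mapping.keys ?a. pair_at v g (?h w))"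
      unfolding A tw_mult_A_gen[OF a]
      by (simp add: pair_at_add[OF v] pair_at_sum[OF v] frac_coeffs_sum fF hF del: mult_minus_left)
    also have "(\<Sum>w\<in>Poly_Mapping.keys ?a. pair_at v g (?f w)) = act_frac n v ?c * pair_at v g ?a"
      unfolding pair_at_single[OF v] act_frac_mult[OF v cF aF]
      by (simp add: pair_at_def sum_distrib_left mult.assoc)
    also have "(\<Sum>w\<in>Poly_Mapping.keys ?a. pair_at v g (?h w)) = - act_frac n v ?c * pair_at (v \<circ> s i) g ?a"
      unfolding pair_at_single[OF v] act_frac_mult[OF v Frac_uminus[OF cF] asF]
        act_frac_comp[OF v s_in_W aF, symmetric] act_frac_uminus[OF v cF]
      by (simp add: pair_at_def sum_distrib_left mult.assoc comp_assoc)
    also have "act_frac n v ?c * pair_at v g ?a + - act_frac n v ?c * pair_at (v \<circ> s i) g ?a =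
        kk.ddw (i # is) g v"
    proof -
      have 1: "pair_at v g ?a = kk.ddw is g v" using Cons v by blast
      have "v \<circ> s i \<in> W" using v by simp
      then have 2: "pair_at (v \<circ> s i) g ?a = kk.ddw is g (v \<circ> s i)" using Cons by blast
      show ?thesis unfolding vc 1 2 kk.ddw_simps kk.dd_def divide_inverse
        by (simp add: algebra_simps)
    qed
    finally show ?thesis .
  qed
  moreover have "frac_coeffs (A_word n (i # is))"
    unfolding A tw_mult_A_gen[OF a] by (intro frac_coeffs_add frac_coeffs_sum fF hF)
  ultimately show ?case by blast
qed

lemma A_af_frac: "frac_coeffs (A_af n u)"
  using A_word_pair[of "SOME is. reduced_word n u is"] by (simp add: A_af_def)

lemma pm_eval_A_af: "pm_eval g (A_af n u) = kk.L u g"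
proof -
  have "pm_eval g (A_af n u) = pair_at id g (A_af n u)"
    using A_af_frac by (auto simp: pm_eval_def pair_at_def act_frac_id frac_coeffs_def)
  also have "\<dots> = kk.L u g"
    using A_word_pair[of "SOME is. reduced_word n u is" g] id_in_W by (simp add: A_af_def kk.L_def)
  finally show ?thesis .
qed

text \<open>Both sides of the expansion are evaluated on the pair of classes of \<open>u\<close> and
  \<open>v\<close>. The coproduct gives their pointwise product at A_w, and on the other side
  duality leaves a single coefficient.\<close>

lemma expansion_eq_pstr:
  assumes p: "is_coproduct_expansion n w p" and uv: "u \<in> W" "v \<in> W"
  shows "Poly_Mapping.lookup p (u, v) = kk.pstr u v w"
proof -
  let ?h = "\<lambda>(x, y). kk.sch u x * kk.sch v y"
  have sub: "Poly_Mapping.keys p \<subseteq> W \<times> W" using p by (simp add: is_coproduct_expansion_def)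
  have "kk.pstr u v w = pm_eval ?h (Delta (A_af n w))"
    by (simp add: pm_eval_Delta pm_eval_A_af kk.pstr_def)
  also have "\<dots> = (\<Sum>(x, y)\<in>Poly_Mapping.keys p. Poly_Mapping.lookup p (x, y) * (kk.L x (kk.sch u) * kk.L y (kk.sch v)))"
    using p by (simp add: is_coproduct_expansion_def pm_eval_sum pm_eval_scale pm_eval_tensor[unfolded case_prod_unfold]
        pm_eval_A_af case_prod_unfold)
  also have "\<dots> = (\<Sum>k\<in>Poly_Mapping.keys p. if k = (u, v) then Poly_Mapping.lookup p k else 0)"
  proof (intro sum.cong refl)
    fix k assume "k \<in> Poly_Mapping.keys p"
    then obtain a b where "k = (a, b)" "a \<in> W" "b \<in> W" using sub by blast
    then show "(case k of (x, y) \<Rightarrow> Poly_Mapping.lookup p (x, y) * (kk.L x (kk.sch u) * kk.L y (kk.sch v))) =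
        (if k = (u, v) then Poly_Mapping.lookup p k else 0)"
      using uv by (auto simp: kk.L_sch)
  qed
  also have "\<dots> = Poly_Mapping.lookup p (u, v)" by (simp add: in_keys_iff)
  finally show ?thesis by simp
qed

lemma L_Frac:
  assumes "\<And>x. x \<in> W \<Longrightarrow> g x \<in> Frac n"
  shows "kk.L u g \<in> Frac n"
proof -
  have "\<forall>x\<in>W. kk.ddw is g x \<in> Frac n" for "is"
    using assms by (induction "is")
      (auto simp: kk.ddw_simps kk.dd_def intro!: Frac_divide Frac_diff wt_Frac)
  then show ?thesis using id_in_W by (simp add: kk.L_def)
qed

lemma sch_Frac: "v \<in> W \<Longrightarrow> u \<in> W \<Longrightarrow> kk.sch u v \<in> Frac n"
proof (induction arbitrary: u rule: W_induct)
  case id then show ?case unfolding kk.sch_at_id by simp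
next
  case (s w p)
  have IH: "kk.sch x w \<in> Frac n" if "x \<in> W" for x using s.IH that .
  have "kk.sch u (w \<circ> s p) \<in> Frac n"
    unfolding kk.sch_comp_s[OF s.hyps s.prems]
    using s.prems by (auto intro!: Frac_diff Frac_mult wt_Frac IH)
  then show ?case .
qed

lemma pstr_Frac: "u \<in> W \<Longrightarrow> v \<in> W \<Longrightarrow> kk.pstr u v w \<in> Frac n"
  unfolding kk.pstr_def by (intro L_Frac Frac_mult sch_Frac)

text \<open>Equality of tensors is tested on pairs of delta functions. Each delta function is
  replaced by its Taylor sum over a ball, and locality of \<open>kk.L w\<close> makes agreement on
  that ball sufficient.\<close>

lemma ex_expansion:
  assumes w: "w \<in> W"
  shows "\<exists>p. is_coproduct_expansion n w p"
proof -
  let ?B = "ball (len w)"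
  define p :: twisted2 where
    "p = (\<Sum>k\<in>?B \<times> ?B. Poly_Mapping.single k (kk.pstr (fst k) (snd k) w))"
  have lookup: "Poly_Mapping.lookup p k = (if k \<in> ?B \<times> ?B then kk.pstr (fst k) (snd k) w else 0)" for k
    by (simp add: p_def lookup_sum lookup_single when_def)
  have keys: "Poly_Mapping.keys p \<subseteq> ?B \<times> ?B" using lookup by (auto simp: in_keys_iff split: if_splits)
  have BW: "?B \<subseteq> W" by (auto simp: ball_def)
  have "Delta (A_af n w) = (\<Sum>(u, v)\<in>Poly_Mapping.keys p.
       scale (Poly_Mapping.lookup p (u, v)) (tensor (A_af n u) (A_af n v)))" (is "_ = ?R")
  proof (rule poly_mapping_eqI)
    fix k :: "(int \<Rightarrow> int) \<times> (int \<Rightarrow> int)"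
    obtain x y where k: "k = (x, y)" by fastforce
    define dx dy where "dx z = (if z = x then 1 else 0 :: mpol fract)"
      and "dy z = (if z = y then 1 else 0 :: mpol fract)" for z
    have ev: "Poly_Mapping.lookup T k = pm_eval (\<lambda>(a, b). dx a * dy b) T" for T :: twisted2
      unfolding lookup_eq_pm_eval[of T k]
      by (rule arg_cong[of _ _ "\<lambda>h. pm_eval h T"]) (auto simp: k dx_def dy_def fun_eq_iff)
    have "Poly_Mapping.lookup ?R k = (\<Sum>k\<in>Poly_Mapping.keys p.
        Poly_Mapping.lookup p k * (kk.L (fst k) dx * kk.L (snd k) dy))"
      unfolding ev by (simp add: pm_eval_sum pm_eval_scale pm_eval_tensor[unfolded case_prod_unfold]
          pm_eval_A_af case_prod_unfold)
    also have "\<dots> = (\<Sum>k\<in>?B \<times> ?B. Poly_Mapping.lookup p k * (kk.L (fst k) dx * kk.L (snd k) dy))"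
      by (rule sum.mono_neutral_left) (use keys in \<open>auto simp: in_keys_iff\<close>)
    also have "\<dots> = (\<Sum>k\<in>?B \<times> ?B. (kk.L (fst k) dx * kk.L (snd k) dy) *
        kk.L w (\<lambda>v. kk.sch (fst k) v * kk.sch (snd k) v))"
      by (intro sum.cong) (auto simp: lookup kk.pstr_def)
    also have "\<dots> = kk.L w (\<lambda>z. \<Sum>k\<in>?B \<times> ?B. (kk.L (fst k) dx * kk.L (snd k) dy) *
        (kk.sch (fst k) z * kk.sch (snd k) z))"
      by (rule kk.L_sum[symmetric])
    also have "\<dots> = kk.L w (\<lambda>z. dx z * dy z)"
    proof (rule kk.L_local[OF w])
      fix z assume "z \<in> ?B"
      then have z: "z \<in> W" "len z \<le> len w" by (auto simp: ball_def)
      have "dx z * dy z = (\<Sum>u\<in>?B. kk.sch u z * kk.L u dx) * (\<Sum>v\<in>?B. kk.sch v z * kk.L v dy)"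
        using kk.taylor_expansion[OF z] by metis
      also have "\<dots> = (\<Sum>k\<in>?B \<times> ?B. (kk.sch (fst k) z * kk.L (fst k) dx) * (kk.sch (snd k) z * kk.L (snd k) dy))"
        by (simp add: sum_product sum.cartesian_product case_prod_unfold)
      finally show "(\<Sum>k\<in>?B \<times> ?B. (kk.L (fst k) dx * kk.L (snd k) dy) *
        (kk.sch (fst k) z * kk.sch (snd k) z)) = dx z * dy z"
        by (simp add: mult_ac)
    qed
    also have "\<dots> = Poly_Mapping.lookup (Delta (A_af n w)) k"
      unfolding ev by (simp add: pm_eval_Delta pm_eval_A_af)
    finally show "Poly_Mapping.lookup (Delta (A_af n w)) k = Poly_Mapping.lookup ?R k" by simp
  qed
  moreover have "Poly_Mapping.lookup p k \<in> Frac n" for k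
    using BW by (auto simp: lookup intro!: pstr_Frac)
  ultimately have "is_coproduct_expansion n w p"
    using keys BW unfolding is_coproduct_expansion_def by blast
  then show ?thesis by blast
qed

lemma p_const_eq:
  assumes "w \<in> W" "u \<in> W" "v \<in> W"
  shows "p_const n u v w = kk.pstr u v w"
proof -
  obtain p where p: "is_coproduct_expansion n w p" using ex_expansion[OF assms(1)] by blast
  have "q = p" if q: "is_coproduct_expansion n w q" for q
  proof (rule poly_mapping_eqI)
    fix k :: "(int \<Rightarrow> int) \<times> (int \<Rightarrow> int)"
    show "Poly_Mapping.lookup q k = Poly_Mapping.lookup p k"
    proof (cases "k \<in> W \<times> W")
      case True
      then show ?thesis using expansion_eq_pstr[OF p] expansion_eq_pstr[OF q] by auto
    next
      case False
      then have "k \<notin> Poly_Mapping.keys p" "k \<notin> Poly_Mapping.keys q"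
        using p q by (auto simp: is_coproduct_expansion_def)
      then show ?thesis by (simp add: in_keys_iff)
    qed
  qed
  then have "(THE p. is_coproduct_expansion n w p) = p" using p by blast
  then show ?thesis using expansion_eq_pstr[OF p] assms by (simp add: p_const_def)
qed

end

section \<open>Counting strong strips\<close>

context affine_sym
begin

definition steps :: "int \<Rightarrow> (int \<Rightarrow> int) \<Rightarrow> (int \<times> int) set" where
  "steps k z = {(i, j). i \<le> k \<and> k < j \<and> cov z i j}"

text \<open>Strips are read from the top; \<open>Q\<close> constrains the marking of the first step.\<close>

primrec cnt :: "nat \<Rightarrow> int \<Rightarrow> (int \<Rightarrow> bool) \<Rightarrow> (int \<Rightarrow> int) \<Rightarrow> (int \<Rightarrow> int) \<Rightarrow> nat" where
  "cnt 0 k Q z w = (if z = w then 1 else 0)"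
| "cnt (Suc m) k Q z w = (\<Sum>x\<in>{x \<in> steps k z. Q (z (snd x))}.
     cnt m k (\<lambda>a. a < z (snd x)) (z \<circ> t (fst x) (snd x)) w)"

lemma stepsD:
  assumes "z \<in> W" "x \<in> steps k z"
  shows "fst x \<le> k" "k < snd x" "cov z (fst x) (snd x)" "\<not> fst x \<approx> snd x"
    "z (snd x) < z (fst x)" "z \<circ> t (fst x) (snd x) \<in> W"
  using assms cov_inv_less[OF assms(1), of "fst x" "snd x"]
  by (auto simp: steps_def cov_cong cov_W)

lemma finite_steps: assumes "z \<in> W" shows "finite (steps k z)"
proof -
  obtain B where B: "\<And>x. \<bar>z x - x\<bar> \<le> B" using W_displacement_bound[OF assms] by blast
  have "steps k z \<subseteq> {k - 2 * B..k} \<times> {k..k + 2 * B}"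
  proof
    fix x assume "x \<in> steps k z"
    then show "x \<in> {k - 2 * B..k} \<times> {k..k + 2 * B}"
      using stepsD[OF assms, of x k] B[of "fst x"] B[of "snd x"] by (auto simp: mem_Times_iff)
  qed
  then show ?thesis using finite_subset by blast
qed

lemma cnt_cong:
  assumes "\<And>x. x \<in> steps k z \<Longrightarrow> Q (z (snd x)) \<longleftrightarrow> Q' (z (snd x))"
  shows "cnt m k Q z w = cnt m k Q' z w"
proof (cases m)
  case (Suc m')
  have "{x \<in> steps k z. Q (z (snd x))} = {x \<in> steps k z. Q' (z (snd x))}" using assms by blast
  then show ?thesis by (simp only: Suc cnt.simps)
qed simp

lemma cnt_nonzero:
  assumes "z \<in> W" "cnt m k Q z w \<noteq> 0"
  shows "w \<in> W \<and> len z = len w + m"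
  using assms
proof (induction m arbitrary: z Q)
  case 0 then show ?case by (auto split: if_splits)
next
  case (Suc m)
  then obtain x where x: "x \<in> steps k z"
    "cnt m k (\<lambda>a. a < z (snd x)) (z \<circ> t (fst x) (snd x)) w \<noteq> 0"
    by (auto elim!: sum.not_neutral_contains_not_neutral simp del: not_gr_zero neq0_conv)
  have "w \<in> W \<and> len (z \<circ> t (fst x) (snd x)) = len w + m"
    by (rule Suc.IH[OF stepsD(6)[OF Suc.prems(1) x(1)] x(2)])
  then show ?case using stepsD[OF Suc.prems(1) x(1)] by (simp add: cov_def)
qed

section \<open>Strips and descents away from the cut\<close>

lemma s_le_iff: assumes "\<not> p \<approx> k" shows "s p x \<le> k \<longleftrightarrow> x \<le> k"
proof -
  have "x \<approx> p \<Longrightarrow> x \<noteq> k" "x \<approx> p + 1 \<Longrightarrow> x \<noteq> k + 1"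
    using assms cg_add_iff[of k 1 p] by (auto simp: cong_sym_eq)
  moreover have "s p x = (if x \<approx> p then x + 1 else if x \<approx> p + 1 then x - 1 else x)"
    by (simp add: s_eq refl_af_def)
  ultimately show ?thesis by auto
qed

text \<open>The two positions of a step lie on different sides of the cut and \<open>s p\<close>
  does not cross it, so the pair is not special. Comparing the covers of \<open>z\<close> and of
  \<open>z \<circ> s p\<close> then yields the conjugated step and the surviving descent
  together.\<close>

lemma step_desc:
  assumes z: "z \<in> W" "desc z p" and pk: "\<not> p \<approx> k" and x: "x \<in> steps k z"
  shows "desc (z \<circ> t (fst x) (snd x)) p"
    "cov (z \<circ> s p) (s p (fst x)) (s p (snd x))"
    "z \<circ> s p \<circ> t (s p (fst x)) (s p (snd x)) = z \<circ> t (fst x) (snd x) \<circ> s p"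
proof -
  let ?i = "fst x" and ?j = "snd x"
  note d = stepsD[OF z(1) x]
  have ns: "\<not> special p ?i ?j"
  proof
    assume "special p ?i ?j"
    then have "?i = k" "?i \<approx> p" using d by (auto simp: special_def)
    then show False using pk by (simp add: cong_sym_eq)
  qed
  show eq: "z \<circ> s p \<circ> t (s p ?i) (s p ?j) = z \<circ> t ?i ?j \<circ> s p"
    using comp_s_t[of "s p ?i" "s p ?j" z p] d(4) by (simp add: s_cg)
  have zs: "z \<circ> s p \<in> W" "\<not> desc (z \<circ> s p) p" using z by simp_all
  have "cov (z \<circ> s p \<circ> s p) ?i ?j" using d by simp
  from this[unfolded cov_comp_s_iff[OF zs ns] eq]
  show "cov (z \<circ> s p) (s p ?i) (s p ?j)" "desc (z \<circ> t ?i ?j) p"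
    using d(6) by (simp_all add: desc_comp_s)
qed

lemma cnt_desc_chain:
  assumes "z \<in> W" "desc z p" "\<not> p \<approx> k" "cnt m k Q z w \<noteq> 0"
  shows "desc w p"
  using assms(1,2,4)
proof (induction m arbitrary: z Q)
  case 0 then show ?case by (auto split: if_splits)
next
  case (Suc m)
  then obtain x where x: "x \<in> steps k z"
    "cnt m k (\<lambda>a. a < z (snd x)) (z \<circ> t (fst x) (snd x)) w \<noteq> 0"
    by (auto elim!: sum.not_neutral_contains_not_neutral simp del: not_gr_zero neq0_conv)
  show ?case
    using Suc.IH[OF stepsD(6)[OF Suc.prems(1) x(1)] step_desc(1)[OF Suc.prems(1,2) assms(3) x(1)] x(2)] .
qed

lemma cnt_desc:
  assumes "z \<in> W" "w \<in> W" "desc z p" "\<not> p \<approx> k"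
  shows "cnt m k Q z w = (if desc w p then cnt m k Q (z \<circ> s p) (w \<circ> s p) else 0)"
  using assms(1,3)
proof (induction m arbitrary: z Q)
  case 0
  have "z \<circ> s p = w \<circ> s p \<longleftrightarrow> z = w" by (metis comp_s_s)
  then have "cnt 0 k Q z w = (if desc w p then cnt 0 k Q (z \<circ> s p) (w \<circ> s p) else 0)"
    using 0 by auto
  then show ?case .
next
  case (Suc m)
  note z = Suc.prems(1) and dz = Suc.prems(2) and pk = assms(4)
  let ?y = "\<lambda>x. z \<circ> t (fst x) (snd x)" and ?Q = "\<lambda>x a. a < z (snd x)"
  let ?A = "{x \<in> steps k z. Q (z (snd x))}"
  have IH: "cnt m k (?Q x) (?y x) w = (if desc w p then cnt m k (?Q x) (?y x \<circ> s p) (w \<circ> s p) else 0)"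
    if "x \<in> ?A" for x
    by (rule Suc.IH[OF stepsD(6)[OF z] step_desc(1)[OF z dz pk]]) (use that in auto)
  show ?case
  proof (cases "desc w p")
    case False
    then show ?thesis using IH by simp
  next
    case True
    let ?z = "z \<circ> s p"
    let ?y' = "\<lambda>x. ?z \<circ> t (fst x) (snd x)" and ?Q' = "\<lambda>x a. a < ?z (snd x)"
    let ?A' = "{x \<in> steps k ?z. Q (?z (snd x))}"
    have z': "?z \<in> W" "\<not> desc ?z p" using z dz by simp_all
    have "cnt (Suc m) k Q z w = (\<Sum>x\<in>?A. cnt m k (?Q x) (?y x \<circ> s p) (w \<circ> s p))"
      using IH True by simp
    also have "\<dots> = (\<Sum>x\<in>{x \<in> ?A'. \<not> desc (?y' x) p}. cnt m k (?Q' x) (?y' x) (w \<circ> s p))"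
    proof (rule sum.reindex_bij_witness[where i = "map_prod (s p) (s p)" and j = "map_prod (s p) (s p)"])
      \<comment> \<open>Positions and elements are both changed by \<open>s p\<close>, so the value
        at the moved position, which is the marking, stays the same.\<close>
      fix x assume x: "x \<in> ?A"
      then have xs: "x \<in> steps k z" by simp
      let ?x = "map_prod (s p) (s p) x"
      show "map_prod (s p) (s p) ?x = x" by (cases x) simp
      note sd = step_desc[OF z dz pk xs]
      have "\<not> desc (?y x \<circ> s p) p" using sd(1) stepsD(6)[OF z xs] by simp
      then show "?x \<in> {x \<in> ?A'. \<not> desc (?y' x) p}"
        using x sd stepsD(1,2)[OF z xs] s_le_iff[OF pk]
        by (cases x) (auto simp: steps_def not_le[symmetric])
      show "cnt m k (?Q' ?x) (?y' ?x) (w \<circ> s p) = cnt m k (?Q x) (?y x \<circ> s p) (w \<circ> s p)"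
        using sd(3) by (cases x) simp
    next
      fix x assume x: "x \<in> {x \<in> ?A'. \<not> desc (?y' x) p}"
      then have xs: "x \<in> steps k ?z" by simp
      let ?x = "map_prod (s p) (s p) x"
      show "map_prod (s p) (s p) ?x = x" by (cases x) simp
      have lek: "s p (fst x) \<le> k" "k < s p (snd x)"
        using stepsD(1,2)[OF z'(1) xs] s_le_iff[OF pk] by (auto simp: not_le[symmetric])
      have ns: "\<not> special p (s p (fst x)) (s p (snd x))"
      proof
        assume "special p (s p (fst x)) (s p (snd x))"
        then have "s p (fst x) = k" "s p (fst x) \<approx> p" using lek by (auto simp: special_def)
        then show False using pk by (simp add: cong_sym_eq)
      qed
      have "cov (?z \<circ> s p) (s p (fst x)) (s p (snd x))"
        using cov_comp_s_iff[OF z' ns] stepsD(3)[OF z'(1) xs] x by simp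
      then show "?x \<in> ?A" using x lek by (cases x) (auto simp: steps_def)
    qed
    \<comment> \<open>Steps to an element with descent p may be added freely: the descent would
      persist down to \<open>w \<circ> s p\<close>, which has none, so they contribute 0.\<close>
    also have "\<dots> = (\<Sum>x\<in>?A'. cnt m k (?Q' x) (?y' x) (w \<circ> s p))"
    proof (rule sum.mono_neutral_left)
      show "finite ?A'" using finite_steps[OF z'(1)] by simp
      show "\<forall>x\<in>?A' - {x \<in> ?A'. \<not> desc (?y' x) p}. cnt m k (?Q' x) (?y' x) (w \<circ> s p) = 0"
      proof
        fix x assume "x \<in> ?A' - {x \<in> ?A'. \<not> desc (?y' x) p}"
        then have x: "x \<in> steps k ?z" "desc (?y' x) p" by auto
        have dw: "\<not> desc (w \<circ> s p) p" "w \<circ> s p \<in> W" using True assms(2) by simp_all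
        then show "cnt m k (?Q' x) (?y' x) (w \<circ> s p) = 0"
          using cnt_desc_chain[OF stepsD(6)[OF z'(1) x(1)] x(2) pk] by blast
      qed
    qed auto
    also have "\<dots> = cnt (Suc m) k Q ?z (w \<circ> s p)" by simp
    finally show ?thesis using True by simp
  qed
qed

text \<open>The exchange of a step with a step at the cut \<open>k\<close>: \<open>t k j'\<close> followed by \<open>t i j\<close> is replaced by
  the conjugate of \<open>t i j\<close> followed by \<open>t k j'\<close>.\<close>

lemma exchange_forward:
  assumes z: "z \<in> W" and zk: "c < z k"
    and j': "k < j'" "cov z k j'" "z j' < c"
    and ij: "i \<le> k" "k < j" "cov (z \<circ> t k j') i j" "(z \<circ> t k j') j = c"
  defines "i' \<equiv> t k j' i" and "j1 \<equiv> t k j' j"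
  defines "v \<equiv> z \<circ> t i' j1"
  shows "i' < k" "k < j1" "cov z i' j1" "z j1 = c" "cov v k j'" "v j' < c"
    "v \<circ> t k j' = z \<circ> t k j' \<circ> t i j"
proof -
  define y where "y = z \<circ> t k j'"
  define x where "x = y \<circ> t i j"
  have kj': "\<not> k \<approx> j'" "\<not> j' \<approx> k" using cov_cong[OF j'(2)] by (simp_all add: cong_sym_eq)
  have nij: "\<not> i \<approx> j" "\<not> j \<approx> i" using cov_cong[OF ij(3)] by (simp_all add: cong_sym_eq)
  have y: "y \<in> W" unfolding y_def by (rule cov_W[OF z j'(2)])
  have x: "x \<in> W" unfolding x_def using cov_W[OF y] ij(3) by (simp add: y_def)
  have yk: "y k = z j'" "y j' = z k" using kj' by (simp_all add: y_def t_ends)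
  have yj: "y j = c" using ij(4) by (simp add: y_def)
  have yi: "c < y i" using cov_inv_less[OF y, of i j] ij yj by (simp add: y_def)
  have xij: "x i = c" "x j = y i" using nij yj by (simp_all add: x_def t_ends)
  have lens: "len y + 1 = len z" "len x + 1 = len y"
    using j'(2) ij(3) by (simp_all add: cov_def y_def x_def)
  \<comment> \<open>Otherwise \<open>i\<close> is a translate of \<open>k\<close> to the left or
    \<open>k\<close> itself, and then y(i) is at most y(k) = z(j'), which is below
    \<open>c\<close>.\<close>
  have ki: "\<not> k \<approx> i" "\<not> i \<approx> k"
  proof -
    show "\<not> k \<approx> i"
    proof
      assume "k \<approx> i"
      then obtain a where a: "k = i + a * int n" by (auto simp: cg_iff)
      then have "a * int n \<ge> 0" using ij(1) by simp
      moreover have "y i = y k - a * int n" using a W_per[OF y, of i a] by simp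
      ultimately show False using yk yi j'(3) by simp
    qed
    then show "\<not> i \<approx> k" by (simp add: cong_sym_eq)
  qed
  have ik: "i < k" using ij(1) ki by (cases "i = k") auto
  show i': "i' < k" unfolding i'_def using kj'(1)
  proof (rule t_cases[of k j' i])
    fix a assume a: "i = j' + a * int n" "t k j' i = k + a * int n"
    then have "a * int n < 0" using ij(1) j'(1) by linarith
    then show "t k j' i < k" using a by simp
  qed (use ki ik in auto)
  \<comment> \<open>Otherwise \<open>j\<close> is a translate of \<open>j'\<close> that lies between
    \<open>k\<close> and \<open>j'\<close>, with value \<open>c\<close> still above y(k);
    \<open>not_cover_translate\<close> then denies that \<open>z\<close> covers
    \<open>y\<close>.\<close>
  have jj': "\<not> j \<approx> j'" "\<not> j' \<approx> j"
  proof -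
    show "\<not> j \<approx> j'"
    proof
      assume "j \<approx> j'"
      then have "j' \<approx> j" by (simp add: cong_sym_eq)
      then obtain a where a: "j' = j + a * int n" by (auto simp: cg_iff)
      then have "y j' = y j + a * int n" using W_per[OF y] by simp
      then have "a * int n > 0" using yk yj zk by simp
      then have "a \<ge> 1" using n0 by (simp add: zero_less_mult_iff)
      moreover have "j' - a * int n = j" "y j' - a * int n = c" using a W_per[OF y, of j a] yj by simp_all
      ultimately have "len (y \<circ> t k j') \<noteq> len y + 1"
        using not_cover_translate[OF y kj'(1), of a] ij(2) yk j'(3) by simp
      moreover have "y \<circ> t k j' = z" by (simp add: y_def comp_assoc t_comp_t[OF kj'(1)])
      ultimately show False using lens by simp
    qed
    then show "\<not> j' \<approx> j" by (simp add: cong_sym_eq)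
  qed
  show j1: "k < j1" unfolding j1_def using kj'(1)
  proof (rule t_cases[of k j' j])
    fix a assume a: "j = k + a * int n" "t k j' j = j' + a * int n"
    then have "a * int n > 0" using ij(2) by linarith
    then show "k < t k j' j" using a j'(1) by simp
  qed (use jj' ij(2) in auto)
  show zj1: "z j1 = c" using yj by (simp add: j1_def y_def)
  have zi': "z i' = y i" by (simp add: i'_def y_def)
  have i'j1: "\<not> i' \<approx> j1" using nij W_cg[OF t_in_W[OF kj'(1)]] by (simp add: i'_def j1_def)
  have vT: "v \<circ> t k j' = x"
    using t_conj_t[OF kj'(1) nij(1)] by (simp add: v_def x_def y_def comp_assoc i'_def j1_def)
  then show "v \<circ> t k j' = z \<circ> t k j' \<circ> t i j" by (simp add: x_def y_def)
  have v: "v \<in> W" unfolding v_def by (rule comp_t_in_W[OF i'j1 z])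
  have lv: "len v < len z" unfolding v_def using i' j1 i'j1 zj1 zi' yi by (intro len_t_less[OF z]) auto
  have vx: "v j' = x k" "v k = x j'" using kj' by (simp_all add: t_ends flip: vT)
  \<comment> \<open>The critical case is k = j - r n, where x(k) = y(i) - r n. A value above
    \<open>c\<close> would leave room for a translate of \<open>t i j\<close>, against the cover of
    \<open>x\<close> by \<open>y\<close>; the value \<open>c\<close> itself is excluded by
    congruence.\<close>
  have xk: "x k < c"
  proof -
    have "y (t i j k) < c" using nij(1)
    proof (rule t_cases[of i j k])
      fix a assume a: "k = j + a * int n" "t i j k = i + a * int n"
      define r where "r = - a"
      have r: "k = j - r * int n" "t i j k = i - r * int n" using a by (simp_all add: r_def)
      have "r * int n > 0" using r(1) ij(2) by linarith
      then have "r \<ge> 1" using n0 by (simp add: zero_less_mult_iff)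
      have eq: "y (t i j k) = y i - r * int n" using r W_per_minus[OF y] by simp
      have "\<not> c < y i - r * int n"
      proof
        assume "c < y i - r * int n"
        then have "len (x \<circ> t i j) \<noteq> len x + 1"
          using not_cover_translate[OF x nij(1) \<open>r \<ge> 1\<close>] ij(1) ki r(1) xij by fastforce
        moreover have "x \<circ> t i j = y" by (simp add: x_def comp_assoc t_comp_t[OF nij(1)])
        ultimately show False using lens by simp
      qed
      moreover have "y i - r * int n \<noteq> c"
      proof
        assume "y i - r * int n = c"
        then have "y i \<approx> y j" using yj cg_add_mult(3)[of "y i" r "y j"] by simp
        then show False using W_cg[OF y] nij by simp
      qed
      ultimately show "y (t i j k) < c" using eq by simp
    qed (use ki yk j'(3) in auto)
    then show ?thesis by (simp add: x_def)
  qed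
  then show vj': "v j' < c" using vx by simp
  have "x j' \<ge> c"
  proof -
    have "y (t i j j') \<ge> c" using nij(1)
    proof (rule t_cases[of i j j'])
      fix a assume a: "j' = i + a * int n" "t i j j' = j + a * int n"
      then have "a * int n > 0" using ij(1) j'(1) by linarith
      then show "c \<le> y (t i j j')" using W_per[OF y, of j a] yj unfolding a(2) by simp
    qed (use jj' yk zk in auto)
    then show ?thesis by (simp add: x_def)
  qed
  then have "v j' < v k" using vx xk by simp
  then have "len x < len v" unfolding vT[symmetric] using len_t_less[OF v j'(1) kj'(1)] by simp
  \<comment> \<open>The length of \<open>v\<close> lies strictly between those of \<open>x\<close>
    and \<open>z\<close>, which differ by two, so both new steps are covers.\<close>
  then have "len v + 1 = len z" "len x + 1 = len v" using lv lens by linarith+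
  then show "cov z i' j1" "cov v k j'"
    using i'j1 kj' vT by (simp_all add: cov_def v_def)
qed

text \<open>The inverse exchange. The bounds on \<open>i\<close> and \<open>j\<close> describe a
  step with cut k - 1 and marking \<open>c\<close>; the value at \<open>k\<close> being above
  \<open>c\<close> keeps \<open>j\<close> off the residue of \<open>k\<close>. As in the forward
  direction, strict length inequalities are enough to obtain covers.\<close>

lemma exchange_backward:
  assumes z: "z \<in> W" and zk: "c < z k"
    and ij: "i < k" "k \<le> j" "cov z i j" "z j = c"
    and j': "k < j'" "cov (z \<circ> t i j) k j'" "(z \<circ> t i j) j' < c"
  defines "y \<equiv> z \<circ> t k j'"
  shows "cov z k j'" "z j' < c" "t k j' i \<le> k" "k < t k j' j" "cov y (t k j' i) (t k j' j)"
    "y (t k j' j) = c" "y \<circ> t (t k j' i) (t k j' j) = z \<circ> t i j \<circ> t k j'"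
proof -
  define v where "v = z \<circ> t i j"
  define x where "x = v \<circ> t k j'"
  have nij: "\<not> i \<approx> j" "\<not> j \<approx> i" using cov_cong[OF ij(3)] by (simp_all add: cong_sym_eq)
  have kj': "\<not> k \<approx> j'" "\<not> j' \<approx> k" using cov_cong[OF j'(2)] by (simp_all add: cong_sym_eq)
  have v: "v \<in> W" unfolding v_def by (rule cov_W[OF z ij(3)])
  have x: "x \<in> W" unfolding x_def using cov_W[OF v] j'(2) by (simp add: v_def)
  have y: "y \<in> W" unfolding y_def by (rule comp_t_in_W[OF kj'(1) z])
  have zi: "c < z i" using cov_inv_less[OF z ij(3)] ij by simp
  have vij: "v i = c" "v j = z i" using nij ij(4) by (simp_all add: v_def t_ends)
  have vj': "v j' < c" using j'(3) by (simp add: v_def)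
  have xk: "x k = v j'" "x j' = v k" using kj' by (simp_all add: x_def t_ends)
  have vk: "v j' < v k" using cov_inv_less[OF v, of k j'] j' by (simp add: v_def)
  have lens: "len v + 1 = len z" "len x + 1 = len v"
    using ij(3) j'(2) by (simp_all add: cov_def v_def x_def)
  have jk: "\<not> j \<approx> k" "\<not> k \<approx> j"
  proof -
    show "\<not> j \<approx> k"
    proof
      assume "j \<approx> k"
      then obtain a where a: "j = k + a * int n" by (auto simp: cg_iff)
      then have "a * int n \<ge> 0" using ij(2) by simp
      moreover have "z j = z k + a * int n" using a W_per[OF z] by simp
      ultimately show False using ij(4) zk by simp
    qed
    then show "\<not> k \<approx> j" by (simp add: cong_sym_eq)
  qed
  have kj: "k < j" using ij(2) jk by (cases "k = j") auto
  have vz: "v \<circ> t i j = z" by (simp add: v_def comp_assoc t_comp_t[OF nij(1)])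
  have j'i: "\<not> j' \<approx> i"
  proof
    assume "j' \<approx> i"
    then obtain a where a: "j' = i + a * int n" by (auto simp: cg_iff)
    then have "a * int n > 0" using ij(1) j'(1) by linarith
    then show False using a W_per[OF v, of i a] vij vj' by simp
  qed
  have j'j: "a < 0" if "j' = j + a * int n" for a
  proof -
    have "v j' = z i + a * int n" using that W_per[OF v, of j a] vij by simp
    then have "a * int n < 0" using vj' zi by linarith
    then show ?thesis by (simp add: mult_less_0_iff)
  qed
  show zj': "z j' < c"
  proof -
    have "v (t i j j') < c" using nij(1)
    proof (rule t_cases[of i j j'])
      fix a assume a: "j' = j + a * int n" "t i j j' = i + a * int n"
      then have "a * int n < 0" using j'j n0 by (simp add: mult_less_0_iff)
      then show "v (t i j j') < c" using a W_per[OF v, of i a] vij by simp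
    qed (use j'i vj' in auto)
    then show ?thesis by (simp flip: vz)
  qed
  have ly: "len y < len z" unfolding y_def using j'(1) kj' zj' zk by (intro len_t_less[OF z]) auto
  \<comment> \<open>Only i = k - r n is critical: if j' - r n were to the right of \<open>k\<close>,
    it would be a translate of \<open>j'\<close> that prevents \<open>v\<close> from covering
    \<open>x\<close>.\<close>
  show i0: "t k j' i \<le> k" using kj'(1)
  proof (rule t_cases[of k j' i])
    fix a assume a: "i = k + a * int n" "t k j' i = j' + a * int n"
    define r where "r = - a"
    have r: "i = k - r * int n" "t k j' i = j' - r * int n" using a by (simp_all add: r_def)
    have "r * int n > 0" using r(1) ij(1) by linarith
    then have "r \<ge> 1" using n0 by (simp add: zero_less_mult_iff)
    show "t k j' i \<le> k"
    proof (rule ccontr)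
      assume "\<not> ?thesis"
      then have "k < j' - r * int n" using r by simp
      moreover have "x j' - r * int n = c"
        using xk vij(1) r(1) W_per_minus[OF v, of k r] by simp
      ultimately have "len (x \<circ> t k j') \<noteq> len x + 1"
        using not_cover_translate[OF x kj'(1) \<open>r \<ge> 1\<close>] xk vj' by simp
      moreover have "x \<circ> t k j' = v" by (simp add: x_def comp_assoc t_comp_t[OF kj'(1)])
      ultimately show False using lens by simp
    qed
  qed (use j'i ij(1) in \<open>auto simp: cong_sym_eq\<close>)
  show j0: "k < t k j' j" using kj'(1)
  proof (rule t_cases[of k j' j])
    fix a assume a: "j = j' + a * int n" "t k j' j = k + a * int n"
    then have "j' = j + (- a) * int n" by simp
    from j'j[OF this] have "a * int n > 0" using n0 by simp
    then show "k < t k j' j" using a by simp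
  qed (use jk kj in auto)
  show yj0: "y (t k j' j) = c" using ij(4) by (simp add: y_def t_invol[OF kj'(1)])
  have yi0: "y (t k j' i) = z i" by (simp add: y_def t_invol[OF kj'(1)])
  have nij0: "\<not> t k j' i \<approx> t k j' j" using nij W_cg[OF t_in_W[OF kj'(1)]] by simp
  have yx: "y \<circ> t (t k j' i) (t k j' j) = x"
    using t_conj_t[OF kj'(1) nij0] t_invol[OF kj'(1)]
    by (simp add: y_def x_def v_def comp_assoc)
  then show "y \<circ> t (t k j' i) (t k j' j) = z \<circ> t i j \<circ> t k j'" by (simp add: x_def v_def)
  have "len x < len y" unfolding yx[symmetric]
    using i0 j0 yi0 yj0 zi nij0 by (intro len_t_less[OF y]) auto
  then have "len y + 1 = len z" "len x + 1 = len y" using ly lens by linarith+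
  then show "cov z k j'" "cov y (t k j' i) (t k j' j)"
    using kj' nij0 yx by (simp_all add: cov_def y_def)
qed

end

section \<open>Changing the cut\<close>

context affine_sym
begin

text \<open>On the left a step at \<open>k\<close> comes before a step with larger marking, still
  below \<open>c\<close>; on the right the pair is in decreasing order and its first step has cut k
  - 1. The weight \<open>G\<close> sees only the larger marking and the end of the pair, and the
  exchange preserves both.\<close>

lemma exchange_sum:
  assumes z: "z \<in> W" and zk: "c \<le> z k"
  shows "(\<Sum>j\<in>{j. k < j \<and> cov z k j \<and> z j < c}.
      \<Sum>x\<in>{x \<in> steps k (z \<circ> t k j). (z \<circ> t k j) (snd x) < c \<and> z j < (z \<circ> t k j) (snd x)}.
        G ((z \<circ> t k j) (snd x)) (z \<circ> t k j \<circ> t (fst x) (snd x))) =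
    (\<Sum>x\<in>{x \<in> steps (k - 1) z. z (snd x) < c}.
      \<Sum>j\<in>{j. k < j \<and> cov (z \<circ> t (fst x) (snd x)) k j \<and> (z \<circ> t (fst x) (snd x)) j < z (snd x)}.
        (G (z (snd x)) (z \<circ> t (fst x) (snd x) \<circ> t k j) :: nat))"
    (is "(\<Sum>j\<in>?J. \<Sum>x\<in>?A j. ?g j x) = (\<Sum>x\<in>?B. \<Sum>j\<in>?C x. ?h x j)")
proof -
  have finJ: "finite ?J" using finite_cov[OF z, of k] by simp
  have finA: "\<forall>j\<in>?J. finite (?A j)" using finite_steps cov_W[OF z] by auto
  have finB: "finite ?B" using finite_steps[OF z] by simp
  have finC: "\<forall>x\<in>?B. finite (?C x)"
  proof
    fix x assume "x \<in> ?B"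
    then have "z \<circ> t (fst x) (snd x) \<in> W" using stepsD(6)[OF z] by blast
    from finite_cov[OF this, of k] show "finite (?C x)" by simp
  qed
  have "(\<Sum>j\<in>?J. \<Sum>x\<in>?A j. ?g j x) = (\<Sum>(j, x)\<in>Sigma ?J ?A. ?g j x)"
    using sum.Sigma[OF finJ finA] .
  also have "\<dots> = (\<Sum>(x, j)\<in>Sigma ?B ?C. ?h x j)"
  proof (rule sum.reindex_bij_witness[
      where i = "\<lambda>(x, j). (j, t k j (fst x), t k j (snd x))"
        and j = "\<lambda>(j, x). ((t k j (fst x), t k j (snd x)), j)"])
    fix p assume "p \<in> Sigma ?J ?A"
    then obtain j' i j where p: "p = (j', i, j)" and J: "j' \<in> ?J" and A: "(i, j) \<in> ?A j'" by auto
    have kj': "\<not> k \<approx> j'" using J cov_cong by auto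
    have y: "z \<circ> t k j' \<in> W" by (rule comp_t_in_W[OF kj' z])
    note E = exchange_forward[OF z, of "(z \<circ> t k j') j" k j' i j]
    have pre: "(z \<circ> t k j') j < z k" "k < j'" "cov z k j'" "z j' < (z \<circ> t k j') j"
      "i \<le> k" "k < j" "cov (z \<circ> t k j') i j" "(z \<circ> t k j') j = (z \<circ> t k j') j"
      using J A zk by (auto simp: steps_def)
    note E = E[OF pre]
    show "(case case p of (j, x) \<Rightarrow> ((t k j (fst x), t k j (snd x)), j) of
        (x, j) \<Rightarrow> (j, t k j (fst x), t k j (snd x))) = p"
      by (simp add: p t_invol[OF kj'])
    show "(case p of (j, x) \<Rightarrow> ((t k j (fst x), t k j (snd x)), j)) \<in> Sigma ?B ?C"
      using E pre A by (auto simp: p steps_def)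
    show "(case case p of (j, x) \<Rightarrow> ((t k j (fst x), t k j (snd x)), j) of (x, j) \<Rightarrow> ?h x j) =
        (case p of (j, x) \<Rightarrow> ?g j x)"
      using E(4,7) by (simp add: p)
  next
    fix p assume "p \<in> Sigma ?B ?C"
    then obtain j' i j where p: "p = ((i, j), j')" and B: "(i, j) \<in> ?B" and C: "j' \<in> ?C (i, j)" by auto
    have kj': "\<not> k \<approx> j'" using C cov_cong by auto
    have pre: "z j < z k" "i < k" "k \<le> j" "cov z i j" "z j = z j" "k < j'"
      "cov (z \<circ> t i j) k j'" "(z \<circ> t i j) j' < z j"
      using B C zk by (auto simp: steps_def)
    note E = exchange_backward[OF z pre]
    show "(case case p of (x, j) \<Rightarrow> (j, t k j (fst x), t k j (snd x)) of
        (j, x) \<Rightarrow> ((t k j (fst x), t k j (snd x)), j)) = p"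
      by (simp add: p t_invol[OF kj'])
    show "(case p of (x, j) \<Rightarrow> (j, t k j (fst x), t k j (snd x))) \<in> Sigma ?J ?A"
      using E pre B by (auto simp: p steps_def)
  qed
  also have "\<dots> = (\<Sum>x\<in>?B. \<Sum>j\<in>?C x. ?h x j)"
    using sum.Sigma[OF finB finC, of ?h] by simp
  finally show ?thesis .
qed

text \<open>In the sum, what follows the step at \<open>k\<close> is bounded by \<open>c\<close> and
  not by the marking of that step, so wrongly ordered pairs are included. These match, by the
  exchange, the extra terms that the induction hypothesis produces after a first step with cut k -
  1.\<close>

lemma cnt_cut_bounded:
  assumes "z \<in> W" "c \<le> z k"
  shows "cnt m k (\<lambda>a. a < c) z w = cnt m (k - 1) (\<lambda>a. a < c) z w +
    (if m = 0 then 0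
     else \<Sum>j\<in>{j. k < j \<and> cov z k j \<and> z j < c}. cnt (m - 1) k (\<lambda>a. a < c) (z \<circ> t k j) w)"
  using assms
proof (induction m arbitrary: z c)
  case 0 then show ?case by simp
next
  case (Suc m)
  note z = Suc.prems(1) and zk = Suc.prems(2)
  let ?y = "\<lambda>x. z \<circ> t (fst x) (snd x)" and ?Q = "\<lambda>x a. a < z (snd x)"
  let ?J = "{j. k < j \<and> cov z k j \<and> z j < c}"
  let ?B = "{x \<in> steps (k - 1) z. z (snd x) < c}"
  have finB: "finite ?B" and finJ: "finite ?J"
    using finite_steps[OF z] finite_cov[OF z, of k] by simp_all
  \<comment> \<open>A step with cut \<open>k\<close> either starts at \<open>k\<close> or has cut k
    - 1. The converse needs that \<open>j\<close> is not \<open>k\<close>, which holds because z(j)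
    is below \<open>c\<close> and z(k) is not.\<close>
  have split: "{x \<in> steps k z. z (snd x) < c} = Pair k ` ?J \<union> ?B"
  proof -
    have "(i, j) \<in> {x \<in> steps k z. z (snd x) < c} \<longleftrightarrow> (i, j) \<in> Pair k ` ?J \<union> ?B" for i j
    proof -
      have "i \<le> k \<longleftrightarrow> i = k \<or> i \<le> k - 1" by linarith
      moreover have "k < j \<longleftrightarrow> k - 1 < j" if "z j < c"
        using that zk by (cases "j = k") auto
      ultimately show ?thesis by (auto simp: steps_def)
    qed
    then show ?thesis by (intro set_eqI) (simp only: split_paired_all)
  qed
  have disj: "Pair k ` ?J \<inter> ?B = {}" by (auto simp: steps_def)
  have 1: "cnt (Suc m) k (\<lambda>a. a < c) z w =
      (\<Sum>j\<in>?J. cnt m k (\<lambda>a. a < z j) (z \<circ> t k j) w) + (\<Sum>x\<in>?B. cnt m k (?Q x) (?y x) w)"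
    unfolding cnt.simps split
    using finB finJ disj by (subst sum.union_disjoint) (simp_all add: sum.reindex inj_on_def)
  let ?S = "if m = 0 then 0 else \<Sum>x\<in>?B. \<Sum>j\<in>{j. k < j \<and> cov (?y x) k j \<and> ?y x j < z (snd x)}.
      cnt (m - 1) k (?Q x) (?y x \<circ> t k j) w"
  have 2: "(\<Sum>x\<in>?B. cnt m k (?Q x) (?y x) w) = cnt (Suc m) (k - 1) (\<lambda>a. a < c) z w + ?S"
  proof -
    have "cnt m k (?Q x) (?y x) w = cnt m (k - 1) (?Q x) (?y x) w +
      (if m = 0 then 0 else \<Sum>j\<in>{j. k < j \<and> cov (?y x) k j \<and> ?y x j < z (snd x)}.
        cnt (m - 1) k (?Q x) (?y x \<circ> t k j) w)" if x: "x \<in> ?B" for x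
    proof (rule Suc.IH)
      have xs: "x \<in> steps (k - 1) z" using x by simp
      note d = stepsD[OF z xs]
      show "?y x \<in> W" by (rule d)
      have le: "z (snd x) \<le> z k" using x zk by simp
      \<comment> \<open>The hypothesis for the next element, with the current marking as the new
        bound: the step must not push the value at \<open>k\<close> below it.\<close>
      have "z (snd x) \<le> z (t (fst x) (snd x) k)" using d(4)
      proof (rule t_cases[of "fst x" "snd x" k])
        fix a assume a: "k = fst x + a * int n" "t (fst x) (snd x) k = snd x + a * int n"
        then have "a * int n > 0" using d(1) by linarith
        then show "z (snd x) \<le> z (t (fst x) (snd x) k)" using W_per[OF z, of "snd x" a] unfolding a(2) by simp
      next
        fix a assume a: "k = snd x + a * int n" "t (fst x) (snd x) k = fst x + a * int n"
        then have "z k = z (snd x) + a * int n" using W_per[OF z] by simp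
        then have "a * int n \<ge> 0" using le by simp
        then show "z (snd x) \<le> z (t (fst x) (snd x) k)" using W_per[OF z, of "fst x" a] d(5) unfolding a(2) by simp
      qed (use le in simp)
      then show "z (snd x) \<le> ?y x k" by simp
    qed
    then show ?thesis by (simp add: sum.distrib)
  qed
  have 3: "cnt m k (\<lambda>a. a < c) (z \<circ> t k j) w = cnt m k (\<lambda>a. a < z j) (z \<circ> t k j) w +
        (\<Sum>x\<in>{x \<in> steps k (z \<circ> t k j). (z \<circ> t k j) (snd x) < c \<and> z j < (z \<circ> t k j) (snd x)}.
          cnt m' k (\<lambda>a. a < (z \<circ> t k j) (snd x)) (z \<circ> t k j \<circ> t (fst x) (snd x)) w)"
    if j: "j \<in> ?J" and Suc: "m = Suc m'" for j m'
  proof -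
    let ?v = "z \<circ> t k j"
    have v: "?v \<in> W" using j cov_W[OF z] by blast
    let ?f = "\<lambda>x. cnt m' k (\<lambda>a. a < ?v (snd x)) (?v \<circ> t (fst x) (snd x)) w"
    \<comment> \<open>After the step the value z(j) sits at position \<open>k\<close>, while
      markings are read strictly to the right of \<open>k\<close>; hence no marking equals
      z(j).\<close>
    have "?v k = z j" by (simp add: t_ends)
    then have ne: "?v (snd x) \<noteq> z j" if "x \<in> steps k ?v" for x
      using that W_inj[OF v, of "snd x" k] by (auto simp: steps_def)
    have "{x \<in> steps k ?v. ?v (snd x) < c} = {x \<in> steps k ?v. ?v (snd x) < z j} \<union>
        {x \<in> steps k ?v. ?v (snd x) < c \<and> z j < ?v (snd x)}"
    proof (intro set_eqI iffI)
      fix x assume "x \<in> {x \<in> steps k ?v. ?v (snd x) < c}"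
      then show "x \<in> {x \<in> steps k ?v. ?v (snd x) < z j} \<union> {x \<in> steps k ?v. ?v (snd x) < c \<and> z j < ?v (snd x)}"
        using ne[of x] by (cases "?v (snd x) < z j") auto
    qed (use j in auto)
    then have "sum ?f {x \<in> steps k ?v. ?v (snd x) < c} = sum ?f {x \<in> steps k ?v. ?v (snd x) < z j} +
        sum ?f {x \<in> steps k ?v. ?v (snd x) < c \<and> z j < ?v (snd x)}"
      using finite_steps[OF v] by (simp only:) (rule sum.union_disjoint, auto)
    then show ?thesis by (simp add: Suc)
  qed
  show ?case
  proof (cases m)
    case 0
    then show ?thesis using 1 2 by simp
  next
    case (Suc m')
    have "(\<Sum>j\<in>?J. cnt m k (\<lambda>a. a < c) (z \<circ> t k j) w) =
      (\<Sum>j\<in>?J. cnt m k (\<lambda>a. a < z j) (z \<circ> t k j) w) +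
      (\<Sum>j\<in>?J. \<Sum>x\<in>{x \<in> steps k (z \<circ> t k j). (z \<circ> t k j) (snd x) < c \<and> z j < (z \<circ> t k j) (snd x)}.
          cnt m' k (\<lambda>a. a < (z \<circ> t k j) (snd x)) (z \<circ> t k j \<circ> t (fst x) (snd x)) w)"
      unfolding sum.distrib[symmetric] by (rule sum.cong[OF refl 3[OF _ Suc]])
    also have "(\<Sum>j\<in>?J. \<Sum>x\<in>{x \<in> steps k (z \<circ> t k j). (z \<circ> t k j) (snd x) < c \<and> z j < (z \<circ> t k j) (snd x)}.
          cnt m' k (\<lambda>a. a < (z \<circ> t k j) (snd x)) (z \<circ> t k j \<circ> t (fst x) (snd x)) w) = ?S"
      using exchange_sum[OF z zk, of "\<lambda>b y. cnt m' k (\<lambda>a. a < b) y w"] Suc by simp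
    finally have 4: "(\<Sum>j\<in>?J. cnt m k (\<lambda>a. a < c) (z \<circ> t k j) w) =
      (\<Sum>j\<in>?J. cnt m k (\<lambda>a. a < z j) (z \<circ> t k j) w) + ?S" .
    have "cnt (Suc m) k (\<lambda>a. a < c) z w = cnt (Suc m) (k - 1) (\<lambda>a. a < c) z w +
      (\<Sum>j\<in>?J. cnt m k (\<lambda>a. a < c) (z \<circ> t k j) w)"
      unfolding 1 2 4 by (simp only: add_ac)
    then show ?thesis by simp
  qed
qed

text \<open>Periodicity allows moving to the right by \<open>n\<close> until less than
  \<open>n\<close> remains; from there single steps suffice, since no position strictly between k -
  n and k has the residue of a descent.\<close>

lemma grassmannian_le:
  assumes u: "u \<in> W" and gr: "\<And>p. desc u p \<Longrightarrow> p \<approx> k" and "i \<le> k"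
  shows "u i \<le> u k"
  using assms(3)
proof (induction "nat (k - i)" arbitrary: i rule: less_induct)
  case less
  show ?case
  proof (cases "i = k")
    case False
    then have "i < k" using less.prems by simp
    show ?thesis
    proof (cases "i + int n \<le> k")
      case True
      then have "u (i + int n) \<le> u k" using n0 less by simp
      then show ?thesis using W_per[OF u, of i 1] by simp
    next
      case out: False
      then have "\<not> i \<approx> k" using cg_near[of i k] \<open>i < k\<close> by auto
      then have "u i \<le> u (i + 1)" using gr by (force simp: desc_def)
      also have "\<dots> \<le> u k" using less \<open>i < k\<close> by simp
      finally show ?thesis .
    qed
  qed simp
qed

text \<open>Since \<open>u\<close> has descents only at the cut, all markings below it are less than \<open>u k\<close>, so the bounded
  formula applies.\<close>

lemma cnt_cut:
  assumes u: "u \<in> W" and gr: "\<And>p. desc u p \<Longrightarrow> p \<approx> k"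
  shows "cnt (Suc m) k (\<lambda>_. True) u w = cnt (Suc m) (k - 1) (\<lambda>_. True) u w +
    (\<Sum>j\<in>{j. k < j \<and> cov u k j}. cnt m k (\<lambda>_. True) (u \<circ> t k j) w)"
proof -
  let ?Q = "\<lambda>a. a < u k"
  have le: "u i \<le> u k" if "i \<le> k" for i using grassmannian_le[OF u gr that] .
  have Q: "u (snd x) < u k" if "x \<in> steps k u" for x
    using stepsD[OF u that] le[of "fst x"] by simp
  have Q': "u (snd x) < u k" if "x \<in> steps (k - 1) u" for x
    using stepsD[OF u that] le[of "fst x"] by simp
  have QJ: "u j < u k" if "k < j" "cov u k j" for j
    using cov_inv_less[OF u that(2,1)] .
  have Qv: "(u \<circ> t k j) (snd x) < u k" if j: "k < j" "cov u k j" and x: "x \<in> steps k (u \<circ> t k j)" for j x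
  proof -
    have v: "u \<circ> t k j \<in> W" by (rule cov_W[OF u j(2)])
    have kj: "\<not> k \<approx> j" by (rule cov_cong[OF j(2)])
    note d = stepsD[OF v x]
    have "u (t k j (fst x)) \<le> u k" using kj
    proof (rule t_cases[of k j "fst x"])
      fix a assume a: "fst x = k + a * int n" "t k j (fst x) = j + a * int n"
      then have "a * int n \<le> 0" using d(1) by simp
      then show "u (t k j (fst x)) \<le> u k" using W_per[OF u, of j a] QJ[OF j] unfolding a(2) by simp
    next
      fix a assume a: "fst x = j + a * int n" "t k j (fst x) = k + a * int n"
      then have "a * int n \<le> 0" using d(1) j(1) by linarith
      then show "u (t k j (fst x)) \<le> u k" using W_per[OF u, of k a] unfolding a(2) by simp
    qed (use le d in simp)
    then show ?thesis using d(5) by simp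
  qed
  have "cnt (Suc m) k (\<lambda>_. True) u w = cnt (Suc m) k ?Q u w" by (rule cnt_cong) (use Q in simp)
  also have "\<dots> = cnt (Suc m) (k - 1) ?Q u w +
      (\<Sum>j\<in>{j. k < j \<and> cov u k j \<and> u j < u k}. cnt m k ?Q (u \<circ> t k j) w)"
    using cnt_cut_bounded[OF u order_refl, of "Suc m" k w] by simp
  also have "cnt (Suc m) (k - 1) ?Q u w = cnt (Suc m) (k - 1) (\<lambda>_. True) u w"
    by (rule cnt_cong) (use Q' in simp)
  also have "{j. k < j \<and> cov u k j \<and> u j < u k} = {j. k < j \<and> cov u k j}" using QJ by blast
  also have "(\<Sum>j\<in>{j. k < j \<and> cov u k j}. cnt m k ?Q (u \<circ> t k j) w) =
      (\<Sum>j\<in>{j. k < j \<and> cov u k j}. cnt m k (\<lambda>_. True) (u \<circ> t k j) w)"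
    by (intro sum.cong refl cnt_cong) (use Qv in auto)
  finally show ?thesis .
qed

section \<open>Strong strips as sets of paths, and their number\<close>

definition paths :: "nat \<Rightarrow> (int \<Rightarrow> bool) \<Rightarrow> (int \<Rightarrow> int) \<Rightarrow> (int \<Rightarrow> int) \<Rightarrow> (int \<times> (int \<Rightarrow> int)) list set" where
  "paths m Q u w = {p. marked_path n u p \<and> sorted_wrt (>) (map fst p) \<and>
     (\<forall>a\<in>set (map fst p). Q a) \<and> length p = m \<and> last (u # map snd p) = w}"

lemma marked_cover_iff:
  assumes u: "u \<in> W"
  shows "marked_cover n u a v \<longleftrightarrow> (\<exists>x\<in>steps 0 u. a = u (snd x) \<and> v = u \<circ> t (fst x) (snd x))"
proof
  assume "marked_cover n u a v"
  then obtain i j where ij: "i \<le> 0" "0 < j" "\<not> i \<approx> j" "u = v \<circ> t i j" "len u = len v + 1" "a = u j"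
    by (auto simp: marked_cover_def bruhat_cover_def)
  have "v = u \<circ> t i j" using ij(3,4) by (simp add: comp_assoc t_comp_t)
  then show "\<exists>x\<in>steps 0 u. a = u (snd x) \<and> v = u \<circ> t (fst x) (snd x)"
    using ij by (intro bexI[of _ "(i, j)"]) (auto simp: steps_def cov_def)
next
  assume "\<exists>x\<in>steps 0 u. a = u (snd x) \<and> v = u \<circ> t (fst x) (snd x)"
  then obtain x where x: "x \<in> steps 0 u" "a = u (snd x)" and v: "v = u \<circ> t (fst x) (snd x)" by blast
  note d = stepsD[OF u x(1)]
  have vW: "v \<in> W" using d v by simp
  have uv: "u = v \<circ> t (fst x) (snd x)" using d(4) by (simp add: v comp_assoc t_comp_t)
  have l: "len u = len v + 1" using d(3) by (simp add: cov_def v)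
  have "bruhat_step n v u"
    unfolding bruhat_step_def using vW u l uv d(1,2,4) by (metis less_add_one order_le_less_trans)
  then have "bruhat_cover n v u" using l by (simp add: bruhat_cover_def bruhat_less_def)
  moreover have "v (fst x) = u (snd x)" by (simp add: v t_ends)
  ultimately have "fst x \<le> 0 \<and> 0 < snd x \<and> \<not> fst x \<approx> snd x \<and> u = v \<circ> t (fst x) (snd x) \<and>
      bruhat_cover n v u \<and> a = u (snd x) \<and> a = v (fst x)"
    using uv d(1,2,4) x(2) by simp
  then show "marked_cover n u a v"
    unfolding marked_cover_def using u vW by blast
qed

lemma paths_Suc:
  assumes u: "u \<in> W" and Q: "\<And>a b. Q a \<Longrightarrow> b < a \<Longrightarrow> Q b"
  shows "paths (Suc m) Q u w = (\<Union>x\<in>{x \<in> steps 0 u. Q (u (snd x))}.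
    (#) (u (snd x), u \<circ> t (fst x) (snd x)) ` paths m (\<lambda>a. a < u (snd x)) (u \<circ> t (fst x) (snd x)) w)"
  (is "?L = ?R")
proof
  show "?L \<subseteq> ?R"
  proof
    fix p assume p: "p \<in> ?L"
    then obtain a v q where pq: "p = (a, v) # q" by (cases p) (auto simp: paths_def)
    from p have "marked_cover n u a v" by (simp add: paths_def pq)
    then obtain x where x: "x \<in> steps 0 u" "a = u (snd x)" "v = u \<circ> t (fst x) (snd x)"
      using marked_cover_iff[OF u] by blast
    have "q \<in> paths m (\<lambda>a. a < u (snd x)) v w" "Q (u (snd x))"
      using p x(2) by (auto simp: paths_def pq)
    then show "p \<in> ?R" using x pq by blast
  qed
  show "?R \<subseteq> ?L"
  proof
    fix p assume "p \<in> ?R"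
    then obtain x q where x: "x \<in> steps 0 u" "Q (u (snd x))"
      and p: "p = (u (snd x), u \<circ> t (fst x) (snd x)) # q"
      and q: "q \<in> paths m (\<lambda>a. a < u (snd x)) (u \<circ> t (fst x) (snd x)) w" by blast
    have "marked_cover n u (u (snd x)) (u \<circ> t (fst x) (snd x))"
      using marked_cover_iff[OF u] x(1) by blast
    then show "p \<in> ?L" using q x(2) Q by (auto simp: paths_def p)
  qed
qed

text \<open>Different steps yield different first entries: the marking u(j) determines
  \<open>j\<close>, and it is also the value at \<open>i\<close> of the next element, which
  determines \<open>i\<close>. As \<open>Q\<close> is closed downwards, imposing it on all markings
  of a path amounts to imposing it on the first.\<close>

lemma card_paths:
  assumes "u \<in> W" and "\<And>a b. Q a \<Longrightarrow> b < a \<Longrightarrow> Q b"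
  shows "finite (paths m Q u w) \<and> card (paths m Q u w) = cnt m 0 Q u w"
  using assms
proof (induction m arbitrary: u Q)
  case 0
  have "paths 0 Q u w = (if u = w then {[]} else {})" using 0 by (auto simp: paths_def)
  then show ?case by simp
next
  case (Suc m)
  note u = Suc.prems(1)
  let ?X = "{x \<in> steps 0 u. Q (u (snd x))}"
  let ?v = "\<lambda>x. u \<circ> t (fst x) (snd x)"
  let ?P = "\<lambda>x. (#) (u (snd x), ?v x) ` paths m (\<lambda>a. a < u (snd x)) (?v x) w"
  have IH: "finite (paths m (\<lambda>a. a < u (snd x)) (?v x) w) \<and>
      card (paths m (\<lambda>a. a < u (snd x)) (?v x) w) = cnt m 0 (\<lambda>a. a < u (snd x)) (?v x) w"
    if "x \<in> ?X" for x
    by (rule Suc.IH[OF stepsD(6)[OF u]]) (use that in auto)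
  have finX: "finite ?X" using finite_steps[OF u] by simp
  have eq: "paths (Suc m) Q u w = (\<Union>x\<in>?X. ?P x)" by (rule paths_Suc[OF Suc.prems])
  have inj: "x = y" if "x \<in> ?X" "y \<in> ?X" "u (snd x) = u (snd y)" "?v x = ?v y" for x y
  proof -
    have s: "snd x = snd y" using that(3) W_inj[OF u] by simp
    have vx: "?v x (fst x) = u (snd x)" "?v y (fst y) = u (snd y)" by (simp_all add: t_ends)
    have "?v x \<in> W" using stepsD(6)[OF u] that(1) by blast
    then have "fst x = fst y" using vx that(3,4) W_inj by metis
    then show ?thesis using s by (simp add: prod_eq_iff)
  qed
  have card: "card (?P x) = cnt m 0 (\<lambda>a. a < u (snd x)) (?v x) w" if "x \<in> ?X" for x
    using IH[OF that] by (simp add: card_image)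
  have "card (\<Union>x\<in>?X. ?P x) = (\<Sum>x\<in>?X. card (?P x))"
  proof (rule card_UN_disjoint)
    show "\<forall>x\<in>?X. finite (?P x)" using IH by blast
    show "\<forall>x\<in>?X. \<forall>y\<in>?X. x \<noteq> y \<longrightarrow> ?P x \<inter> ?P y = {}"
    proof (intro ballI impI)
      fix x y assume "x \<in> ?X" "y \<in> ?X" "x \<noteq> y"
      then have "\<not> (u (snd x) = u (snd y) \<and> ?v x = ?v y)" using inj by blast
      then show "?P x \<inter> ?P y = {}" by blast
    qed
  qed (rule finX)
  also have "\<dots> = cnt (Suc m) 0 Q u w" unfolding cnt.simps by (rule sum.cong[OF refl card])
  finally show ?case unfolding eq using finX IH by auto
qed

end

section \<open>The Pieri formula\<close>

text \<open>The constant term is the substitution of 0 for every variable, which makes it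
  multiplicative.\<close>

lemma subst_pol_zero: "subst_pol (\<lambda>_. 0) p = of_int (Poly_Mapping.lookup p 0)"
proof -
  have "(\<Prod>j\<in>Poly_Mapping.keys t. 0 ^ Poly_Mapping.lookup t j) = (if t = 0 then 1 else 0 :: mpol)"
    for t :: "nat \<Rightarrow>\<^sub>0 nat"
  proof (cases "t = 0")
    case False
    then obtain j where "j \<in> Poly_Mapping.keys t" by (metis all_not_in_conv keys_eq_empty)
    then have "(\<Prod>j\<in>Poly_Mapping.keys t. 0 ^ Poly_Mapping.lookup t j) = (0 :: mpol)"
      by (intro prod_zero bexI[of _ j]) (auto simp: in_keys_iff power_0_left)
    then show ?thesis using False by simp
  qed simp
  then have "subst_pol (\<lambda>_. 0) p =
      (\<Sum>t\<in>Poly_Mapping.keys p. if t = 0 then of_int (Poly_Mapping.lookup p t) else 0)"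
    unfolding subst_pol_def by (intro sum.cong) simp_all
  also have "\<dots> = of_int (Poly_Mapping.lookup p 0)" by (simp add: in_keys_iff)
  finally show ?thesis .
qed

lemma lookup_of_int_0: "Poly_Mapping.lookup (of_int c :: mpol) 0 = c"
  by (simp flip: single_of_int)

lemma constant_term_mult:
  "Poly_Mapping.lookup (p * q :: mpol) 0 = Poly_Mapping.lookup p 0 * Poly_Mapping.lookup q 0"
  using subst_pol_mult[of "\<lambda>_. 0" p q] lookup_of_int_0 unfolding subst_pol_zero
  by (metis of_int_mult)

lemma constant_term_e_wt: "Poly_Mapping.lookup (e_wt n x) 0 = 0"
proof -
  have "Poly_Mapping.single j (1 :: nat) \<noteq> 0" for j :: nat
    by (metis lookup_single_eq lookup_zero one_neq_zero)
  then have "Poly_Mapping.lookup (Var j) 0 = 0" for j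
    unfolding Var_def by (simp only: lookup_single when_def) simp
  then show ?thesis by (simp add: e_wt_def Let_def lookup_sum)
qed

text \<open>A relation and not an equation for \<open>phi\<close>, because it also records that the
  fraction is a polynomial; outside the polynomials \<open>phi\<close> has no meaning.\<close>

definition has_const :: "mpol fract \<Rightarrow> int \<Rightarrow> bool" where
  "has_const q c \<longleftrightarrow> (\<exists>a. q = Fract a 1 \<and> Poly_Mapping.lookup a 0 = c)"

lemma has_const_phi: "has_const q c \<Longrightarrow> phi q = c"
  by (auto simp: has_const_def phi_Fract)

lemma has_const_0: "has_const 0 0"
  unfolding has_const_def by (rule exI[of _ 0]) (simp add: Zero_fract_def)

lemma has_const_1: "has_const 1 1"
  unfolding has_const_def using lookup_of_int_0[of 1] by (intro exI[of _ 1]) (simp add: One_fract_def)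

lemma has_const_add: "has_const p c \<Longrightarrow> has_const q d \<Longrightarrow> has_const (p + q) (c + d)"
  unfolding has_const_def by (force simp: lookup_add)

lemma has_const_diff: "has_const p c \<Longrightarrow> has_const q d \<Longrightarrow> has_const (p - q) (c - d)"
  unfolding has_const_def by (force simp: lookup_minus)

lemma has_const_mult: "has_const p c \<Longrightarrow> has_const q d \<Longrightarrow> has_const (p * q) (c * d)"
  unfolding has_const_def by (force simp: constant_term_mult)

lemma has_const_sum: "(\<And>x. x \<in> A \<Longrightarrow> has_const (f x) (g x)) \<Longrightarrow> has_const (sum f A) (sum g A)"
  by (induction A rule: infinite_finite_induct) (auto intro: has_const_0 has_const_add)

text \<open>The automorphism \<omega> as a total function, an involution without side conditions of
  membership.\<close>

definition flip :: "(int \<Rightarrow> int) \<Rightarrow> int \<Rightarrow> int" where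
  "flip u x = 1 - u (1 - x)"

lemma flip_flip [simp]: "flip (flip u) = u" by (simp add: flip_def fun_eq_iff)

lemma flip_comp: "flip (u \<circ> v) = flip u \<circ> flip v" by (simp add: flip_def fun_eq_iff)

lemma flip_id [simp]: "flip id = id" by (simp add: flip_def fun_eq_iff)

lemma flip_inject [simp]: "flip u = flip v \<longleftrightarrow> u = v" by (metis flip_flip)

section \<open>Transport by the automorphism and the constant terms\<close>

context affine_sym
begin

lemma flip_in_W [simp]: "flip u \<in> W \<longleftrightarrow> u \<in> W"
proof -
  have "flip v \<in> W" if "v \<in> W" for v
    using flip_in_W_af[OF n0 that] by (simp add: flip_def[abs_def])
  then show ?thesis by (metis flip_flip)
qed

lemma cg_minus: "a - x \<approx> b \<longleftrightarrow> x \<approx> a - b"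
proof -
  have "a - x - b = - (x - (a - b))" by simp
  then show ?thesis unfolding cong_iff_dvd_diff by (simp only: dvd_minus_iff)
qed

lemma flip_t: "flip (t i j) = t (1 - i) (1 - j)"
proof
  fix x
  have "1 - x \<approx> i \<longleftrightarrow> x \<approx> 1 - i" "1 - x \<approx> j \<longleftrightarrow> x \<approx> 1 - j" by (rule cg_minus)+
  then show "flip (t i j) x = t (1 - i) (1 - j) x" by (simp add: flip_def refl_af_def)
qed

lemma flip_s: "flip (s p) = s (- p)"
proof -
  have "\<not> - p \<approx> 1 - p" using not_cg_Suc(2)[of "- p"] by simp
  then show ?thesis using t_sym[of "- p" "1 - p"] by (simp add: s_eq flip_t)
qed

lemma flip_word: "flip (word_prod n is) = word_prod n (map uminus is)"
  by (induction "is") (simp_all only: word_prod_Nil word_prod_Cons flip_id flip_comp flip_s list.map)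

lemma len_flip [simp]: assumes "u \<in> W" shows "len (flip u) = len u"
proof -
  have "len (flip v) \<le> len v" if v: "v \<in> W" for v
  proof -
    obtain "is" where "word_prod n is = v" "length is = len v"
      using ex_reduced[OF v] by (auto simp: reduced_word_def)
    then show ?thesis using len_word_le[of "map uminus is"] flip_word[of "is"] by simp
  qed
  from this[OF assms] this[of "flip u"] show ?thesis using assms by simp
qed

lemma desc_flip: "desc (flip u) p \<longleftrightarrow> desc u (- p)"
  by (simp add: desc_def flip_def algebra_simps)

lemma cov_flip: "u \<in> W \<Longrightarrow> cov (flip u) (1 - i) (1 - j) \<longleftrightarrow> cov u i j"
proof -
  assume u: "u \<in> W"
  have "flip u \<circ> t (1 - i) (1 - j) = flip (u \<circ> t i j)" by (simp add: flip_comp flip_t)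
  moreover have "1 - i \<approx> 1 - j \<longleftrightarrow> i \<approx> j" using cg_minus[of 1 i "1 - j"] by simp
  ultimately show ?thesis using u comp_t_in_W[of i j u] by (auto simp: cov_def)
qed

text \<open>The cut is arbitrary in both inductions: the change of cut uses the claim for the same
  \<open>u\<close> at k + 1, and the claims for one letter less at k.\<close>

lemma pstr_const:
  assumes "u \<in> W" "w \<in> W"
  shows "has_const (kk.pstr (rr m k) w u) (int (cnt m (- k) (\<lambda>_. True) (flip u) (flip w)))"
  using assms
proof (induction m arbitrary: u w k)
  case 0
  have "has_const (kk.pstr (rr 0 k) w u) (int (cnt 0 (- k) (\<lambda>_. True) (flip u) (flip w)))"
    using kk.pstr_id[OF 0(2,1)] has_const_0 has_const_1 by (auto simp: eq_commute[of w u])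
  then show ?case .
next
  case (Suc m)
  let ?P = "\<lambda>k w u. kk.pstr (rr (Suc m) k) w u"
  let ?N = "\<lambda>k u w. int (cnt (Suc m) (- k) (\<lambda>_. True) (flip u) (flip w))"
  from Suc.prems have "has_const (?P k w u) (?N k u w)"
  proof (induction "len u" arbitrary: u w k rule: less_induct)
    case less
    note u = less.prems(1) and w = less.prems(2)
    have IH: "has_const (?P k w' u') (?N k u' w')" if "len u' < len u" "u' \<in> W" "w' \<in> W" for u' w' k
      using less.hyps[OF that] .
    have A: "has_const (?P k w u) (?N k u w)" if p: "desc u p" "\<not> p \<approx> k" for k p
    proof -
      have P: "?P k w u = (if desc w p then ?P k (w \<circ> s p) (u \<circ> s p) else 0)"
        using u w p rr_not_desc[OF p(2)] by (intro kk.pstr_desc) simp_all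
      have "\<not> - p \<approx> - k" using p(2) cg_minus[of 0 p "- k"] by simp
      then have "cnt (Suc m) (- k) (\<lambda>_. True) (flip u) (flip w) = (if desc (flip w) (- p) then
          cnt (Suc m) (- k) (\<lambda>_. True) (flip u \<circ> s (- p)) (flip w \<circ> s (- p)) else 0)"
        using u w p by (intro cnt_desc) (simp_all add: desc_flip)
      then have N: "?N k u w = (if desc w p then ?N k (u \<circ> s p) (w \<circ> s p) else 0)"
        by (simp only: desc_flip flip_comp flip_s minus_minus) simp
      have "has_const (?P k (w \<circ> s p) (u \<circ> s p)) (?N k (u \<circ> s p) (w \<circ> s p))"
        using u w len_comp_s_desc[OF u p(1)] by (intro IH) simp_all
      then show ?thesis unfolding P N using has_const_0 by simp
    qed
    have "has_const (?P k w u) (?N k u w)"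
    proof (cases "\<exists>p. desc u p \<and> \<not> p \<approx> k")
      case True
      then show ?thesis using A by blast
    next
      case False
      then have gr: "\<And>p. desc u p \<Longrightarrow> p \<approx> k" by blast
      show ?thesis
      proof (cases "u = id")
        case True
        have "cnt (Suc m) (- k) (\<lambda>_. True) (flip u) (flip w) = 0"
          using cnt_nonzero[of "flip u" "Suc m" "- k" "\<lambda>_. True" "flip w"] u True by fastforce
        then show ?thesis using kk.pstr_at_id[OF rr_Suc_not_id] has_const_0 True by simp
      next
        case id: False
        then obtain p where p: "desc u p" using ex_desc[OF u] by blast
        have "desc u k" using desc_cong[OF u gr[OF p]] p by simp
        from A[OF this, of "k + 1"] have up: "has_const (?P (k + 1) w u) (?N (k + 1) u w)" by simp
        have fgr: "\<And>p. desc (flip u) p \<Longrightarrow> p \<approx> - k"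
          using gr cg_minus[of 0 _ k] by (force simp: desc_flip)
        have fu: "flip u \<in> W" using u by simp
        \<comment> \<open>To the right of the cut a Grassmannian \<open>u\<close> takes its least
          value at k + 1, so no cover pairs k + 1 with a larger position.\<close>
        have lt: "j < k + 1" if c: "cov u (k + 1) j" for j
        proof (rule ccontr)
          assume "\<not> ?thesis"
          then have "1 - j \<le> - k" "k + 1 < j" using cov_cong[OF c] by (auto, cases "j = k + 1", auto)
          then have "u (k + 1) \<le> u j" using grassmannian_le[OF fu fgr, of "1 - j"]
            by (simp add: flip_def add.commute)
          then show False using cov_inv_less[OF u c] \<open>k + 1 < j\<close> by simp
        qed
        let ?C = "{j. cov u (k + 1) j}"
        let ?p = "\<lambda>j. kk.pstr (rr m k) w (u \<circ> t (k + 1) j)"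
        have neg: "(\<Sum>j\<in>?C. of_int (sgn (j - (k + 1))) * ?p j) = - (\<Sum>j\<in>?C. ?p j)"
          unfolding sum_negf[symmetric]
        proof (rule sum.cong[OF refl])
          fix j assume "j \<in> ?C"
          then have "sgn (j - (k + 1)) = -1" using lt[of j] by (simp add: sgn_if)
          then show "of_int (sgn (j - (k + 1))) * ?p j = - ?p j" by (simp only:) simp
        qed
        have solve: "b = a + t - c" if "a = b + c + s" "s = - t" for a b c s t :: "mpol fract"
          using that by simp
        have P: "?P k w u = ?P (k + 1) w u + (\<Sum>j\<in>?C. ?p j) -
            (wt (u (k + 1)) - wt (rr m k (k + 1))) * kk.pstr (rr m k) w u"
          by (rule solve[OF kk.pstr_rr_step[OF u] neg])
        have "{j. - k < j \<and> cov (flip u) (- k) j} = (\<lambda>j. 1 - j) ` ?C"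
        proof -
          have *: "j \<in> {j. - k < j \<and> cov (flip u) (- k) j} \<longleftrightarrow> 1 - j \<in> ?C" for j
            using cov_flip[OF u, of "k + 1" "1 - j"] lt[of "1 - j"] by auto
          show ?thesis
          proof (intro equalityI subsetI)
            fix j assume "j \<in> {j. - k < j \<and> cov (flip u) (- k) j}"
            with * show "j \<in> (\<lambda>j. 1 - j) ` ?C" by (intro image_eqI[of _ _ "1 - j"]) auto
          next
            fix j assume "j \<in> (\<lambda>j. 1 - j) ` ?C"
            then have "1 - j \<in> ?C" by auto
            then show "j \<in> {j. - k < j \<and> cov (flip u) (- k) j}" using * by blast
          qed
        qed
        then have "(\<Sum>j\<in>{j. - k < j \<and> cov (flip u) (- k) j}. cnt m (- k) (\<lambda>_. True) (flip u \<circ> t (- k) j) (flip w)) =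
            (\<Sum>j\<in>?C. cnt m (- k) (\<lambda>_. True) (flip u \<circ> t (- k) (1 - j)) (flip w))"
          by (simp add: sum.reindex inj_on_def)
        also have "\<dots> = (\<Sum>j\<in>?C. cnt m (- k) (\<lambda>_. True) (flip (u \<circ> t (k + 1) j)) (flip w))"
          by (simp add: flip_comp flip_t)
        finally have N: "?N k u w = ?N (k + 1) u w +
            (\<Sum>j\<in>?C. int (cnt m (- k) (\<lambda>_. True) (flip (u \<circ> t (k + 1) j)) (flip w)))"
          using cnt_cut[OF fu fgr, of m "flip w"] by (simp del: cnt.simps)
        \<comment> \<open>A difference of two linear forms; it annihilates whatever constant term
          its cofactor has.\<close>
        have "has_const (wt (u (k + 1)) - wt (rr m k (k + 1))) 0"
          unfolding has_const_def wt_def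
          by (rule exI[of _ "e_wt n (u (k + 1)) - e_wt n (rr m k (k + 1))"])
            (simp add: lookup_minus constant_term_e_wt)
        from has_const_mult[OF this Suc.IH[OF u w, of k]]
        have z: "has_const ((wt (u (k + 1)) - wt (rr m k (k + 1))) * kk.pstr (rr m k) w u) 0" by simp
        have "has_const (\<Sum>j\<in>?C. ?p j)
            (\<Sum>j\<in>?C. int (cnt m (- k) (\<lambda>_. True) (flip (u \<circ> t (k + 1) j)) (flip w)))"
          by (rule has_const_sum) (use Suc.IH w cov_W[OF u] in blast)
        from has_const_diff[OF has_const_add[OF up this] z] show ?thesis unfolding P N by simp
      qed
    qed
    then show ?case .
  qed
  then show ?case .
qed

section \<open>Assembly in the cohomology ring\<close>

lemma rr_word: "rr m k = word_prod n (rev (map (\<lambda>i. k - int i) [0..<m]))"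
proof (induction m arbitrary: k)
  case 0 then show ?case by (simp add: word_prod_Nil)
next
  case (Suc m)
  have "[0..<Suc m] = 0 # map Suc [0..<m]" by (simp add: map_Suc_upt upt_conv_Cons)
  then have "rev (map (\<lambda>i. k - int i) [0..<Suc m]) = rev (map (\<lambda>i. k - 1 - int i) [0..<m]) @ [k]"
    by (simp only: list.map map_map rev.simps) (simp add: o_def algebra_simps)
  then show ?case by (simp only: rr.simps(2) Suc word_prod_snoc)
qed

lemma omega_af_flip: "w \<in> W \<Longrightarrow> omega_af n w = flip w"
  by (simp add: omega_af_eq[OF n2] flip_def[abs_def])

lemma rho_in_W: "rho_af n m \<in> W" by (simp add: rho_af_def)

text \<open>\<open>flip\<close> negates the indices of the letters, so s_(m-1) ... s_0 becomes
  s_(1-m) ... s_0.\<close>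

lemma omega_rho: "omega_af n (rho_af n m) = rr m 0"
proof -
  have "omega_af n (rho_af n m) = flip (rho_af n m)" by (rule omega_af_flip[OF rho_in_W])
  also have "\<dots> = rr m 0" unfolding rho_af_def flip_word rr_word by (simp add: rev_map[symmetric] o_def)
  finally show ?thesis .
qed

lemma phi_p_const:
  assumes "u \<in> W" "w \<in> W"
  shows "phi (p_const n (rr m 0) w u) = int (cnt m 0 (\<lambda>_. True) (flip u) (flip w))"
  using has_const_phi[OF pstr_const[OF assms, of m 0]] p_const_eq[OF assms(1) rr_in_W assms(2)]
  by simp

text \<open>The start of a strip is longer than its end by the number of steps, so all starts lie in
  one ball; this is where finiteness comes from.\<close>

lemma strips_eq_paths:
  assumes "w \<in> W"
  shows "{S. strong_strip n S \<and> strip_size S = m \<and> outside S = w} =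
    (SIGMA u:ball (len w + m). paths m (\<lambda>_. True) u w)"
proof -
  have uW: "u \<in> W" if "marked_path n u p" for u p
    using that by (cases p) (auto simp: marked_cover_def)
  have ball: "u \<in> ball (len w + m)" if u: "u \<in> W" and p: "p \<in> paths m (\<lambda>_. True) u w" for u p
  proof -
    have "cnt m 0 (\<lambda>_. True) u w \<noteq> 0"
      using card_paths[OF u, of "\<lambda>_. True" m w] p by (metis card_0_eq empty_iff)
    then show ?thesis using cnt_nonzero[OF u] u by (auto simp: ball_def)
  qed
  have iff: "strong_strip n (u, p) \<and> strip_size (u, p) = m \<and> outside (u, p) = w \<longleftrightarrow>
      u \<in> W \<and> p \<in> paths m (\<lambda>_. True) u w" for u p
    unfolding strong_strip_def strip_size_def outside_def paths_def fst_conv snd_conv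
    using uW[of u p] by blast
  show ?thesis
  proof (intro set_eqI)
    fix S :: strip
    obtain u p where S: "S = (u, p)" by fastforce
    have "u \<in> W" if "u \<in> ball (len w + m)" using that by (simp add: ball_def)
    then show "S \<in> {S. strong_strip n S \<and> strip_size S = m \<and> outside S = w} \<longleftrightarrow>
        S \<in> (SIGMA u:ball (len w + m). paths m (\<lambda>_. True) u w)"
      unfolding S mem_Collect_eq mem_Sigma_iff iff using ball by blast
  qed
qed

lemma sum_const_frag: "finite A \<Longrightarrow> (\<Sum>x\<in>A. c) = frag_cmul (int (card A)) c"
  by (induction A rule: finite_induct) (simp_all add: frag_cmul_distrib add.commute)

lemma strong_pieri:
  assumes w: "w \<in> W"
  shows "finite {S. strong_strip n S \<and> strip_size S = m \<and> outside S = omega_af n w} \<and>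
    cup n (xi (omega_af n (rho_af n m))) (xi w) =
      (\<Sum>S\<in>{S. strong_strip n S \<and> strip_size S = m \<and> outside S = omega_af n w}.
         xi (omega_af n (inside S)))"
proof -
  let ?N = "len w + m"
  let ?c = "\<lambda>u. cnt m 0 (\<lambda>_. True) u (flip w)"
  have fw: "flip w \<in> W" using w by simp
  have S: "{S. strong_strip n S \<and> strip_size S = m \<and> outside S = omega_af n w} =
      (SIGMA u:ball ?N. paths m (\<lambda>_. True) u (flip w))"
    unfolding omega_af_flip[OF w] strips_eq_paths[OF fw] using w by simp
  have card: "finite (paths m (\<lambda>_. True) u (flip w)) \<and> card (paths m (\<lambda>_. True) u (flip w)) = ?c u"
    if "u \<in> ball ?N" for u
    by (rule card_paths) (use that in \<open>auto simp: ball_def\<close>)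
  have "(\<Sum>S\<in>(SIGMA u:ball ?N. paths m (\<lambda>_. True) u (flip w)). xi (omega_af n (inside S))) =
      (\<Sum>u\<in>ball ?N. \<Sum>p\<in>paths m (\<lambda>_. True) u (flip w). xi (omega_af n u))"
    using card by (subst sum.Sigma) (auto simp: inside_def case_prod_unfold)
  also have "\<dots> = (\<Sum>u\<in>ball ?N. frag_cmul (int (?c u)) (xi (flip u)))"
    using card by (intro sum.cong) (auto simp: sum_const_frag omega_af_flip ball_def)
  also have "\<dots> = (\<Sum>u\<in>ball ?N. frag_cmul (int (?c (flip u))) (xi u))"
    by (rule sum.reindex_bij_witness[where i = flip and j = flip]) (auto simp: ball_def)
  \<comment> \<open>The index set of \<open>schubert_prod\<close> is the support of the structure
    constants. A nonzero count fixes the length of \<open>u\<close>, so this support lies in the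
    ball.\<close>
  also have "\<dots> = (\<Sum>u\<in>{u \<in> W. phi (p_const n (rr m 0) w u) \<noteq> 0}.
      frag_cmul (phi (p_const n (rr m 0) w u)) (xi u))"
  proof (rule sum.mono_neutral_cong_right[OF finite_ball])
    show "{u \<in> W. phi (p_const n (rr m 0) w u) \<noteq> 0} \<subseteq> ball ?N"
      using cnt_nonzero[of "flip _" m 0 "\<lambda>_. True" "flip w"] w by (force simp: phi_p_const ball_def)
  qed (use w in \<open>auto simp: phi_p_const ball_def\<close>)
  also have "\<dots> = cup n (xi (omega_af n (rho_af n m))) (xi w)"
    by (simp add: cup_def xi_def frag_extend_of omega_rho schubert_prod_def)
  finally have "cup n (xi (omega_af n (rho_af n m))) (xi w) =
      (\<Sum>S\<in>(SIGMA u:ball ?N. paths m (\<lambda>_. True) u (flip w)). xi (omega_af n (inside S)))" by simp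
  moreover have "finite (SIGMA u:ball ?N. paths m (\<lambda>_. True) u (flip w))"
    using card by (intro finite_SigmaI) auto
  ultimately show ?thesis unfolding S by blast
qed

end

theorem theorem6p6:
  fixes n m :: nat and w :: "int \<Rightarrow> int"
  assumes "n \<ge> 2" and "w \<in> W_af n" and "m \<ge> 1"
  shows "finite {S. strong_strip n S \<and> strip_size S = m \<and> outside S = omega_af n w} \<and>
    cup n (xi (omega_af n (rho_af n m))) (xi w) =
      (\<Sum>S\<in>{S. strong_strip n S \<and> strip_size S = m \<and> outside S = omega_af n w}.
         xi (omega_af n (inside S)))"
  by (rule affine_sym.strong_pieri[OF affine_sym.intro[OF assms(1)] assms(2)])

end
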